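(* Let $q$ be a prime and $k$ a natural number. Let $\mathcal{S}_{q,k}$ be the collection of all $k$-element subsets of $\mathbb{Z}$ that contain a $q^{th}$ power modulo almost every prime. Then: (1) The additive subset density of $\mathcal{S}_{q,k}$ is zero. More specifically, there is a positive constant $a_{q,k}$ depending only on $q$ and $k$ such that for every $N\in\mathbb{N}$, the number of $k$-element subsets of $\{-N,\ldots,-1,0,1,\ldots,N\}$ that contain a $q^{th}$ power modulo almost every prime is at most $a_{q,k}N^{k-(1-\frac{1}{q})}$. (2) The multiplicative subset density of $\mathcal{S}_{q,k}$ is zero. More specifically, there is a positive constant $m_{q,k}$ depending only on $q$ and $k$ such that for every $N\in\mathbb{N}$, the number of $k$-element subsets of $\{\pm p_1^{e_1}p_2^{e_2}\cdots p_N^{e_N} : 0\le e_1,\ldots,e_N\le N\}$ that contain a $q^{th}$ power modulo almost every prime is at most $m_{q,k}\frac{N^{Nk}}{q^N}$.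
   Context: Let $\mathbb{P}=\{p_1<p_2<\cdots\}$ be the set of primes ordered by size. For $S\subseteq\mathbb{P}$, its relative density is $d_{\mathbb{P}}(S)=\lim_{N\to\infty}\frac{|S\cap\{1,\ldots,N\}|}{|\mathbb{P}\cap\{1,\ldots,N\}|}$ when the limit exists. An integer $a$ is a $q^{th}$ power modulo a prime $p$ if $a\equiv x^q \pmod p$ for some integer $x$. A set $A\subseteq\mathbb{Z}$ contains a $q^{th}$ power modulo almost every prime if the set $\{p\in\mathbb{P}: A \text{ contains a } q^{th}\text{ power modulo } p\}$ has relative density $1$ in $\mathbb{P}$. Let $[N]=\{-N,\ldots,-1,0,1,\ldots,N\}$ and $[N]^{\times}=\{\pm p_1^{e_1}p_2^{e_2}\cdots p_N^{e_N}: 0\le e_1,\ldots,e_N\le N\}$ (a set with $2(N+1)^N$ elements). For a set $X$, $\mathfrak{P}_k(X)$ denotes the collection of all $k$-element subsets of $X$. The additive subset density of a collection $\mathcal{S}$ of $k$-element subsets of $\mathbb{Z}$ is $D(\mathcal{S})=\lim_{N\to\infty}\frac{|\mathcal{S}\cap\mathfrak{P}_k([N])|}{\binom{2N+1}{k}}$ if the limit exists; its multiplicative subset density is $D^{\times}(\mathcal{S})=\lim_{N\to\infty}\frac{|\mathcal{S}\cap\mathfrak{P}_k([N]^{\times})|}{\binom{2(N+1)^N}{k}}$ if the limit exists. "Density zero" means the limit exists and equals $0$. *)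

theory Defs
  imports "HOL-Analysis.Analysis" "HOL-Number_Theory.Number_Theory" "HOL-Library.Infinite_Set"
begin

text \<open>The i-th prime p_i (1-indexed): p_1 = 2, p_2 = 3, ...\<close>
definition ith_prime :: "nat \<Rightarrow> nat" where
  "ith_prime i = enumerate {p::nat. prime p} (i - 1)"

definition rel_density_primes :: "nat set \<Rightarrow> real \<Rightarrow> bool" where
  "rel_density_primes S L \<longleftrightarrow>
     ((\<lambda>N. real (card (S \<inter> {1..N})) / real (card {p::nat. prime p \<and> p \<le> N})) \<longlonglongrightarrow> L)"

definition is_qth_power_mod :: "nat \<Rightarrow> int \<Rightarrow> nat \<Rightarrow> bool" where
  "is_qth_power_mod q a p \<longleftrightarrow> (\<exists>x::int. [a = x ^ q] (mod int p))"

definition contains_qth_power_ae :: "nat \<Rightarrow> int set \<Rightarrow> bool" where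
  "contains_qth_power_ae q A \<longleftrightarrow>
     rel_density_primes {p::nat. prime p \<and> (\<exists>a\<in>A. is_qth_power_mod q a p)} 1"

definition k_subsets :: "nat \<Rightarrow> 'a set \<Rightarrow> 'a set set" where
  "k_subsets k X = {A. A \<subseteq> X \<and> finite A \<and> card A = k}"

definition S_qk :: "nat \<Rightarrow> nat \<Rightarrow> int set set" where
  "S_qk q k = {A. finite A \<and> card A = k \<and> contains_qth_power_ae q A}"

definition add_box :: "nat \<Rightarrow> int set" where
  "add_box N = {- int N .. int N}"

definition mult_box :: "nat \<Rightarrow> int set" where
  "mult_box N = {s * (\<Prod>i\<in>{1..N}. int (ith_prime i) ^ e i) | s e.
                   s \<in> {1, -1} \<and> (\<forall>i\<in>{1..N}. e i \<le> N)}"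

definition add_subset_density :: "nat \<Rightarrow> int set set \<Rightarrow> real \<Rightarrow> bool" where
  "add_subset_density k S L \<longleftrightarrow>
     ((\<lambda>N. real (card (S \<inter> k_subsets k (add_box N))) / real ((2 * N + 1) choose k)) \<longlonglongrightarrow> L)"

definition mult_subset_density :: "nat \<Rightarrow> int set set \<Rightarrow> real \<Rightarrow> bool" where
  "mult_subset_density k S L \<longleftrightarrow>
     ((\<lambda>N. real (card (S \<inter> k_subsets k (mult_box N))) / real ((2 * (N + 1) ^ N) choose k)) \<longlonglongrightarrow> L)"

end

theory Submission
  imports Defs "Jordan_Normal_Form.Char_Poly" "HOL-Real_Asymp.Real_Asymp"
begin

text \<open>
  Let \<open>A\<close> be a finite set of nonzero integers that are independent modulo \<open>q\<close>-th powers. Then the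
  primes modulo which no element of \<open>A\<close> is a \<open>q\<close>-th power do not have density zero. Hence a set in
  \<open>S_qk q k\<close> contains \<open>0\<close> or satisfies a nontrivial relation \<open>(\<Prod>a\<in>A. a ^ w a) = y ^ q\<close> with all \<open>w a < q\<close>; one
  of its elements is then determined modulo \<open>q\<close>-th powers by the others, which yields both counts.

  The density statement is usually deduced from Chebotarev's theorem. Here it follows from a
  Mertens-type theorem: if \<open>f\<close> is a monic irreducible integer polynomial of degree \<open>n\<close> with \<open>\<rho>(p)\<close> roots
  modulo \<open>p\<close>, then \<open>(\<Sum>p\<le>X. \<rho>(p) ln p / p) = ln X + o(ln X)\<close>. To see this, sum \<open>ln \<bar>N x\<bar>\<close> over the
  \<open>x \<in> \<int>[X]/(f)\<close> with coefficients bounded by \<open>B\<close>. The average is \<open>n ln B\<close> up to a bounded error. On the other hand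
  the ideals \<open>{x. p dvd x(r)}\<close> for the roots \<open>r\<close> of \<open>f\<close> modulo \<open>p\<close> are lattices of index \<open>p\<close> with comparable
  successive minima, so they contain a proportion \<open>1/p\<close> of the points of the box even for \<open>p\<close> up to
  a small multiple of \<open>B ^ n\<close>, while ideals of index at least \<open>p\<^sup>2\<close> contribute little. Applying this to \<open>X ^ q - b\<close>
  for the products \<open>b = (\<Prod>a\<in>A. a ^ w a)\<close>, none of which is a \<open>q\<close>-th power unless \<open>w = 0\<close>, and using the orthogonality of
  characters of order \<open>q\<close> gives the density statement.
\<close>

section \<open>The norm on the order generated by a root of a monic irreducible polynomial\<close>

hide_const (open) Module.smult UnivPoly.coeff UnivPoly.monom Determinants.det Coset.order
no_notation vec_nth (infixl "$" 90)

text \<open>The main term is \<open>ln X\<close>, so every loss of a constant factor inside a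
  logarithm is harmless: the side of the box may be a large constant \<open>c\<close> times
  \<open>b\<close>, which makes lattice counts for \<open>p \<le> b ^ n\<close> as accurate as
  desired. The obstacle is that norms reach size \<open>C1 * B ^ n\<close>, beyond the range of
  those counts; the gap consists of boundedly many dyadic intervals. Since
  \<open>\<int>[X]/(f)\<close> need not be integrally closed, there is no unique factorization of
  ideals; for primes not dividing the discriminant it is replaced by a dichotomy: an ideal above
  \<open>p\<close> belongs to a root of \<open>f\<close> modulo \<open>p\<close> or has index at
  least \<open>p ^ 2\<close>. A second obstacle is the exponent vector \<open>w = 0\<close>: there
  \<open>b = 1\<close>, and \<open>X ^ q - 1\<close> is reducible. Its term is \<open>q - 1\<close>
  at primes congruent to 1 modulo \<open>q\<close> and 0 at other large primes. A contradiction thus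
  needs these primes not to be sparse, a weak case of Dirichlet's theorem that comes from the same
  Mertens theorem applied to a factor of \<open>1 + X + ... + X ^ (q - 1)\<close>. Relative density
  enters by partial summation alone: a set of primes of relative density 0 has weighted sum
  \<open>o(ln X)\<close>.\<close>

abbreviation ceval :: "int poly \<Rightarrow> complex \<Rightarrow> complex" where
  "ceval x z \<equiv> poly (of_int_poly x) z"

lemma ceval_const: "ceval [:c:] z = of_int c"
  by (cases "c = 0") (simp_all add: poly_altdef coeff_map_poly)

lemma monic_division:
  fixes d x :: "int poly"
  assumes "monic d"
  obtains s r where "x = s * d + r" "r = 0 \<or> degree r < degree d"
proof -
  obtain s r where sr: "pseudo_divmod x d = (s, r)" by fastforce
  have "d \<noteq> 0" using assms by auto
  from pseudo_divmod[OF this sr] assms that[of s r] show thesis by (auto simp: mult.commute)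
qed

text \<open>Gauss's lemma: let \<open>m'\<close> be the primitive part of a nonzero integer
  polynomial of least degree vanishing at \<open>z\<close>. Pseudo-division shows that
  \<open>m'\<close> divides a constant multiple of \<open>f\<close>, comparison of contents removes
  the constant, and irreducibility forces \<open>m'\<close> to have the degree of
  \<open>f\<close>.\<close>

lemma irreducible_root_degree:
  fixes f x :: "int poly"
  assumes irr: "irreducible f" and mon: "monic f" and "x \<noteq> 0"
    and "ceval x z = 0" "ceval f z = 0"
  shows "degree f \<le> degree x"
proof -
  define P where "P = (\<lambda>m. m \<noteq> 0 \<and> ceval m z = 0)"
  obtain m where m: "P m" and min: "\<And>y. P y \<Longrightarrow> degree m \<le> degree y"
    using arg_min_nat_lemma[of P x degree] assms(3,4) unfolding P_def by blast
  define m' where "m' = primitive_part m"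
  have m0: "m \<noteq> 0" using m by (simp add: P_def)
  have mm': "m = smult (content m) m'" unfolding m'_def by simp
  have c0: "content m \<noteq> 0" using m0 by simp
  have m'0: "m' \<noteq> 0" using m0 by (simp add: m'_def)
  have cont: "content m' = 1" unfolding m'_def using m0 by simp
  have degm': "degree m' = degree m" by (simp add: m'_def)
  have "ceval m z = of_int (content m) * ceval m' z"
    by (subst mm') (simp add: of_int_hom.map_poly_hom_smult)
  then have evm': "ceval m' z = 0" using m c0 by (auto simp: P_def)
  obtain s r where sr: "pseudo_divmod f m' = (s, r)" by fastforce
  define c where "c = lead_coeff m' ^ (Suc (degree f) - degree m')"
  have eq: "smult c f = m' * s + r" and r: "r = 0 \<or> degree r < degree m'"
    using pseudo_divmod[OF m'0 sr] by (auto simp: c_def)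
  have c: "c \<noteq> 0" using m'0 by (simp add: c_def)
  have "of_int c * ceval f z = ceval m' z * ceval s z + ceval r z"
    using arg_cong[OF eq, of "\<lambda>p. ceval p z"]
    by (simp add: of_int_hom.map_poly_hom_smult of_int_poly_hom.hom_add of_int_poly_hom.hom_mult)
  then have "ceval r z = 0" using assms(5) evm' by simp
  then have "r = 0" using r min[of r] degm' by (cases "r = 0") (auto simp: P_def)
  then have eq: "smult c f = m' * s" using eq by simp
  have "content f = 1" using mon by (metis content_dvd_coeff is_unit_content_iff)
  \<comment> \<open>Both \<open>f\<close> and \<open>m'\<close> are primitive, so the whole constant
    \<open>c\<close> sits in \<open>s\<close> and can be cancelled.\<close>
  then have cs: "\<bar>c\<bar> = content s"
    using arg_cong[OF eq, of content] cont by (simp add: content_mult)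
  have csg: "content s = c * sgn c" using cs by (simp add: abs_sgn)
  have "smult c f = m' * smult (content s) (primitive_part s)" using eq by simp
  also have "\<dots> = smult c (m' * smult (sgn c) (primitive_part s))"
    unfolding csg mult_smult_right by (simp only: smult_smult)
  finally have "smult c f = smult c (m' * smult (sgn c) (primitive_part s))" .
  then have fac: "f = m' * smult (sgn c) (primitive_part s)" using c by (metis smult_cancel)
  have "\<not> is_unit m'"
  proof
    assume "is_unit m'"
    then obtain a where a: "m' = [:a:]" by (metis degree_0_id poly_dvd_1 is_unit_polyE)
    then show False using evm' m'0 by simp
  qed
  then have "is_unit (smult (sgn c) (primitive_part s))"
    using irr fac unfolding irreducible_def by blast
  then have "degree (smult (sgn c) (primitive_part s)) = 0" by (simp add: poly_dvd_1)
  then have "degree f = degree m'" using fac m'0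
    by (metis add.right_neutral degree_mult_eq mult_zero_right degree_0 mon leading_coeff_0_iff zero_neq_one)
  then show ?thesis using min[of x] assms degm' by (auto simp: P_def)
qed

locale monic_irreducible =
  fixes f :: "int poly" and n :: nat
  assumes monic: "monic f" and irr: "irreducible f" and n_def: "n = degree f" and n_pos: "n > 0"
begin

definition Z where "Z = {z. ceval f z = 0}"

lemma ceval_nonzero: "x \<noteq> 0 \<Longrightarrow> degree x < n \<Longrightarrow> z \<in> Z \<Longrightarrow> ceval x z \<noteq> 0"
  using irreducible_root_degree[OF irr monic] n_def by (force simp: Z_def)

lemma rsquarefree_f: "rsquarefree (of_int_poly f :: complex poly)"
proof -
  have "pderiv f \<noteq> 0" using n_pos n_def by (simp add: pderiv_eq_0_iff)
  moreover have "degree (pderiv f) < n" using n_pos n_def by (simp add: degree_pderiv)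
  ultimately show ?thesis using ceval_nonzero[of "pderiv f"]
    by (auto simp: rsquarefree_roots of_int_hom.map_poly_pderiv Z_def)
qed

lemma f_nonzero: "f \<noteq> 0" using n_def n_pos by auto

lemma card_Z: "card Z = n" and finite_Z: "finite Z"
proof -
  have "(of_int_poly f :: complex poly) \<noteq> 0" using f_nonzero by simp
  then show "card Z = n" "finite Z"
    using rsquarefree_f rsquarefree_card_degree[of "of_int_poly f :: complex poly"]
    by (auto simp: Z_def n_def poly_roots_finite)
qed

lemma f_factorization: "of_int_poly f = (\<Prod>z\<in>Z. [:- z, 1:])"
  using complex_poly_decompose_rsquarefree[OF rsquarefree_f] monic by (simp add: Z_def)

text \<open>
  The characteristic polynomial of the integer matrix of multiplication by \<open>- w\<close> on
  \<open>\<int>[X]/(f)\<close>, which the Vandermonde matrix of the roots of \<open>f\<close> diagonalises over the complex numbers.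
\<close>

lemma norm_poly_exists:
  "\<exists>G::int poly. degree G = n \<and> monic G \<and> of_int_poly G = (\<Prod>z\<in>Z. [:ceval w z, 1:])"
proof -
  have "\<exists>r. degree r < n \<and> (\<exists>s. - w * monom 1 i = s * f + r)" for i
  proof -
    obtain s r where "- w * monom 1 i = s * f + r" "r = 0 \<or> degree r < degree f"
      by (rule monic_division[OF monic])
    then show ?thesis using n_def n_pos by (intro exI[of _ r]) auto
  qed
  then obtain r s where degr: "\<And>i. degree (r i) < n"
    and rs: "\<And>i. - w * monom 1 i = s i * f + r i" by metis
  have evr: "ceval (r i) z = - ceval w z * z ^ i" if "z \<in> Z" for z i
  proof -
    have "ceval (- w * monom 1 i) z = ceval (s i * f + r i) z" by (simp only: rs)
    then show ?thesis using that
      by (simp add: Z_def of_int_poly_hom.hom_add of_int_poly_hom.hom_mult of_int_poly_hom.hom_uminus poly_monom)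
  qed
  define B where "B = Matrix.mat n n (\<lambda>(j,i). coeff (r i) j)"
  have B: "B \<in> carrier_mat n n" by (simp add: B_def)
  obtain zs where zs: "distinct zs" "set zs = Z" using finite_distinct_list[OF finite_Z] by blast
  have len: "length zs = n" using zs card_Z distinct_card by fastforce
  define W where "W = Matrix.mat n n (\<lambda>(k,i). (zs ! k) ^ i)"
  define D where "D = Matrix.mat n n (\<lambda>(k,i). if k = i then - ceval w (zs ! k) else 0)"
  define C where "C = (map_mat of_int B :: complex mat)"
  have W: "W \<in> carrier_mat n n" and D: "D \<in> carrier_mat n n" and C: "C \<in> carrier_mat n n"
    using B by (auto simp: W_def D_def C_def)
  \<comment> \<open>Row \<open>k\<close> evaluates at the root \<open>zs ! k\<close>; column
    \<open>i\<close> of \<open>C\<close> is \<open>- w\<close> times the monomial of degree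
    \<open>i\<close>, reduced modulo \<open>f\<close>, and reduction does not change values at
    roots.\<close>
  have WC: "W * C = D * W"
  proof (rule eq_matI)
    fix k i assume ki: "k < dim_row (D * W)" "i < dim_col (D * W)"
    then have k: "k < n" and i: "i < n" using D W by auto
    have zk: "zs ! k \<in> Z" using nth_mem[of k zs] zs(2) len k by simp
    have "(W * C) $$ (k, i) = (\<Sum>j<n. (zs ! k) ^ j * of_int (coeff (r i) j))"
      using k i unfolding W_def C_def B_def by (simp add: scalar_prod_def atLeast0LessThan)
    also have "\<dots> = ceval (r i) (zs ! k)"
    proof -
      have "ceval (r i) (zs ! k) = (\<Sum>j\<le>degree (r i). of_int (coeff (r i) j) * (zs ! k) ^ j)"
        by (simp add: poly_altdef)
      also have "\<dots> = (\<Sum>j<n. of_int (coeff (r i) j) * (zs ! k) ^ j)"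
        using degr[of i] by (intro sum.mono_neutral_left) (auto simp: coeff_eq_0)
      finally show ?thesis by (simp add: mult.commute)
    qed
    also have "\<dots> = - ceval w (zs ! k) * (zs ! k) ^ i" using evr[OF zk] .
    also have "\<dots> = (\<Sum>j<n. (if k = j then - ceval w (zs ! k) else 0) * (zs ! j) ^ i)"
      using k by (subst sum.cong[OF refl, where h = "\<lambda>j. if k = j then - ceval w (zs ! k) * (zs ! k) ^ i else 0"]) auto
    also have "\<dots> = (D * W) $$ (k, i)"
      using k i by (simp add: W_def D_def scalar_prod_def atLeast0LessThan)
    finally show "(W * C) $$ (k, i) = (D * W) $$ (k, i)" .
  qed (use W D C in auto)
  \<comment> \<open>A nonzero kernel vector of this Vandermonde matrix would be the coefficient
    vector of a nonzero polynomial of degree below \<open>n\<close> with \<open>n\<close>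
    roots.\<close>
  have "Determinant.det W \<noteq> 0"
  proof
    assume "Determinant.det W = 0"
    then obtain v where v: "v \<in> carrier_vec n" "v \<noteq> 0\<^sub>v n" "W *\<^sub>v v = 0\<^sub>v n"
      using det_0_iff_vec_prod_zero_field[OF W] by blast
    define P where "P = (\<Sum>i<n. monom (v $ i) i)"
    have root: "poly P z = 0" if zZ: "z \<in> Z" for z
    proof -
      obtain k where k: "k < n" "z = zs ! k" using zZ in_set_conv_nth[of z zs] zs(2) len by auto
      have "poly P z = (W *\<^sub>v v) $ k"
        using k v(1) by (simp add: P_def W_def scalar_prod_def atLeast0LessThan poly_sum poly_monom mult.commute)
      then show ?thesis using v(3) k by simp
    qed
    have "P = 0"
    proof (rule ccontr)
      assume P: "P \<noteq> 0"
      have "degree P \<le> n - 1" unfolding P_def using n_pos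
        by (intro degree_sum_le) (auto intro: order_trans[OF degree_monom_le])
      moreover have "n \<le> card {z. poly P z = 0}"
        using root card_mono[OF poly_roots_finite[OF P], of Z] card_Z by auto
      ultimately show False using card_poly_roots_bound[OF P] n_pos by linarith
    qed
    moreover have "coeff P i = v $ i" if "i < n" for i
      using that by (simp add: P_def coeff_sum)
    ultimately have "v = 0\<^sub>v n" using v(1) by (intro eq_vecI) auto
    then show False using v(2) by simp
  qed
  then obtain W' where W': "W' \<in> carrier_mat n n" "W' * W = 1\<^sub>m n" "W * W' = 1\<^sub>m n"
    using det_non_zero_imp_unit[OF W] unfolding Units_def ring_mat_def by auto
  have "C = W' * D * W"
  proof -
    have "C = (W' * W) * C" using W' C by simp
    also have "\<dots> = W' * (W * C)" by (rule assoc_mult_mat[OF W'(1) W C])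
    also have "\<dots> = W' * D * W" unfolding WC by (rule assoc_mult_mat[OF W'(1) D W, symmetric])
    finally show ?thesis .
  qed
  then have "similar_mat C D" unfolding similar_mat_def similar_mat_wit_def
    by (intro exI[of _ W'] exI[of _ W]) (use W' W D C in \<open>auto simp: Let_def\<close>)
  then have "char_poly C = char_poly D" by (rule char_poly_similar)
  also have "\<dots> = (\<Prod>a\<leftarrow>diag_mat D. [:- a, 1:])"
    by (rule char_poly_upper_triangular[OF D]) (auto simp: D_def)
  also have "diag_mat D = map (\<lambda>z. - ceval w z) zs"
    by (rule nth_equalityI) (auto simp: diag_mat_def D_def len)
  also have "(\<Prod>a\<leftarrow>map (\<lambda>z. - ceval w z) zs. [:- a, 1:]) = (\<Prod>z\<in>Z. [:ceval w z, 1:])"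
    unfolding zs(2)[symmetric] by (simp add: o_def prod.distinct_set_conv_list[OF zs(1)])
  finally have "of_int_poly (char_poly B) = (\<Prod>z\<in>Z. [:ceval w z, 1:])"
    using of_int_hom.char_poly_hom[OF B] unfolding C_def by metis
  moreover have "degree (char_poly B) = n" "monic (char_poly B)"
    using degree_monic_char_poly[OF B] by auto
  ultimately show ?thesis by (intro exI[of _ "char_poly B"] conjI)
qed


text \<open>
  The norm of \<open>x\<close>; the integer in question exists by the previous lemma.
\<close>

definition N :: "int poly \<Rightarrow> int" where
  "N x = (THE m. of_int m = (\<Prod>z\<in>Z. ceval x z))"

text \<open>The norm is kept as a polynomial in the shift \<open>c\<close>, not just at 0: that this
  polynomial is integral, monic and of degree \<open>n\<close> gives congruences for norms, inverses
  modulo \<open>f\<close>, and bounds on how often prime powers divide norms along a line.\<close>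

lemma norm_shift_poly:
  obtains G :: "int poly" where "degree G = n" "monic G"
    "\<And>c. of_int (poly G c) = (\<Prod>z\<in>Z. ceval ([:c:] + w) z)"
    "of_int_poly G = (\<Prod>z\<in>Z. [:ceval w z, 1:])"
proof -
  obtain G :: "int poly" where G: "degree G = n" "monic G"
    "of_int_poly G = (\<Prod>z\<in>Z. [:ceval w z, 1:])" using norm_poly_exists[of w] by auto
  have "of_int (poly G c) = (\<Prod>z\<in>Z. ceval ([:c:] + w) z)" for c
  proof -
    have "(of_int (poly G c) :: complex) = poly (of_int_poly G) (of_int c)" by simp
    also have "\<dots> = (\<Prod>z\<in>Z. ceval ([:c:] + w) z)"
      unfolding G(3) by (simp add: poly_prod of_int_poly_hom.hom_add add.commute ceval_const)
    finally show ?thesis .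
  qed
  with G that show thesis by blast
qed

lemma of_int_N: "of_int (N x) = (\<Prod>z\<in>Z. ceval x z)"
proof -
  obtain G :: "int poly" where "\<And>c. of_int (poly G c) = (\<Prod>z\<in>Z. ceval ([:c:] + x) z)"
    by (rule norm_shift_poly[of x]) blast
  from this[of 0] have G0: "(\<Prod>z\<in>Z. ceval x z) = of_int (poly G 0)" by simp
  show ?thesis unfolding N_def G0 of_int_eq_iff by (simp only: the_eq_trivial the_sym_eq_trivial)
qed

lemma N_eqI:
  assumes "of_int m = (\<Prod>z\<in>Z. ceval x z)"
  shows "N x = m"
proof -
  have "(of_int (N x) :: complex) = of_int m" unfolding of_int_N assms ..
  then show ?thesis by (rule of_int_eq_iff[THEN iffD1])
qed

lemma N_mult: "N (x * y) = N x * N y"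
  by (rule N_eqI) (simp add: of_int_N of_int_poly_hom.hom_mult flip: prod.distrib)

lemma N_one: "N 1 = 1"
  by (rule N_eqI) simp

lemma N_add_multiple: "N (x + s * f) = N x"
  by (rule N_eqI)
    (auto simp: of_int_N of_int_poly_hom.hom_mult of_int_poly_hom.hom_add Z_def intro!: prod.cong)

lemma N_nonzero: "x \<noteq> 0 \<Longrightarrow> degree x < n \<Longrightarrow> N x \<noteq> 0"
  using of_int_N[of x] ceval_nonzero[of x] finite_Z by (cases "N x = 0") auto

lemma N_shift:
  obtains G :: "int poly" where "degree G = n" "monic G" "\<And>c. N ([:c:] + w) = poly G c"
proof -
  obtain G :: "int poly" where G: "degree G = n" "monic G"
    "\<And>c. of_int (poly G c) = (\<Prod>z\<in>Z. ceval ([:c:] + w) z)" by (rule norm_shift_poly[of w]) blast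
  have "N ([:c:] + w) = poly G c" for c by (rule N_eqI) (rule G(3))
  with G that show thesis by blast
qed

lemma N_linear: "\<bar>N [:- r, 1:]\<bar> = \<bar>poly f r\<bar>"
proof -
  have "(of_int (poly f r) :: complex) = poly (of_int_poly f) (of_int r)" by simp
  also have "\<dots> = (\<Prod>z\<in>Z. of_int r - z)" unfolding f_factorization by (simp add: poly_prod)
  finally have "norm (of_int (poly f r) :: complex) = (\<Prod>z\<in>Z. norm (of_int r - z))"
    by (simp add: prod_norm)
  moreover have "norm (of_int (N [:- r, 1:]) :: complex) = (\<Prod>z\<in>Z. norm (of_int r - z))"
    unfolding of_int_N by (simp add: prod_norm norm_minus_commute)
  ultimately have "(of_int \<bar>poly f r\<bar> :: real) = of_int \<bar>N [:- r, 1:]\<bar>" by (simp add: norm_of_int)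
  then show ?thesis by (metis of_int_eq_iff)
qed

text \<open>The norm is an integer polynomial in the shift, and its values at \<open>c\<close> and 0
  agree modulo \<open>c\<close>.\<close>

lemma N_add_const_cong: "c dvd N ([:c:] + w) - N w"
proof -
  obtain G :: "int poly" where G: "\<And>c. N ([:c:] + w) = poly G c" by (rule N_shift[of w]) blast
  have "c dvd poly G c - poly G 0" by (cases G) auto
  then show ?thesis using G[of c] G[of 0] by simp
qed

text \<open>Subtracting the constant \<open>poly x r\<close> makes \<open>x\<close> a multiple of
  \<open>X - r\<close>, whose norm is \<open>poly f r\<close> up to sign; the subtraction does not
  change the norm modulo \<open>p\<close>.\<close>

lemma prime_dvd_N_if_root:
  assumes "p dvd poly x r" "p dvd poly f r"
  shows "p dvd N x"
proof -
  obtain y where y: "x - [:poly x r:] = [:- r, 1:] * y"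
    using poly_eq_0_iff_dvd[of "x - [:poly x r:]" r] by (auto elim: dvdE)
  have "p dvd N [:- r, 1:]" using N_linear[of r] assms(2) by (metis dvd_abs_iff)
  then have 1: "p dvd N (x - [:poly x r:])" unfolding y N_mult by simp
  have "poly x r dvd N ([:poly x r:] + (x - [:poly x r:])) - N (x - [:poly x r:])"
    by (rule N_add_const_cong)
  then have "p dvd N x - N (x - [:poly x r:])" using assms(1) by (auto intro: dvd_trans)
  then show ?thesis using 1 by (metis dvd_add_right_iff diff_add_cancel add.commute)
qed

text \<open>For \<open>p \<noteq> 0\<close> this norm is \<open>p ^ n\<close> times the monic
  polynomial \<open>G\<close> of \<open>u\<close> at \<open>1 / p\<close>. Clearing denominators
  reverses the coefficients of \<open>G\<close>, and the leading one becomes the constant term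
  1.\<close>

lemma N_one_plus_multiple: "p dvd N (1 + [:p:] * u) - 1"
proof (cases "p = 0")
  case True then show ?thesis by (simp add: N_one)
next
  case False
  obtain G :: "int poly" where G: "degree G = n" "monic G"
    "of_int_poly G = (\<Prod>z\<in>Z. [:ceval u z, 1:])" by (rule norm_shift_poly[of u]) blast
  have "of_int (N (1 + [:p:] * u)) = (\<Prod>z\<in>Z. of_int p * (1 / of_int p + ceval u z))"
    unfolding of_int_N using False
    by (intro prod.cong refl)
       (simp add: of_int_poly_hom.hom_add of_int_hom.map_poly_hom_smult field_simps)
  also have "\<dots> = of_int p ^ n * poly (of_int_poly G) (1 / of_int p)"
    unfolding G(3) by (simp add: prod.distrib poly_prod card_Z add.commute)
  also have "\<dots> = (\<Sum>i\<le>n. of_int p ^ n * (of_int (coeff G i) * (1 / of_int p) ^ i))"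
    using G(1) by (simp add: poly_altdef sum_distrib_left)
  also have "\<dots> = (\<Sum>i\<le>n. of_int (coeff G i * p ^ (n - i)))"
  proof (intro sum.cong refl)
    fix i assume "i \<in> {..n}"
    then have "(of_int p :: complex) ^ n = of_int p ^ i * of_int p ^ (n - i)" by (simp flip: power_add)
    then show "(of_int p :: complex) ^ n * (of_int (coeff G i) * (1 / of_int p) ^ i) =
      of_int (coeff G i * p ^ (n - i))" using False by (simp add: power_divide)
  qed
  also have "\<dots> = (of_int (\<Sum>i\<le>n. coeff G i * p ^ (n - i)) :: complex)" by simp
  finally have "N (1 + [:p:] * u) = (\<Sum>i\<le>n. coeff G i * p ^ (n - i))"
    by (simp only: of_int_eq_iff)
  also have "\<dots> = (\<Sum>i<n. coeff G i * p ^ (n - i)) + 1"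
    using G(1,2) by (simp add: lessThan_Suc_atMost[symmetric])
  finally show ?thesis by (auto intro!: dvd_sum)
qed

text \<open>Modulo \<open>f\<close> such a relation would make \<open>t * x\<close> equal to 1 minus
  a multiple of \<open>p\<close>, so its norm would be 1 modulo \<open>p\<close>, although
  \<open>p\<close> divides \<open>N x\<close>.\<close>

lemma not_comaximal_if_dvd_N:
  assumes "p dvd N x" "\<not> is_unit p"
  shows "1 \<noteq> s * f + t * x + [:p:] * u"
proof
  assume "1 = s * f + t * x + [:p:] * u"
  then have "t * x + s * f = 1 + [:p:] * (- u)" by (simp add: algebra_simps)
  then have "N t * N x = N (1 + [:p:] * (- u))" by (metis N_add_multiple N_mult)
  then have "p dvd N (1 + [:p:] * (- u))" using assms(1) by (metis dvd_mult)
  then have "p dvd 1" using N_one_plus_multiple[of p "- u"] by (metis dvd_diff diff_diff_eq2 add_diff_cancel_left')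
  then show False using assms(2) by simp
qed

end

section \<open>Ideals as balanced lattices\<close>

text \<open>Polynomials of degree below \<open>n\<close> represent \<open>\<int>[X]/(f)\<close>, so
  a box in the lattice of coefficient vectors is a set of polynomials. The separate bounds also
  allow coefficients from \<open>0\<close> to \<open>s\<close>, for pigeonhole arguments.\<close>

definition gbox :: "nat \<Rightarrow> int \<Rightarrow> int \<Rightarrow> int poly set" where
  "gbox n a b = {x. \<forall>i. (i < n \<longrightarrow> a \<le> coeff x i \<and> coeff x i \<le> b) \<and> (i \<ge> n \<longrightarrow> coeff x i = 0)}"

abbreviation pbox :: "nat \<Rightarrow> nat \<Rightarrow> int poly set" where
  "pbox n B \<equiv> gbox n (- int B) (int B)"

lemma gbox_Suc: "gbox (Suc n) a b = (\<lambda>(c, x). pCons c x) ` ({a..b} \<times> gbox n a b)"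
proof (intro equalityI subsetI)
  fix x assume x: "x \<in> gbox (Suc n) a b"
  obtain c y where xy: "x = pCons c y" by (cases x)
  have *: "(i < Suc n \<longrightarrow> a \<le> coeff x i \<and> coeff x i \<le> b) \<and> (i \<ge> Suc n \<longrightarrow> coeff x i = 0)" for i
    using x unfolding gbox_def by blast
  have "c \<in> {a..b}" using *[of 0] xy by simp
  moreover have "y \<in> gbox n a b" unfolding gbox_def using *[of "Suc i" for i] xy by auto
  ultimately show "x \<in> (\<lambda>(c, x). pCons c x) ` ({a..b} \<times> gbox n a b)" using xy by auto
next
  fix x assume "x \<in> (\<lambda>(c, x). pCons c x) ` ({a..b} \<times> gbox n a b)"
  then show "x \<in> gbox (Suc n) a b" by (auto simp: gbox_def coeff_pCons split: nat.splits)
qed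

lemma gbox_0: "gbox 0 a b = {0}"
  by (auto simp: gbox_def poly_eq_iff)

lemma inj_pCons: "inj_on (\<lambda>(c, x). pCons c x) A"
  by (auto simp: inj_on_def)

lemma finite_gbox [simp, intro]: "finite (gbox n a b)"
  by (induction n) (auto simp: gbox_0 gbox_Suc)

lemma card_gbox: "card (gbox n a b) = nat (b - a + 1) ^ n"
  by (induction n) (simp_all add: gbox_0 gbox_Suc card_image inj_pCons card_cartesian_product)

lemma card_pbox: "card (pbox n B) = (2 * B + 1) ^ n"
proof -
  have "nat (int B - (- int B) + 1) = 2 * B + 1" by simp
  then show ?thesis by (simp only: card_gbox)
qed

lemma gbox_degree:
  assumes "n > 0" "x \<in> gbox n a b"
  shows "degree x < n"
proof -
  have "degree x \<le> n - 1" using assms by (intro degree_le) (auto simp: gbox_def)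
  then show ?thesis using assms(1) by simp
qed

lemma pbox_coeff: "x \<in> pbox n B \<Longrightarrow> \<bar>coeff x i\<bar> \<le> int B"
  unfolding gbox_def by (cases "i < n") (auto simp: abs_le_iff)

lemma pboxI: "(\<And>i. i < n \<Longrightarrow> \<bar>coeff x i\<bar> \<le> int B) \<Longrightarrow> (\<And>i. i \<ge> n \<Longrightarrow> coeff x i = 0) \<Longrightarrow> x \<in> pbox n B"
  unfolding gbox_def by (simp add: abs_le_iff minus_le_iff)

lemma pbox_add:
  assumes "x \<in> pbox n A" "y \<in> pbox n B"
  shows "x + y \<in> pbox n (A + B)"
proof (rule pboxI)
  show "\<bar>coeff (x + y) i\<bar> \<le> int (A + B)" for i
    using pbox_coeff[OF assms(1), of i] pbox_coeff[OF assms(2), of i] by simp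
  show "coeff (x + y) i = 0" if "n \<le> i" for i
    using assms that by (auto simp: gbox_def)
qed

lemma pbox_diff:
  assumes "x \<in> pbox n A" "y \<in> pbox n B"
  shows "x - y \<in> pbox n (A + B)"
proof (rule pboxI)
  show "\<bar>coeff (x - y) i\<bar> \<le> int (A + B)" for i
    using pbox_coeff[OF assms(1), of i] pbox_coeff[OF assms(2), of i] by simp
  show "coeff (x - y) i = 0" if "n \<le> i" for i
    using assms that by (auto simp: gbox_def)
qed

section \<open>Ideals of the polynomial ring and their residue classes\<close>

definition is_ideal :: "int poly set \<Rightarrow> bool" where
  "is_ideal J \<longleftrightarrow> 0 \<in> J \<and> (\<forall>x\<in>J. \<forall>y\<in>J. x + y \<in> J) \<and> (\<forall>x\<in>J. \<forall>s. s * x \<in> J)"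

lemma ideal_0: "is_ideal J \<Longrightarrow> 0 \<in> J" and ideal_add: "is_ideal J \<Longrightarrow> x \<in> J \<Longrightarrow> y \<in> J \<Longrightarrow> x + y \<in> J"
  and ideal_mult: "is_ideal J \<Longrightarrow> x \<in> J \<Longrightarrow> s * x \<in> J"
  by (auto simp: is_ideal_def)

lemma ideal_uminus: "is_ideal J \<Longrightarrow> x \<in> J \<Longrightarrow> - x \<in> J"
  using ideal_mult[of J x "- 1"] by simp

lemma ideal_diff: "is_ideal J \<Longrightarrow> x \<in> J \<Longrightarrow> y \<in> J \<Longrightarrow> x - y \<in> J"
  using ideal_add[of J x "- y"] ideal_uminus[of J y] by simp

lemma ideal_mult_right: "is_ideal J \<Longrightarrow> x \<in> J \<Longrightarrow> x * s \<in> J"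
  using ideal_mult[of J x s] by (simp add: mult.commute)

definition residue_class :: "int poly set \<Rightarrow> int poly \<Rightarrow> int poly set" where
  "residue_class J x = {y. y - x \<in> J}"

text \<open>The index of \<open>J\<close> is \<open>card (quot J)\<close>; as \<open>card\<close> is
  0 on infinite sets, finiteness is always established alongside.\<close>

definition quot :: "int poly set \<Rightarrow> int poly set set" where
  "quot J = range (residue_class J)"

lemma residue_class_eq: "is_ideal J \<Longrightarrow> residue_class J x = residue_class J y \<longleftrightarrow> x - y \<in> J"
proof -
  assume J: "is_ideal J"
  show ?thesis
  proof
    assume "residue_class J x = residue_class J y"
    then show "x - y \<in> J" using ideal_0[OF J] unfolding residue_class_def by force
  next
    assume a: "x - y \<in> J"
    have "z - x \<in> J \<longleftrightarrow> z - y \<in> J" for z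
      using ideal_add[OF J, of "z - x" "x - y"] ideal_diff[OF J, of "z - y" "x - y"] a by auto
    then show "residue_class J x = residue_class J y" unfolding residue_class_def by simp
  qed
qed

lemma quot_card_eq:
  assumes J: "is_ideal J" and eq: "\<And>x y. \<phi> x = \<phi> y \<longleftrightarrow> x - y \<in> J"
  shows "card (quot J) = card (range \<phi>)" "finite (quot J) \<longleftrightarrow> finite (range \<phi>)"
proof -
  have *: "residue_class J x = residue_class J y \<longleftrightarrow> \<phi> x = \<phi> y" for x y
    using residue_class_eq[OF J] eq by simp
  define g where "g = (\<lambda>c. \<phi> (SOME x. residue_class J x = c))"
  have g: "g (residue_class J x) = \<phi> x" for x
    unfolding g_def using someI[of "\<lambda>y. residue_class J y = residue_class J x" x] * by simp
  have im: "g ` quot J = range \<phi>" unfolding quot_def image_image g ..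
  have inj: "inj_on g (quot J)"
  proof (rule inj_onI)
    fix a b assume ab: "a \<in> quot J" "b \<in> quot J" "g a = g b"
    obtain x y where xy: "a = residue_class J x" "b = residue_class J y" using ab(1,2) unfolding quot_def by blast
    have "\<phi> x = \<phi> y" using ab(3) unfolding xy g .
    then show "a = b" unfolding xy * .
  qed
  show "card (quot J) = card (range \<phi>)" using card_image[OF inj] im by simp
  show "finite (quot J) \<longleftrightarrow> finite (range \<phi>)" using finite_image_iff[OF inj] im by simp
qed

text \<open>A crude form of Minkowski's theorem: two of the \<open>(s + 1) ^ n\<close> points with
  coefficients in \<open>0..s\<close> are congruent modulo \<open>J\<close>, and their difference is
  the short element.\<close>

lemma pigeonhole_ideal:
  assumes J: "is_ideal J" and fin: "finite (quot J)" and big: "card (quot J) < (s + 1) ^ n"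
  obtains v where "v \<in> J" "v \<noteq> 0" "v \<in> pbox n s"
proof -
  have "card (gbox n 0 (int s)) = (s + 1) ^ n"
    by (simp add: card_gbox nat_add_distrib)
  moreover have "card (residue_class J ` gbox n 0 (int s)) \<le> card (quot J)"
    using fin unfolding quot_def by (intro card_mono) auto
  ultimately have "\<not> inj_on (residue_class J) (gbox n 0 (int s))"
    using big by (metis card_image linorder_not_less)
  then obtain x y where xy: "x \<in> gbox n 0 (int s)" "y \<in> gbox n 0 (int s)" "x \<noteq> y"
    "residue_class J x = residue_class J y" by (auto simp: inj_on_def)
  have "x - y \<in> J" using residue_class_eq[OF J] xy(4) by simp
  moreover have "x - y \<in> pbox n s"
  proof (rule pboxI)
    fix i assume "i < n"
    then have "0 \<le> coeff x i" "coeff x i \<le> s" "0 \<le> coeff y i" "coeff y i \<le> s"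
      using xy by (auto simp: gbox_def)
    then show "\<bar>coeff (x - y) i\<bar> \<le> int s" by auto
  next
    fix i assume "n \<le> i"
    then show "coeff (x - y) i = 0" using xy by (auto simp: gbox_def)
  qed
  ultimately show thesis using xy(3) by (intro that[of "x - y"]) auto
qed

section \<open>Covering radii and lattice point counts for ideals containing
  \<open>f\<close>\<close>

context monic_irreducible
begin

lemma monic_dvd_small:
  assumes "f dvd y" "degree y < n" shows "y = 0"
  using dvd_imp_degree_le[OF assms(1)] assms(2) n_def by (cases "y = 0") auto

lemma reduce:
  obtains s r where "x = s * f + r" "degree r < n"
proof -
  obtain s r where "x = s * f + r" "r = 0 \<or> degree r < degree f" by (rule monic_division[OF monic])
  then show thesis using that[of s r] n_def n_pos by auto
qed

text \<open>As in the Cayley-Hamilton theorem, the polynomial \<open>G\<close> with roots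
  \<open>v(z)\<close> annihilates \<open>v\<close> modulo \<open>f\<close>. Its constant term is the
  norm of \<open>- v\<close>, which is not 0, and the remaining terms have a factor
  \<open>v\<close>.\<close>

lemma exists_inverse_mod:
  assumes "v \<noteq> 0" "degree v < n"
  obtains h s g where "g \<noteq> (0::int)" "v * h = [:g:] + s * f"
proof -
  obtain G :: "int poly" where G: "\<And>c. N ([:c:] + - v) = poly G c"
    "of_int_poly G = (\<Prod>z\<in>Z. [:ceval (- v) z, 1:])"
  proof -
    obtain G :: "int poly" where G: "\<And>c. of_int (poly G c) = (\<Prod>z\<in>Z. ceval ([:c:] + - v) z)"
      "of_int_poly G = (\<Prod>z\<in>Z. [:ceval (- v) z, 1:])" by (rule norm_shift_poly[of "- v"]) blast
    have "N ([:c:] + - v) = poly G c" for c by (rule N_eqI) (rule G(1))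
    with G(2) that show thesis by blast
  qed
  have root: "ceval (pcompose G v) z = 0" if "z \<in> Z" for z
  proof -
    have "ceval (pcompose G v) z = poly (of_int_poly G) (ceval v z)"
      by (simp add: of_int_hom.map_poly_pcompose poly_pcompose)
    also have "\<dots> = (\<Prod>z'\<in>Z. ceval v z - ceval v z')"
      unfolding G(2) by (simp add: poly_prod of_int_poly_hom.hom_uminus)
    also have "\<dots> = 0" using that finite_Z by (intro prod_zero) auto
    finally show ?thesis .
  qed
  obtain s r where sr: "pcompose G v = s * f + r" "degree r < n" by (rule reduce)
  have "r = 0"
  proof (rule ccontr)
    assume "r \<noteq> 0"
    obtain z where z: "z \<in> Z" using card_Z n_pos by (cases "Z = {}") auto
    have "ceval (pcompose G v) z = ceval r z"
      using z unfolding sr(1) by (simp add: Z_def of_int_poly_hom.hom_add of_int_poly_hom.hom_mult)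
    then show False using root[OF z] ceval_nonzero[OF \<open>r \<noteq> 0\<close> sr(2) z] by simp
  qed
  obtain g G' where GG': "G = pCons g G'" by (cases G)
  have "g = N (- v)" using G(1)[of 0] GG' by simp
  then have g0: "g \<noteq> 0" using N_nonzero[of "- v"] assms by simp
  have "v * (- pcompose G' v) = [:g:] + (- s) * f"
    using sr(1) \<open>r = 0\<close> unfolding GG' by (simp add: pcompose_pCons algebra_simps)
  with g0 that show thesis by blast
qed

lemma reduced_product_bound:
  obtains C :: nat where "C > 0"
    "\<And>a b s t. a \<in> pbox n s \<Longrightarrow> b \<in> pbox n t \<Longrightarrow> \<exists>r\<in>pbox n (C * s * t). \<exists>k. a * b = k * f + r"
proof -
  have "\<exists>r. degree r < n \<and> (\<exists>s. monom 1 i = s * f + r)" for i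
    by (rule reduce[of "monom 1 i"]) blast
  then obtain \<rho> \<sigma> where rho: "\<And>i. degree (\<rho> i) < n" "\<And>i. monom 1 i = \<sigma> i * f + \<rho> i" by metis
  define H where "H = (\<Sum>i\<le>2*n. \<Sum>j<n. nat \<bar>coeff (\<rho> i) j\<bar>)"
  have H: "\<bar>coeff (\<rho> i) j\<bar> \<le> int H" if "i \<le> 2*n" for i j
  proof (cases "j < n")
    case True
    have "nat \<bar>coeff (\<rho> i) j\<bar> \<le> (\<Sum>j<n. nat \<bar>coeff (\<rho> i) j\<bar>)"
      using True by (intro member_le_sum) auto
    also have "\<dots> \<le> H" unfolding H_def using that
      by (intro member_le_sum[of i _ "\<lambda>i. \<Sum>j<n. nat \<bar>coeff (\<rho> i) j\<bar>"]) auto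
    finally show ?thesis by linarith
  next
    case False
    then show ?thesis using rho(1)[of i] by (simp add: coeff_eq_0)
  qed
  define C where "C = (2 * n + 1) * (2 * n + 1) * H + 1"
  have "\<exists>r\<in>pbox n (C * s * t). \<exists>k. a * b = k * f + r" if a: "a \<in> pbox n s" and b: "b \<in> pbox n t" for a b s t
  proof -
    define c where "c = coeff (a * b)"
    have deg: "degree (a * b) \<le> 2 * n"
      using gbox_degree[OF n_pos a] gbox_degree[OF n_pos b] degree_mult_le[of a b] by linarith
    have cb: "\<bar>c i\<bar> \<le> int ((2 * n + 1) * s * t)" if "i \<le> 2 * n" for i
    proof -
      have "\<bar>c i\<bar> \<le> (\<Sum>j\<le>i. \<bar>coeff a j * coeff b (i - j)\<bar>)"
        unfolding c_def coeff_mult by (rule sum_abs)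
      also have "\<dots> \<le> (\<Sum>j\<le>i. int s * int t)"
        unfolding abs_mult by (intro sum_mono mult_mono pbox_coeff[OF a] pbox_coeff[OF b]) auto
      also have "\<dots> = int (i + 1) * (int s * int t)" by simp
      also have "\<dots> \<le> int (2 * n + 1) * (int s * int t)" using that by (intro mult_right_mono) auto
      finally show ?thesis by (simp only: of_nat_mult mult.assoc)
    qed
    define r where "r = (\<Sum>i\<le>2*n. smult (c i) (\<rho> i))"
    define k where "k = (\<Sum>i\<le>2*n. smult (c i) (\<sigma> i))"
    have "a * b = (\<Sum>i\<le>2*n. monom (c i) i)"
      unfolding c_def using deg by (rule poly_as_sum_of_monoms'[symmetric])
    also have "\<dots> = (\<Sum>i\<le>2*n. smult (c i) (\<sigma> i * f + \<rho> i))"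
      by (simp flip: rho(2) add: smult_monom)
    also have "\<dots> = k * f + r"
      by (simp add: k_def r_def sum.distrib sum_distrib_right smult_add_right)
    finally have eq: "a * b = k * f + r" .
    have "r \<in> pbox n (C * s * t)"
    proof (rule pboxI)
      fix j assume "j < n"
      have "\<bar>coeff r j\<bar> \<le> (\<Sum>i\<le>2*n. \<bar>c i * coeff (\<rho> i) j\<bar>)"
        unfolding r_def by (simp add: coeff_sum sum_abs)
      also have "\<dots> \<le> (\<Sum>i\<le>2*n. int ((2 * n + 1) * s * t) * int H)"
        unfolding abs_mult by (intro sum_mono mult_mono cb H) auto
      also have "\<dots> = int ((2 * n + 1) * ((2 * n + 1) * s * t * H))" by (simp add: algebra_simps)
      also have "\<dots> \<le> int (C * s * t)"
        unfolding C_def by (subst of_nat_le_iff) (simp add: algebra_simps)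
      finally show "\<bar>coeff r j\<bar> \<le> int (C * s * t)" .
    next
      fix j assume "n \<le> j"
      then have "coeff (\<rho> i) j = 0" for i using rho(1)[of i] by (simp add: coeff_eq_0)
      then show "coeff r j = 0" by (simp add: r_def coeff_sum)
    qed
    with eq show ?thesis by blast
  qed
  moreover have "C > 0" by (simp add: C_def)
  ultimately show thesis using that by blast
qed

text \<open>
  Dividing \<open>x\<close> by \<open>v\<close> in the field \<open>\<rat>[X]/(f)\<close> and rounding the coefficients of the quotient
  leaves a remainder of the size of \<open>v\<close>. Hence an ideal is a lattice whose successive minima
  all have the same order of magnitude.
\<close>

lemma covering:
  obtains C :: nat where "C > 0"
    "\<And>s v x. v \<in> pbox n s \<Longrightarrow> v \<noteq> 0 \<Longrightarrow> \<exists>y\<in>pbox n (C * s). \<exists>k l. x - y = v * k + f * l"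
proof -
  obtain C :: nat where C: "C > 0"
    "\<And>a b s t. a \<in> pbox n s \<Longrightarrow> b \<in> pbox n t \<Longrightarrow> \<exists>r\<in>pbox n (C * s * t). \<exists>k. a * b = k * f + r"
    by (rule reduced_product_bound) blast
  have "\<exists>y\<in>pbox n (C * s). \<exists>k l. x - y = v * k + f * l" if v: "v \<in> pbox n s" "v \<noteq> 0" for s v x
  proof -
    have degv: "degree v < n" using gbox_degree[OF n_pos v(1)] .
    obtain h u g where g: "g \<noteq> 0" and h: "v * h = [:g:] + u * f"
      by (rule exists_inverse_mod[OF v(2) degv])
    obtain s1 w where w: "x * h = s1 * f + w" "degree w < n" by (rule reduce)
    \<comment> \<open>Modulo \<open>f\<close> the quotient of \<open>x\<close> by \<open>v\<close>
      is \<open>w / g\<close>; \<open>q\<close> is its coefficientwise integer part and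
      \<open>r / g\<close> the fractional part.\<close>
    define q where "q = map_poly (\<lambda>c. c div g) w"
    define r where "r = map_poly (\<lambda>c. c mod g) w"
    have cq: "coeff q i = coeff w i div g"
      and cr: "coeff r i = coeff w i mod g" for i
      by (simp_all add: q_def r_def coeff_map_poly)
    have wqr: "w = [:g:] * q + r" by (rule poly_eqI) (simp add: cq cr)
    have r: "r \<in> pbox n (nat \<bar>g\<bar>)"
    proof (rule pboxI)
      show "\<bar>coeff r i\<bar> \<le> int (nat \<bar>g\<bar>)" for i using abs_mod_less[OF g, of "coeff w i"] by (simp add: cr)
      show "coeff r i = 0" if "n \<le> i" for i using w(2) that by (simp add: cr coeff_eq_0)
    qed
    obtain \<rho> k where rho: "\<rho> \<in> pbox n (C * s * nat \<bar>g\<bar>)" "v * r = k * f + \<rho>"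
      using C(2)[OF v(1) r] by blast
    obtain s2 y where y: "x - v * q = s2 * f + y" "degree y < n" by (rule reduce)
    \<comment> \<open>Both polynomials represent \<open>v * r\<close> modulo \<open>f\<close> and
      have degree below \<open>n\<close>, so they coincide; the factor \<open>g\<close> then cancels
      from the size bound.\<close>
    have "f dvd smult g y - \<rho>"
    proof -
      have "[:g:] * (x - v * q) - v * r = [:g:] * x - v * w" by (simp add: wqr algebra_simps)
      also have "\<dots> = f * (v * s1 - u * x)"
      proof -
        have "[:g:] * x = (v * h - u * f) * x" using h by simp
        also have "\<dots> = v * (x * h) - u * f * x" by (simp add: algebra_simps)
        also have "\<dots> = v * (s1 * f + w) - u * f * x" by (simp only: w(1))
        finally show ?thesis by (simp add: algebra_simps)
      qed
      finally have "[:g:] * (s2 * f + y) - (k * f + \<rho>) = f * (v * s1 - u * x)" by (simp only: y rho)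
      then have "smult g y - \<rho> = f * (v * s1 - u * x - [:g:] * s2 + k)" by (simp add: algebra_simps)
      then show ?thesis by simp
    qed
    moreover have "degree (smult g y - \<rho>) < n"
      using y(2) gbox_degree[OF n_pos rho(1)] by (metis degree_diff_less degree_smult_le order_le_less_trans)
    ultimately have gy: "smult g y = \<rho>" using monic_dvd_small by fastforce
    have "y \<in> pbox n (C * s)"
    proof (rule pboxI)
      fix i
      have "\<bar>g\<bar> * \<bar>coeff y i\<bar> = \<bar>coeff \<rho> i\<bar>" by (simp add: abs_mult flip: gy)
      also have "\<dots> \<le> \<bar>g\<bar> * int (C * s)" using pbox_coeff[OF rho(1), of i] by (simp add: mult_ac)
      finally show "\<bar>coeff y i\<bar> \<le> int (C * s)" using g by simp
    next
      fix i assume "n \<le> i" then show "coeff y i = 0" using y(2) by (simp add: coeff_eq_0)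
    qed
    moreover have "x - y = v * q + f * s2" using y(1) by (simp add: algebra_simps)
    ultimately show ?thesis by blast
  qed
  with C(1) that show thesis by blast
qed

text \<open>The covering constant is fixed once, so that later estimates depend on \<open>f\<close>
  and not on the ideal.\<close>

definition cov :: nat where
  "cov = (SOME C. C > 0 \<and> (\<forall>s v x. v \<in> pbox n s \<longrightarrow> v \<noteq> 0 \<longrightarrow> (\<exists>y\<in>pbox n (C * s). \<exists>k l. x - y = v * k + f * l)))"

lemma cov: "cov > 0" "v \<in> pbox n s \<Longrightarrow> v \<noteq> 0 \<Longrightarrow> \<exists>y\<in>pbox n (cov * s). \<exists>k l. x - y = v * k + f * l"
proof -
  have "\<exists>C. C > 0 \<and> (\<forall>s v x. v \<in> pbox n s \<longrightarrow> v \<noteq> 0 \<longrightarrow> (\<exists>y\<in>pbox n (C * s). \<exists>k l. x - y = v * k + f * l))"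
    by (rule covering) blast
  from someI_ex[OF this] show "cov > 0" "v \<in> pbox n s \<Longrightarrow> v \<noteq> 0 \<Longrightarrow> \<exists>y\<in>pbox n (cov * s). \<exists>k l. x - y = v * k + f * l"
    unfolding cov_def[symmetric] by blast+
qed

text \<open>A single short element of \<open>J\<close> suffices: by \<open>cov\<close>, division by
  it leaves remainders of its own size, so every residue class meets the box of radius
  \<open>cov * s\<close>.\<close>

lemma class_representatives:
  assumes J: "is_ideal J" "f \<in> J" and v: "v \<in> J" "v \<noteq> 0" "v \<in> pbox n s"
  obtains \<rho> where "\<And>x. \<rho> (residue_class J x) \<in> pbox n (cov * s)" "\<And>x. x - \<rho> (residue_class J x) \<in> J"
proof -
  have ex: "\<exists>y. y \<in> pbox n (cov * s) \<and> x - y \<in> J" for x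
  proof -
    obtain y k l where y: "y \<in> pbox n (cov * s)" "x - y = v * k + f * l" using cov(2)[OF v(3,2)] by blast
    then show ?thesis using ideal_add[OF J(1)] ideal_mult_right[OF J(1)] J(2) v(1) by metis
  qed
  define \<rho> where "\<rho> c = (SOME y. y \<in> pbox n (cov * s) \<and> residue_class J y = c)" for c
  have "\<rho> (residue_class J x) \<in> pbox n (cov * s) \<and> residue_class J (\<rho> (residue_class J x)) = residue_class J x" for x
  proof -
    obtain y where "y \<in> pbox n (cov * s)" "x - y \<in> J" using ex by blast
    then have "y \<in> pbox n (cov * s) \<and> residue_class J y = residue_class J x" using residue_class_eq[OF J(1)] by metis
    then show ?thesis unfolding \<rho>_def by (rule someI)
  qed
  then show thesis using that[of \<rho>] residue_class_eq[OF J(1)] by metis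
qed

lemma finite_index:
  assumes J: "is_ideal J" "f \<in> J" and v: "v \<in> J" "v \<noteq> 0" "v \<in> pbox n s"
  shows "finite (quot J)"
proof -
  obtain \<rho> where \<rho>: "\<And>x. \<rho> (residue_class J x) \<in> pbox n (cov * s)" "\<And>x. x - \<rho> (residue_class J x) \<in> J"
    by (rule class_representatives[OF assms]) blast
  have "quot J \<subseteq> residue_class J ` pbox n (cov * s)"
  proof
    fix c assume "c \<in> quot J"
    then obtain x where c: "c = residue_class J x" by (auto simp: quot_def)
    then have "c = residue_class J (\<rho> c)" using \<rho>(2)[of x] residue_class_eq[OF J(1)] by simp
    then show "c \<in> residue_class J ` pbox n (cov * s)" using \<rho>(1)[of x] c by (intro image_eqI[of _ _ "\<rho> c"]) simp_all
  qed
  then show ?thesis by (rule finite_subset) auto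
qed

text \<open>Adding the representative of every class to every point of \<open>J\<close> in the box
  produces distinct points of the box enlarged by \<open>cov * s\<close>.\<close>

lemma ideal_count_upper:
  assumes J: "is_ideal J" "f \<in> J" and v: "v \<in> J" "v \<noteq> 0" "v \<in> pbox n s"
  shows "card (quot J) * card (J \<inter> pbox n B) \<le> (2 * (B + cov * s) + 1) ^ n"
proof -
  obtain \<rho> where \<rho>: "\<And>x. \<rho> (residue_class J x) \<in> pbox n (cov * s)" "\<And>x. x - \<rho> (residue_class J x) \<in> J"
    by (rule class_representatives[OF assms]) blast
  define g where "g = (\<lambda>(c, x). x + \<rho> c)"
  have "inj_on g (quot J \<times> (J \<inter> pbox n B))"
  proof (rule inj_onI, clarsimp simp: g_def quot_def)
    fix x y u u' assume *: "x \<in> J" "y \<in> J" "x + \<rho> (residue_class J u) = y + \<rho> (residue_class J u')"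
    have "u - u' = (u - \<rho> (residue_class J u)) - (u' - \<rho> (residue_class J u')) + (y - x)"
      using *(3) by (simp add: algebra_simps)
    also have "\<dots> \<in> J"
      by (rule ideal_add[OF J(1) ideal_diff[OF J(1) \<rho>(2) \<rho>(2)] ideal_diff[OF J(1) *(2,1)]])
    finally have "residue_class J u = residue_class J u'" using residue_class_eq[OF J(1)] by simp
    then show "residue_class J u = residue_class J u' \<and> x = y" using * by simp
  qed
  moreover have "g ` (quot J \<times> (J \<inter> pbox n B)) \<subseteq> pbox n (B + cov * s)"
  proof
    fix y assume "y \<in> g ` (quot J \<times> (J \<inter> pbox n B))"
    then obtain c x where y: "c \<in> quot J" "x \<in> pbox n B" "y = x + \<rho> c" by (auto simp: g_def)
    obtain u where "c = residue_class J u" using y(1) by (auto simp: quot_def)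
    then show "y \<in> pbox n (B + cov * s)" unfolding y(3) using \<rho>(1) by (intro pbox_add[OF y(2)]) blast
  qed
  ultimately have "card (quot J \<times> (J \<inter> pbox n B)) \<le> card (pbox n (B + cov * s))"
    by (rule card_inj_on_le) auto
  then show ?thesis unfolding card_pbox card_cartesian_product .
qed

text \<open>Conversely, a point of the shrunken box minus the representative of its class is a point
  of \<open>J\<close> in the box, and the class together with this point recovers the
  original.\<close>

lemma ideal_count_lower:
  assumes J: "is_ideal J" "f \<in> J" and v: "v \<in> J" "v \<noteq> 0" "v \<in> pbox n s" and B: "cov * s \<le> B"
  shows "(2 * (B - cov * s) + 1) ^ n \<le> card (quot J) * card (J \<inter> pbox n B)"
proof -
  obtain \<rho> where \<rho>: "\<And>x. \<rho> (residue_class J x) \<in> pbox n (cov * s)" "\<And>x. x - \<rho> (residue_class J x) \<in> J"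
    by (rule class_representatives[OF J v]) blast
  define g where "g = (\<lambda>x. (residue_class J x, x - \<rho> (residue_class J x)))"
  have "inj_on g (pbox n (B - cov * s))" by (rule inj_onI) (auto simp: g_def)
  moreover have "g ` pbox n (B - cov * s) \<subseteq> quot J \<times> (J \<inter> pbox n B)"
    unfolding g_def quot_def using \<rho> pbox_diff[of _ n "B - cov * s" _ "cov * s"] B by auto
  moreover have "finite (quot J \<times> (J \<inter> pbox n B))" using finite_index[OF J v] by simp
  ultimately have "card (pbox n (B - cov * s)) \<le> card (quot J \<times> (J \<inter> pbox n B))"
    by (rule card_inj_on_le)
  then show ?thesis unfolding card_pbox card_cartesian_product .
qed

text \<open>If the box contains a nonzero point of \<open>J\<close>, that point itself can play the
  short element, with \<open>s = B\<close>; otherwise there is nothing to count. Excluding 0 makes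
  the bound valid however large the index is.\<close>

lemma ideal_count_nonzero:
  assumes J: "is_ideal J" "f \<in> J" and B: "B > 0"
  shows "card (quot J) * card (J \<inter> pbox n B - {0}) \<le> (2 * cov + 3) ^ n * B ^ n"
proof (cases "J \<inter> pbox n B - {0} = {}")
  case True then show ?thesis by (simp only: True card.empty mult_0_right le0)
next
  case False
  then obtain v where v: "v \<in> J" "v \<noteq> 0" "v \<in> pbox n B" by blast
  have "card (quot J) * card (J \<inter> pbox n B - {0}) \<le> card (quot J) * card (J \<inter> pbox n B)"
    by (intro mult_left_mono card_mono) auto
  also have "\<dots> \<le> (2 * (B + cov * B) + 1) ^ n" by (rule ideal_count_upper[OF J v])
  also have "\<dots> \<le> ((2 * cov + 3) * B) ^ n" using B by (intro power_mono) (auto simp: algebra_simps)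
  finally show ?thesis by (simp add: power_mult_distrib)
qed

end

section \<open>Ideals above a rational prime\<close>

text \<open>The ideal \<open>(p, X - r)\<close>, written as the kernel of evaluation at
  \<open>r\<close> modulo \<open>p\<close>. It is used with \<open>p ^ 2\<close> in place of
  \<open>p\<close> as well.\<close>

definition root_ideal :: "int \<Rightarrow> int \<Rightarrow> int poly set" where
  "root_ideal p r = {x. p dvd poly x r}"

lemma is_ideal_root_ideal: "is_ideal (root_ideal p r)"
  by (auto simp: is_ideal_def root_ideal_def)

text \<open>If \<open>p\<close> did not divide the leading coefficient, a Bezout combination with
  \<open>p\<close> times a monomial would be a monic element of the same degree, below
  \<open>m\<close>. So the leading term is a multiple of \<open>p\<close> and can be stripped off,
  by induction on the degree.\<close>

lemma small_in_ideal_dvd: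
  fixes p :: int
  assumes J: "is_ideal J" and pJ: "[:p:] \<in> J" and p: "prime p"
    and min: "\<And>y. y \<in> J \<Longrightarrow> monic y \<Longrightarrow> m \<le> degree y"
    and r: "r \<in> J" "degree r < m"
  shows "\<exists>t. r = [:p:] * t"
  using r
proof (induction "degree r" arbitrary: r rule: less_induct)
  case less
  show ?case
  proof (cases "r = 0")
    case True then show ?thesis by (intro exI[of _ 0]) simp
  next
    case False
    define c where "c = lead_coeff r"
    define k where "k = degree r"
    have pm: "monom (p * e) k \<in> J" for e
    proof -
      have "monom e k * [:p:] \<in> J" by (rule ideal_mult[OF J pJ])
      moreover have "monom e k * [:p:] = monom (p * e) k" by (simp add: smult_monom)
      ultimately show ?thesis by simp
    qed
    have pc: "p dvd c"
    proof (rule ccontr)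
      assume "\<not> p dvd c"
      then have "coprime p c" using p by (simp add: prime_imp_coprime)
      then obtain u v where uv: "u * p + v * c = 1" by (metis cong_def bezout_int coprime_imp_gcd_eq_1)
      define y where "y = [:v:] * r + monom (p * u) k"
      have yJ: "y \<in> J" unfolding y_def by (intro ideal_add[OF J] ideal_mult[OF J] less.prems pm)
      have ck: "coeff y k = 1" using uv by (simp add: y_def c_def k_def algebra_simps)
      have "degree y \<le> k" unfolding y_def k_def
        by (intro degree_add_le) (auto intro: order_trans[OF degree_monom_le] order_trans[OF degree_smult_le])
      moreover have "k \<le> degree y" using ck by (intro le_degree) simp
      ultimately have "degree y = k" by simp
      then have "monic y" using ck by simp
      then show False using min[OF yJ] \<open>degree y = k\<close> less.prems(2) by (simp add: k_def)
    qed
    then obtain e where e: "c = p * e" by blast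
    define r' where "r' = r - monom c k"
    have r'J: "r' \<in> J" unfolding r'_def e by (intro ideal_diff[OF J] less.prems pm)
    have "\<exists>t. r' = [:p:] * t"
    proof (cases "r' = 0")
      case True then show ?thesis by (intro exI[of _ 0]) simp
    next
      case False
      have "coeff r' k = 0" by (simp add: r'_def c_def k_def)
      moreover have "degree r' \<le> k" unfolding r'_def k_def
        by (intro degree_diff_le) (auto intro: degree_monom_le)
      ultimately have "degree r' < k" using False by (metis leading_coeff_0_iff le_neq_implies_less)
      then show ?thesis using less.hyps[of r'] r'J less.prems(2) by (simp add: k_def)
    qed
    then obtain t where t: "r' = [:p:] * t" by blast
    have "r = [:p:] * (t + monom e k)"
      using t by (simp add: r'_def e algebra_simps smult_add_right smult_monom)
    then show ?thesis by blast
  qed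
qed

text \<open>Modulo \<open>p\<close> the polynomials form a principal ideal domain; \<open>d\<close>
  is a monic lift of the generator of the image of \<open>J\<close>.\<close>

lemma ideal_generator:
  fixes p :: int
  assumes J: "is_ideal J" and pJ: "[:p:] \<in> J" and p: "prime p" and F: "F \<in> J" "monic F"
  obtains d where "d \<in> J" "monic d" "degree d \<le> degree F"
    "\<And>y. y \<in> J \<Longrightarrow> monic y \<Longrightarrow> degree d \<le> degree y"
    "\<And>r. r \<in> J \<Longrightarrow> degree r < degree d \<Longrightarrow> \<exists>t. r = [:p:] * t"
    "\<And>x. x \<in> J \<Longrightarrow> \<exists>s t. x = s * d + [:p:] * t"
proof -
  define P where "P = (\<lambda>d. d \<in> J \<and> monic d)"
  obtain d where d: "P d" and min: "\<And>y. P y \<Longrightarrow> degree d \<le> degree y"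
    using arg_min_nat_lemma[of P F degree] F unfolding P_def by blast
  have small: "\<exists>t. r = [:p:] * t" if "r \<in> J" "degree r < degree d" for r
    by (rule small_in_ideal_dvd[OF J pJ p _ that]) (use min in \<open>auto simp: P_def\<close>)
  have "\<exists>s t. x = s * d + [:p:] * t" if x: "x \<in> J" for x
  proof -
    obtain s r where sr: "x = s * d + r" "r = 0 \<or> degree r < degree d"
      using monic_division[of d x] d unfolding P_def by metis
    have "r = x - s * d" using sr by simp
    then have rJ: "r \<in> J" using ideal_diff[OF J x ideal_mult[OF J]] d by (auto simp: P_def)
    from sr(2) have "\<exists>t. r = [:p:] * t"
    proof
      assume "r = 0" then show ?thesis by (intro exI[of _ 0]) simp
    next
      assume "degree r < degree d" then show ?thesis using small rJ by blast
    qed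
    then show ?thesis using sr(1) by blast
  qed
  moreover have "degree d \<le> degree F" using min[of F] F by (simp add: P_def)
  ultimately show thesis using that[of d] d min small unfolding P_def by blast
qed

definition ideals_over :: "int \<Rightarrow> int poly \<Rightarrow> int poly set set" where
  "ideals_over p F = {J. is_ideal J \<and> [:p:] \<in> J \<and> F \<in> J}"

lemma monic_degree_0: "monic F \<Longrightarrow> degree F = 0 \<Longrightarrow> F = (1 :: int poly)"
  by (metis degree_0_id one_pCons)

lemma ideal_UNIV: "is_ideal J \<Longrightarrow> 1 \<in> J \<Longrightarrow> J = UNIV"
  using ideal_mult[of J 1] by auto

text \<open>
  A monic divisor \<open>g\<close> of \<open>F\<close> modulo \<open>p\<close> of least positive degree is irreducible modulo \<open>p\<close>, so an
  ideal above \<open>(p, F)\<close> either lies in \<open>(p, g)\<close> or contains the cofactor \<open>h\<close>; both kinds are counted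
  by the ideals above \<open>(p, h)\<close>.
\<close>

lemma card_ideals_over:
  fixes p :: int
  assumes p: "prime p" and "monic F"
  shows "finite (ideals_over p F) \<and> card (ideals_over p F) \<le> 2 ^ degree F"
  using assms(2)
proof (induction "degree F" arbitrary: F rule: less_induct)
  case less
  show ?case
  proof (cases "degree F = 0")
    case True
    then have "F = 1" using less.prems monic_degree_0 by blast
    then have "ideals_over p F \<subseteq> {UNIV}" using ideal_UNIV by (auto simp: ideals_over_def)
    then show ?thesis using card_mono[of "{UNIV :: int poly set}" "ideals_over p F"] finite_subset True by auto
  next
    case False
    define Q where "Q = (\<lambda>g. monic g \<and> degree g \<ge> 1 \<and> (\<exists>h t. F = h * g + [:p:] * t \<and> monic h \<and> degree h + degree g = degree F))"
    have "Q F" unfolding Q_def using less.prems False by (intro conjI exI[of _ "1 :: int poly"] exI[of _ "0 :: int poly"]) auto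
    then obtain g where g: "Q g" and min: "\<And>y. Q y \<Longrightarrow> degree g \<le> degree y"
      using arg_min_nat_lemma[of Q F degree] by blast
    from g obtain h t where ht: "F = h * g + [:p:] * t" "monic h" "degree h + degree g = degree F"
      and mg: "monic g" "degree g \<ge> 1" unfolding Q_def by blast
    have IH: "finite (ideals_over p h)" "card (ideals_over p h) \<le> 2 ^ degree h"
      using less.hyps[of h] ht mg by auto
    \<comment> \<open>The colon ideal of \<open>J\<close> by \<open>g\<close>. For \<open>J\<close>
      inside \<open>(p, g)\<close> it determines \<open>J\<close>, because
      \<open>s * g + [:p:] * t\<close> lies in \<open>J\<close> exactly when \<open>s\<close> lies
      in \<open>K J\<close>.\<close>
    define K where "K = (\<lambda>J. {x. x * g \<in> J})"
    define C1 where "C1 = {J \<in> ideals_over p F. \<forall>x\<in>J. \<exists>s t. x = s * g + [:p:] * t}"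
    have gh: "h * g \<in> J" if J: "J \<in> ideals_over p F" for J
    proof -
      have "h * g = F - t * [:p:]" using ht(1) by simp
      also have "\<dots> \<in> J" using J ideal_diff ideal_mult unfolding ideals_over_def by blast
      finally show ?thesis .
    qed
    have KJ: "K J \<in> ideals_over p h" if J: "J \<in> ideals_over p F" for J
    proof -
      have iJ: "is_ideal J" "[:p:] \<in> J" using J by (auto simp: ideals_over_def)
      have "is_ideal (K J)" unfolding is_ideal_def K_def
        using ideal_0[OF iJ(1)] ideal_add[OF iJ(1)] ideal_mult[OF iJ(1)]
        by (auto simp: distrib_right mult.assoc)
      moreover have "[:p:] \<in> K J" unfolding K_def using ideal_mult_right[OF iJ] by simp
      ultimately show ?thesis using gh[OF J] by (simp add: ideals_over_def K_def)
    qed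
    have "inj_on K C1"
    proof (rule inj_onI)
      fix I J assume I: "I \<in> C1" and J: "J \<in> C1" and eq: "K I = K J"
      have sub: "A \<subseteq> B" if A: "A \<in> C1" and B: "B \<in> C1" and KK: "K A = K B" for A B
      proof
        fix x assume x: "x \<in> A"
        then obtain s t where "x = s * g + [:p:] * t" using A unfolding C1_def by blast
        then have st: "x = s * g + t * [:p:]" by (simp only: mult.commute[of t])
        have iA: "is_ideal A" "[:p:] \<in> A" and iB: "is_ideal B" "[:p:] \<in> B"
          using A B by (auto simp: C1_def ideals_over_def)
        have "s * g = x - t * [:p:]" using st by simp
        also have "\<dots> \<in> A" by (rule ideal_diff[OF iA(1) x ideal_mult[OF iA]])
        finally have "s \<in> K B" using KK unfolding K_def by blast
        then show "x \<in> B" unfolding st K_def using ideal_add[OF iB(1) _ ideal_mult[OF iB]] by blast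
      qed
      show "I = J" using sub[OF I J eq] sub[OF J I eq[symmetric]] by blast
    qed
    moreover have "K ` C1 \<subseteq> ideals_over p h" using KJ by (auto simp: C1_def)
    ultimately have c1: "card C1 \<le> card (ideals_over p h)" "finite C1"
      using IH(1) by (auto intro: card_inj_on_le inj_on_finite)
    have "ideals_over p F \<subseteq> C1 \<union> ideals_over p h"
    proof
      fix J assume J: "J \<in> ideals_over p F"
      then have iJ: "is_ideal J" "[:p:] \<in> J" "F \<in> J" by (auto simp: ideals_over_def)
      \<comment> \<open>The sum of \<open>J\<close> and \<open>(g)\<close>. If it is the whole ring,
        \<open>h\<close> lies in \<open>J\<close>; otherwise its generator \<open>d\<close> competes
        with \<open>g\<close> for the least positive degree.\<close>
      define J' where "J' = {a * g + b | a b. b \<in> J}"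
      have J'I: "a * g + b \<in> J'" if "b \<in> J" for a b using that by (auto simp: J'_def)
      have sub: "J \<subseteq> J'" using J'I[of _ 0] by auto
      have gJ': "g \<in> J'" using J'I[OF ideal_0[OF iJ(1)], of 1] by simp
      have iJ': "is_ideal J'" unfolding is_ideal_def
      proof (intro conjI ballI allI)
        show "0 \<in> J'" using J'I[OF ideal_0[OF iJ(1)], of 0] by simp
        fix x assume "x \<in> J'"
        then obtain a b where ab: "x = a * g + b" "b \<in> J" by (auto simp: J'_def)
        show "s * x \<in> J'" for s
          using J'I[OF ideal_mult[OF iJ(1) ab(2), of s], of "s * a"] by (simp add: ab algebra_simps)
        fix y assume "y \<in> J'"
        then obtain a' b' where ab': "y = a' * g + b'" "b' \<in> J" by (auto simp: J'_def)
        show "x + y \<in> J'" using J'I[OF ideal_add[OF iJ(1) ab(2) ab'(2)], of "a + a'"]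
          by (simp add: ab ab' algebra_simps)
      qed
      have pJ': "[:p:] \<in> J'" and FJ': "F \<in> J'" using iJ sub by auto
      obtain d where d: "d \<in> J'" "monic d"
        and dmin: "\<And>y. y \<in> J' \<Longrightarrow> monic y \<Longrightarrow> degree d \<le> degree y"
        and dsmall: "\<And>r. r \<in> J' \<Longrightarrow> degree r < degree d \<Longrightarrow> \<exists>t. r = [:p:] * t"
        and dgen: "\<And>x. x \<in> J' \<Longrightarrow> \<exists>s t. x = s * d + [:p:] * t"
        by (rule ideal_generator[OF iJ' pJ' p FJ' less.prems]) blast
      show "J \<in> C1 \<union> ideals_over p h"
      proof (cases "degree d = 0")
        case True
        then have "1 \<in> J'" using d monic_degree_0 by blast
        then obtain a b where ab: "1 = a * g + b" "b \<in> J" by (auto simp: J'_def)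
        have "h = a * (h * g) + h * b" using arg_cong[OF ab(1), of "\<lambda>x. h * x"] by (simp add: algebra_simps)
        also have "\<dots> \<in> J" by (rule ideal_add[OF iJ(1) ideal_mult[OF iJ(1) gh[OF J]] ideal_mult[OF iJ(1) ab(2)]])
        finally show ?thesis using iJ by (simp add: ideals_over_def)
      next
        case False
        obtain s r where sr: "F = s * d + r" "r = 0 \<or> degree r < degree d"
          by (rule monic_division[OF d(2)])
        have "r = F - s * d" using sr by simp
        then have "r \<in> J'" using ideal_diff[OF iJ' FJ' ideal_mult[OF iJ' d(1)]] by simp
        then obtain t' where t': "r = [:p:] * t'" using dsmall sr(2) False by (metis degree_0 gr0I)
        have rd: "degree r < degree F"
          using sr(2) dmin[OF FJ' less.prems] False by auto
        have s0: "s \<noteq> 0" using sr(1) rd by auto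
        have sdF: "s * d = F + (- r)" using sr(1) by simp
        have "degree (s * d) = degree F" unfolding sdF using rd by (intro degree_add_eq_left) simp
        then have degs: "degree s + degree d = degree F" using s0 d(2) by (metis degree_mult_eq leading_coeff_0_iff zero_neq_one)
        have "lead_coeff (s * d) = 1"
          unfolding \<open>degree (s * d) = degree F\<close> unfolding sdF using less.prems rd by (simp add: coeff_eq_0)
        then have "monic s" using d(2) unfolding lead_coeff_mult by simp
        \<comment> \<open>So minimality gives \<open>d\<close> the degree of \<open>g\<close>; the
          difference \<open>g - d\<close> then has smaller degree and is divisible by
          \<open>p\<close>, which makes \<open>g\<close> a generator as well.\<close>
        then have "Q d" unfolding Q_def using d(2) False degs sr(1) t' by (intro conjI exI[of _ s] exI[of _ t']) auto
        then have dg: "degree d = degree g" using min dmin[OF gJ' mg(1)] by (simp add: order_antisym)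
        have "degree (g - d) < degree d"
        proof -
          have "degree (g - d) \<le> degree d" using dg by (intro degree_diff_le) auto
          moreover have "coeff (g - d) (degree d) = 0" using dg mg(1) d(2) by simp
          ultimately show ?thesis using False by (metis degree_0 gr0I leading_coeff_0_iff le_neq_implies_less)
        qed
        then obtain e where e: "g - d = [:p:] * e" using dsmall[OF ideal_diff[OF iJ' gJ' d(1)]] by blast
        have "\<exists>s t. x = s * g + [:p:] * t" if "x \<in> J" for x
        proof -
          obtain s t where "x = s * d + [:p:] * t" using dgen sub \<open>x \<in> J\<close> by blast
          moreover have "d = g - [:p:] * e" using e by (simp add: algebra_simps)
          ultimately have "x = s * g + [:p:] * (t - s * e)" by (simp add: algebra_simps smult_diff_right)
          then show ?thesis by blast
        qed
        then show ?thesis using J by (simp add: C1_def)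
      qed
    qed
    then have fin: "finite (ideals_over p F)" and "card (ideals_over p F) \<le> card (C1 \<union> ideals_over p h)"
      using c1 IH(1) by (auto intro: finite_subset card_mono)
    then have "card (ideals_over p F) \<le> 2 * 2 ^ degree h"
      using card_Un_le[of C1 "ideals_over p h"] c1 IH(2) by linarith
    also have "\<dots> \<le> 2 ^ degree F" using ht(3) mg(2) by (simp flip: power_Suc)
    finally show ?thesis using fin by simp
  qed
qed

text \<open>The degree of the generator \<open>d\<close> modulo \<open>p\<close> decides: degree 1
  gives a root ideal, while for degree at least 2 the \<open>p ^ 2\<close> linear polynomials with
  coefficients in \<open>0..p - 1\<close> are pairwise incongruent.\<close>

lemma ideal_dichotomy:
  fixes p :: int
  assumes J: "is_ideal J" "[:p:] \<in> J" "F \<in> J" "monic F" "1 \<notin> J" and p: "prime p" and fin: "finite (quot J)"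
  shows "p\<^sup>2 \<le> int (card (quot J)) \<or> (\<exists>r\<in>{0..<p}. J = root_ideal p r)"
proof -
  obtain d where d: "d \<in> J" "monic d"
    and dsmall: "\<And>r. r \<in> J \<Longrightarrow> degree r < degree d \<Longrightarrow> \<exists>t. r = [:p:] * t"
    and dgen: "\<And>x. x \<in> J \<Longrightarrow> \<exists>s t. x = s * d + [:p:] * t"
    by (rule ideal_generator[OF J(1,2) p J(3,4)]) blast
  have p0: "p > 0" using p by (simp add: prime_gt_0_int)
  have "degree d \<noteq> 0" using J(5) d monic_degree_0 by blast
  then consider "degree d = 1" | "degree d \<ge> 2" by linarith
  then show ?thesis
  proof cases
    case 1
    define r where "r = (- coeff d 0) mod p"
    have d_eq: "d = [:coeff d 0, 1:]"
      by (rule poly_eqI) (use 1 d(2) in \<open>auto simp: coeff_pCons coeff_eq_0 split: nat.splits\<close>)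
    define e where "e = - ((- coeff d 0) div p)"
    have e: "r + coeff d 0 = p * e"
      unfolding r_def e_def minus_mult_div_eq_mod[symmetric] by (simp add: algebra_simps)
    have "x \<in> J \<longleftrightarrow> p dvd poly x r" for x
    proof
      assume "x \<in> J"
      then obtain s t where st: "x = s * d + [:p:] * t" using dgen by blast
      have "poly d r = p * e" using e by (subst d_eq) simp
      then show "p dvd poly x r" unfolding st by simp
    next
      assume "p dvd poly x r"
      then obtain c where c: "poly x r = p * c" by blast
      obtain y where y: "x - [:poly x r:] = [:- r, 1:] * y"
        using poly_eq_0_iff_dvd[of "x - [:poly x r:]" r] by (auto elim: dvdE)
      have lin: "[:- r, 1:] = d - [:e:] * [:p:]" using e by (subst d_eq) (simp add: algebra_simps)
      have "x = y * [:- r, 1:] + [:c:] * [:p:]" using y c by (simp add: algebra_simps)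
      also have "\<dots> \<in> J" unfolding lin
        by (intro ideal_add[OF J(1)] ideal_mult[OF J(1)] ideal_diff[OF J(1)] d J(2))
      finally show "x \<in> J" .
    qed
    then have "J = root_ideal p r" by (auto simp: root_ideal_def)
    moreover have "r \<in> {0..<p}" using p0 by (simp add: r_def)
    ultimately show ?thesis by blast
  next
    case 2
    have inj: "inj_on (residue_class J) (gbox 2 0 (p - 1))"
    proof (rule inj_onI)
      fix x y assume x: "x \<in> gbox 2 0 (p - 1)" and y: "y \<in> gbox 2 0 (p - 1)"
        and eq: "residue_class J x = residue_class J y"
      have xy: "x - y \<in> J" using eq residue_class_eq[OF J(1)] by simp
      have "degree (x - y) < degree d"
        using gbox_degree[OF _ x] gbox_degree[OF _ y] 2 by (intro degree_diff_less) auto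
      then obtain t where t: "x - y = [:p:] * t" using dsmall xy by blast
      show "x = y"
      proof (rule poly_eqI)
        fix i
        have c: "coeff x i - coeff y i = p * coeff t i"
          using arg_cong[OF t, of "\<lambda>q. coeff q i"] by simp
        show "coeff x i = coeff y i"
        proof (cases "i < 2")
          case True
          then have "0 \<le> coeff x i" "coeff x i \<le> p - 1" "0 \<le> coeff y i" "coeff y i \<le> p - 1"
            using x y unfolding gbox_def by blast+
          then have "coeff x i mod p = coeff x i" "coeff y i mod p = coeff y i"
            by (simp_all add: mod_pos_pos_trivial)
          moreover have "coeff x i mod p = coeff y i mod p"
            unfolding mod_eq_dvd_iff c by (rule dvd_triv_left)
          ultimately show ?thesis by metis
        next
          case False then show ?thesis using x y by (auto simp: gbox_def)
        qed
      qed
    qed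
    have "residue_class J ` gbox 2 0 (p - 1) \<subseteq> quot J" by (auto simp: quot_def)
    then have "card (gbox 2 0 (p - 1)) \<le> card (quot J)" by (rule card_inj_on_le[OF inj _ fin])
    then have "(nat p)\<^sup>2 \<le> card (quot J)" by (simp add: card_gbox)
    then have "int ((nat p)\<^sup>2) \<le> int (card (quot J))" by (simp only: of_nat_le_iff)
    then show ?thesis using p0 by simp
  qed
qed

lemma poly_taylor2: "\<exists>e. poly q (a + h) = poly q a + h * poly (pderiv q) a + h\<^sup>2 * (e :: int)"
proof (induction q)
  case 0 then show ?case by (intro exI[of _ 0]) simp
next
  case (pCons c q)
  then obtain e where e: "poly q (a + h) = poly q a + h * poly (pderiv q) a + h\<^sup>2 * e" by blast
  show ?case
    by (intro exI[of _ "poly (pderiv q) a + (a + h) * e"]) (simp add: e pderiv_pCons algebra_simps power2_eq_square)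
qed



section \<open>Divisibility of norms by a prime and by its square\<close>

context monic_irreducible
begin

text \<open>
  Up to sign the discriminant of \<open>f\<close>: modulo a prime not dividing it, all roots of \<open>f\<close> are simple.
\<close>

definition disc :: int where "disc = N (pderiv f)"

lemma disc_nonzero: "disc \<noteq> 0"
  unfolding disc_def using n_pos n_def
  by (intro N_nonzero) (auto simp: pderiv_eq_0_iff degree_pderiv)

lemma simple_root:
  fixes p :: int
  assumes "\<not> p dvd disc" "p dvd poly f r"
  shows "\<not> p dvd poly (pderiv f) r"
  using prime_dvd_N_if_root[of p "pderiv f" r] assms unfolding disc_def by blast

lemma finite_quot_over:
  assumes "is_ideal J" "f \<in> J" "[:p:] \<in> J" "p \<noteq> 0"
  shows "finite (quot J)"
proof (rule finite_index[OF assms(1,2,3)])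
  show "[:p:] \<in> pbox n (nat \<bar>p\<bar>)"
    by (rule pboxI) (use n_pos in \<open>auto simp: coeff_pCons split: nat.splits\<close>)
qed (use assms in auto)

definition gen_ideal :: "int \<Rightarrow> int poly \<Rightarrow> int poly set" where
  "gen_ideal p x = {s * f + t * x + [:p:] * u | s t u. True}"

lemma gen_ideal: "is_ideal (gen_ideal p x)" "f \<in> gen_ideal p x" "x \<in> gen_ideal p x" "[:p:] \<in> gen_ideal p x"
proof -
  have I: "s * f + t * x + [:p:] * u \<in> gen_ideal p x" for s t u unfolding gen_ideal_def by blast
  show "f \<in> gen_ideal p x" using I[of 1 0 0] by simp
  show "x \<in> gen_ideal p x" using I[of 0 1 0] by simp
  show "[:p:] \<in> gen_ideal p x" using I[of 0 0 1] by simp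
  show "is_ideal (gen_ideal p x)" unfolding is_ideal_def
  proof (intro conjI ballI allI)
    show "0 \<in> gen_ideal p x" using I[of 0 0 0] by simp
    fix y assume "y \<in> gen_ideal p x"
    then obtain s t u where y: "y = s * f + t * x + [:p:] * u" unfolding gen_ideal_def by blast
    show "a * y \<in> gen_ideal p x" for a
      using I[of "a * s" "a * t" "a * u"] by (simp add: y algebra_simps)
    fix z assume "z \<in> gen_ideal p x"
    then obtain s' t' u' where z: "z = s' * f + t' * x + [:p:] * u'" unfolding gen_ideal_def by blast
    show "y + z \<in> gen_ideal p x"
      using I[of "s + s'" "t + t'" "u + u'"] by (simp add: y z algebra_simps smult_add_right)
  qed
qed

lemma gen_ideal_proper:
  assumes "prime p" "p dvd N x" shows "1 \<notin> gen_ideal p x"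
  using not_comaximal_if_dvd_N[OF assms(2)] assms(1) not_prime_unit unfolding gen_ideal_def by blast

definition big_ideals :: "int \<Rightarrow> int poly set set" where
  "big_ideals p = {J \<in> ideals_over p f. p\<^sup>2 \<le> int (card (quot J))}"

lemma big_ideal_or_root:
  fixes p :: int
  assumes p: "prime p" and J: "J \<in> ideals_over p f" "1 \<notin> J"
  shows "J \<in> big_ideals p \<or> (\<exists>r\<in>{0..<p}. p dvd poly f r \<and> J = root_ideal p r)"
proof -
  have iJ: "is_ideal J" "[:p:] \<in> J" "f \<in> J" using J by (auto simp: ideals_over_def)
  have fin: "finite (quot J)" using finite_quot_over[OF iJ(1,3,2)] p by auto
  from ideal_dichotomy[OF iJ monic J(2) p fin] show ?thesis
  proof
    assume "p\<^sup>2 \<le> int (card (quot J))" then show ?thesis using J by (simp add: big_ideals_def)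
  next
    assume "\<exists>r\<in>{0..<p}. J = root_ideal p r"
    then obtain r where r: "r \<in> {0..<p}" "J = root_ideal p r" by blast
    then have "p dvd poly f r" using iJ(3) by (simp add: root_ideal_def)
    then show ?thesis using r by blast
  qed
qed

text \<open>When \<open>p\<close> divides the norm, the ideal generated by \<open>f\<close>,
  \<open>x\<close> and \<open>p\<close> is proper, so the dichotomy applies to it.\<close>

lemma dvd_N_cases:
  fixes p :: int
  assumes p: "prime p" and x: "p dvd N x"
  shows "(\<exists>J\<in>big_ideals p. gen_ideal p x = J) \<or> (\<exists>r\<in>{0..<p}. p dvd poly f r \<and> gen_ideal p x = root_ideal p r)"
proof -
  have "gen_ideal p x \<in> ideals_over p f" using gen_ideal by (simp add: ideals_over_def)
  from big_ideal_or_root[OF p this gen_ideal_proper[OF p x]] show ?thesis by blast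
qed

lemma poly_diff_dvd: "a - b dvd poly q a - poly q (b :: int)"
proof (induction q)
  case (pCons c q)
  have "poly (pCons c q) a - poly (pCons c q) b = a * (poly q a - poly q b) + (a - b) * poly q b"
    by (simp add: algebra_simps)
  then show ?case using pCons by simp
qed simp

lemma poly_cong_dvd:
  fixes p :: int
  assumes "p dvd a - b" shows "p dvd poly q a \<longleftrightarrow> p dvd poly q b"
proof -
  have "p dvd poly q a - poly q b" using assms poly_diff_dvd[of a b q] dvd_trans by blast
  then show ?thesis using dvd_add_right_iff[of p "poly q a - poly q b" "poly q b"] by simp
qed

text \<open>
  If the only ideal above \<open>p\<close> containing \<open>x\<close> belongs to a root \<open>r\<close>, lift \<open>r\<close> to \<open>r1\<close> with \<open>p\<^sup>2\<close> not
  dividing \<open>f r1\<close>. Up to factors prime to \<open>p\<close>, \<open>x\<close> is then a multiple of \<open>X - r1\<close>, whose norm has exactly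
  one factor \<open>p\<close>, so that \<open>p\<close> still divides the norm of the quotient.
\<close>

lemma square_dvd_N_cases:
  fixes p :: int
  assumes p: "prime p" and disc: "\<not> p dvd disc" and x: "p\<^sup>2 dvd N x"
  shows "(\<exists>J\<in>big_ideals p. x \<in> J) \<or>
    (\<exists>r\<in>{0..<p}. p dvd poly f r \<and> (\<forall>t. p dvd t - r \<longrightarrow> p\<^sup>2 dvd poly f t \<longrightarrow> p\<^sup>2 dvd poly x t))"
proof -
  have px: "p dvd N x" using x by (auto simp: power2_eq_square intro: dvd_mult_left)
  have p0: "p \<noteq> 0" using p by auto
  from dvd_N_cases[OF p px] show ?thesis
  proof
    assume "\<exists>J\<in>big_ideals p. gen_ideal p x = J"
    then show ?thesis using gen_ideal(3)[of x p] by blast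
  next
    assume "\<exists>r\<in>{0..<p}. p dvd poly f r \<and> gen_ideal p x = root_ideal p r"
    then obtain r where r: "r \<in> {0..<p}" "p dvd poly f r" "gen_ideal p x = root_ideal p r" by blast
    \<comment> \<open>If \<open>p ^ 2\<close> divides \<open>f(r)\<close>, replacing
      \<open>r\<close> by \<open>r + p\<close> changes the value by \<open>p * f'(r)\<close> modulo
      \<open>p ^ 2\<close>, and this is not 0 because the root is simple.\<close>
    have "\<exists>r1. p dvd r1 - r \<and> \<not> p\<^sup>2 dvd poly f r1"
    proof (cases "p\<^sup>2 dvd poly f r")
      case False then show ?thesis by (intro exI[of _ r]) simp
    next
      case True
      obtain e where e: "poly f (r + p) = poly f r + p * poly (pderiv f) r + p\<^sup>2 * e"
        using poly_taylor2 by blast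
      have "\<not> p\<^sup>2 dvd poly f (r + p)"
      proof
        assume "p\<^sup>2 dvd poly f (r + p)"
        then have "p\<^sup>2 dvd poly f (r + p) - (poly f r + p\<^sup>2 * e)" using True by (intro dvd_diff dvd_add) auto
        then have "p * p dvd p * poly (pderiv f) r" unfolding e by (simp add: power2_eq_square)
        then show False using simple_root[OF disc r(2)] p0 by simp
      qed
      then show ?thesis by (intro exI[of _ "r + p"]) simp
    qed
    then obtain r1 where r1: "p dvd r1 - r" "\<not> p\<^sup>2 dvd poly f r1" by blast
    have "p dvd poly f r1" using poly_cong_dvd[OF r1(1)] r(2) by blast
    then obtain u where u: "poly f r1 = p * u" by blast
    have pu: "\<not> p dvd u" using r1(2) u p0 by (auto simp: power2_eq_square)
    have "p dvd poly x r" using gen_ideal(3)[of x p] r(3) by (simp add: root_ideal_def)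
    then have "p dvd poly x r1" using poly_cong_dvd[OF r1(1)] by blast
    then obtain s where s: "poly x r1 = p * s" by blast
    obtain y where y: "x - [:poly x r1:] = [:- r1, 1:] * y"
      using poly_eq_0_iff_dvd[of "x - [:poly x r1:]" r1] by (auto elim: dvdE)
    obtain F where F: "f - [:poly f r1:] = [:- r1, 1:] * F"
      using poly_eq_0_iff_dvd[of "f - [:poly f r1:]" r1] by (auto elim: dvdE)
    \<comment> \<open>Chosen to eliminate \<open>p\<close> between
      \<open>x = (X - r1) * y + p * s\<close> and \<open>f = (X - r1) * F + p * u\<close>.\<close>
    define y' where "y' = [:u:] * y - [:s:] * F"
    have main: "[:u:] * x = [:- r1, 1:] * y' + [:s:] * f"
    proof -
      have "x = [:- r1, 1:] * y + [:p * s:]" using y s by (metis diff_eq_eq)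
      then have "[:u:] * x = [:u:] * ([:- r1, 1:] * y) + [:u:] * [:p * s:]" by (metis distrib_left)
      also have "[:u:] * [:p * s:] = [:s:] * [:poly f r1:]" by (simp add: u)
      also have "[:poly f r1:] = f - [:- r1, 1:] * F" using F by (simp add: algebra_simps)
      finally show ?thesis unfolding y'_def by (simp only: algebra_simps)
    qed
    have "N [:u:] * N x = N [:- r1, 1:] * N y'" using main by (metis N_add_multiple N_mult)
    then have "p\<^sup>2 dvd N [:- r1, 1:] * N y'" using x by (metis dvd_mult)
    then have "p\<^sup>2 dvd poly f r1 * N y'" using N_linear[of r1] by (metis abs_mult dvd_abs_iff)
    then have "p * p dvd p * (u * N y')" unfolding u by (simp add: power2_eq_square mult.assoc)
    then have "p dvd u * N y'" using p0 by simp
    then have py': "p dvd N y'" using pu p by (simp add: prime_dvd_mult_iff)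
    have iy: "is_ideal (gen_ideal p y')" by (rule gen_ideal)
    have "coprime u p" using pu p by (simp add: prime_imp_coprime coprime_commute)
    then obtain a b where ab: "a * u + b * p = 1" by (metis bezout_int coprime_imp_gcd_eq_1)
    have "[:u:] * x \<in> gen_ideal p y'" unfolding main
      by (intro ideal_add[OF iy] ideal_mult[OF iy] gen_ideal)
    then have "[:a:] * ([:u:] * x) + ([:b:] * x) * [:p:] \<in> gen_ideal p y'"
      by (rule ideal_add[OF iy ideal_mult[OF iy] ideal_mult[OF iy gen_ideal(4)]])
    moreover have "[:a:] * ([:u:] * x) + ([:b:] * x) * [:p:] = x"
    proof -
      have "[:a:] * ([:u:] * x) + ([:b:] * x) * [:p:] = smult (a * u + b * p) x"
        by (simp add: smult_add_left mult.commute)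
      then show ?thesis using ab by simp
    qed
    ultimately have xy': "x \<in> gen_ideal p y'" by simp
    from dvd_N_cases[OF p py'] show ?thesis
    proof
      assume "\<exists>J\<in>big_ideals p. gen_ideal p y' = J"
      then show ?thesis using xy' by blast
    next
      assume "\<exists>r\<in>{0..<p}. p dvd poly f r \<and> gen_ideal p y' = root_ideal p r"
      then obtain r' where r': "r' \<in> {0..<p}" "gen_ideal p y' = root_ideal p r'" by blast
      \<comment> \<open>The inclusion identifies the root attached to \<open>y'\<close> with
        \<open>r\<close>. For \<open>t\<close> congruent to \<open>r\<close>, both
        \<open>t - r1\<close> and \<open>y'(t)\<close> are then divisible by \<open>p\<close>, which
        accounts for \<open>p ^ 2\<close>.\<close>
      have "gen_ideal p x \<subseteq> gen_ideal p y'"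
      proof
        fix z assume "z \<in> gen_ideal p x"
        then obtain s t u where z: "z = s * f + t * x + u * [:p:]" unfolding gen_ideal_def by (auto simp: mult.commute)
        show "z \<in> gen_ideal p y'" unfolding z by (intro ideal_add[OF iy] ideal_mult[OF iy] gen_ideal xy')
      qed
      moreover have "[:- r, 1:] \<in> gen_ideal p x" unfolding r(3) by (simp add: root_ideal_def)
      ultimately have "[:- r, 1:] \<in> root_ideal p r'" using r'(2) by blast
      then have "p dvd r' - r" by (simp add: root_ideal_def)
      then have "r' mod p = r mod p" by (simp add: mod_eq_dvd_iff)
      then have "r' = r" using r(1) r'(1) by simp
      then have y'r: "p dvd poly y' r" using gen_ideal(3)[of y' p] r'(2) by (simp add: root_ideal_def)
      have "p\<^sup>2 dvd poly x t" if t: "p dvd t - r" "p\<^sup>2 dvd poly f t" for t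
      proof -
        have "p dvd (t - r) - (r1 - r)" using t(1) r1(1) by (rule dvd_diff)
        then have 1: "p dvd t - r1" by simp
        have 2: "p dvd poly y' t" using poly_cong_dvd[OF t(1)] y'r by blast
        have "u * poly x t = (t - r1) * poly y' t + s * poly f t"
          using arg_cong[OF main, of "\<lambda>q. poly q t"] by (simp add: algebra_simps)
        moreover have "p\<^sup>2 dvd (t - r1) * poly y' t" unfolding power2_eq_square using 1 2 by (rule mult_dvd_mono)
        ultimately have "p\<^sup>2 dvd u * poly x t" using t(2) by simp
        moreover have "coprime (p\<^sup>2) u" using \<open>coprime u p\<close> by (simp add: coprime_commute)
        ultimately show ?thesis by (simp add: coprime_dvd_mult_right_iff)
      qed
      then show ?thesis using r by blast
    qed
  qed
qed

text \<open>One Newton step, with \<open>a\<close> an inverse of \<open>f'(r)\<close> modulo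
  \<open>p\<close>; it exists because the root is simple.\<close>

lemma hensel_lift:
  fixes p :: int
  assumes p: "prime p" and disc: "\<not> p dvd disc" and r: "p dvd poly f r"
  obtains t where "p dvd t - r" "p\<^sup>2 dvd poly f t"
proof -
  obtain c where c: "poly f r = p * c" using r by blast
  have "coprime (poly (pderiv f) r) p" using simple_root[OF disc r] p by (simp add: prime_imp_coprime coprime_commute)
  then obtain a b where ab: "a * poly (pderiv f) r + b * p = 1" by (metis bezout_int coprime_imp_gcd_eq_1)
  obtain e where e: "poly f (r + p * (- c * a)) = poly f r + (p * (- c * a)) * poly (pderiv f) r + (p * (- c * a))\<^sup>2 * e"
    using poly_taylor2 by blast
  have "poly f r + (p * (- c * a)) * poly (pderiv f) r = p * c * (1 - a * poly (pderiv f) r)"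
    unfolding c by (simp add: algebra_simps)
  also have "1 - a * poly (pderiv f) r = b * p" using ab by linarith
  also have "p * c * (b * p) = p\<^sup>2 * (c * b)" by (simp add: algebra_simps power2_eq_square)
  finally have "poly f (r + p * (- c * a)) = p\<^sup>2 * (c * b + (- c * a)\<^sup>2 * e)" unfolding e
    by (simp add: power_mult_distrib algebra_simps)
  then show thesis by (intro that[of "r + p * (- c * a)"]) auto
qed

lemma card_quot_root_ideal: "p > 0 \<Longrightarrow> card (quot (root_ideal p t)) = nat p"
proof -
  assume p: "p > 0"
  have "poly x t mod p = poly y t mod p \<longleftrightarrow> x - y \<in> root_ideal p t" for x y
    by (simp add: root_ideal_def mod_eq_dvd_iff)
  then have "card (quot (root_ideal p t)) = card (range (\<lambda>x. poly x t mod p))"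
    by (rule quot_card_eq(1)[OF is_ideal_root_ideal])
  also have "range (\<lambda>x. poly x t mod p) = {0..<p}"
  proof (intro equalityI subsetI)
    fix c assume "c \<in> {0..<p}"
    then have "c = poly [:c:] t mod p" by simp
    then show "c \<in> range (\<lambda>x. poly x t mod p)" by blast
  qed (use p in auto)
  finally show ?thesis by simp
qed

definition roots_mod :: "int \<Rightarrow> int set" where
  "roots_mod p = {r\<in>{0..<p}. p dvd poly f r}"

text \<open>Distinct roots give distinct ideals above \<open>p\<close>, so the bound
  \<open>2 ^ n\<close> is inherited from the count of those ideals.\<close>

lemma card_roots_mod:
  fixes p :: int
  assumes "prime p"
  shows "finite (roots_mod p)" "card (roots_mod p) \<le> 2 ^ n"
proof -
  show "finite (roots_mod p)" unfolding roots_mod_def by (rule finite_subset[of _ "{0..<p}"]) auto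
  have inj: "inj_on (root_ideal p) (roots_mod p)"
  proof (rule inj_onI)
    fix r s assume rs: "r \<in> roots_mod p" "s \<in> roots_mod p" "root_ideal p r = root_ideal p s"
    have "[:- r, 1:] \<in> root_ideal p s" unfolding rs(3)[symmetric] by (simp add: root_ideal_def)
    then have "s mod p = r mod p" by (simp add: root_ideal_def mod_eq_dvd_iff)
    then show "r = s" using rs(1,2) by (simp add: roots_mod_def)
  qed
  have "root_ideal p ` roots_mod p \<subseteq> ideals_over p f"
    using is_ideal_root_ideal by (auto simp: ideals_over_def roots_mod_def root_ideal_def)
  then show "card (roots_mod p) \<le> 2 ^ n"
    using card_ideals_over[OF assms monic] card_inj_on_le[OF inj, of "ideals_over p f"] n_def by simp
qed

text \<open>
  The ideals responsible for everything except a single simple factor \<open>p\<close> of \<open>N x\<close> coming from a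
  single root: there are boundedly many of them, each of index at least \<open>p\<^sup>2\<close>.
\<close>

lemma bad_family:
  fixes p :: int
  assumes p: "prime p" and disc: "\<not> p dvd disc"
  obtains \<B> where "finite \<B>" "card \<B> \<le> 2 * 2 ^ n"
    "\<And>J. J \<in> \<B> \<Longrightarrow> is_ideal J \<and> f \<in> J \<and> p\<^sup>2 \<le> int (card (quot J))"
    "\<And>x. p dvd N x \<Longrightarrow> x \<in> \<Union>\<B> \<or> (\<exists>r\<in>roots_mod p. x \<in> root_ideal p r)"
    "\<And>x. p\<^sup>2 dvd N x \<Longrightarrow> x \<in> \<Union>\<B>"
    "\<And>x r s. r \<in> roots_mod p \<Longrightarrow> s \<in> roots_mod p \<Longrightarrow> r \<noteq> s \<Longrightarrow> x \<in> root_ideal p r \<Longrightarrow> x \<in> root_ideal p s \<Longrightarrow> x \<in> \<Union>\<B>"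
proof -
  have "\<forall>r. \<exists>t. p dvd poly f r \<longrightarrow> p dvd t - r \<and> p\<^sup>2 dvd poly f t"
    using hensel_lift[OF p disc] by metis
  then obtain l where l: "\<And>r. p dvd poly f r \<Longrightarrow> p dvd l r - r \<and> p\<^sup>2 dvd poly f (l r)" by metis
  \<comment> \<open>Besides the ideals of large index, the family contains for each root the
    polynomials vanishing modulo \<open>p ^ 2\<close> at its Hensel lift \<open>l r\<close>; these
    catch a repeated factor \<open>p\<close> at a single root.\<close>
  define \<B> where "\<B> = big_ideals p \<union> (\<lambda>r. root_ideal (p\<^sup>2) (l r)) ` roots_mod p"
  have big: "finite (big_ideals p)" "card (big_ideals p) \<le> 2 ^ n"
    using card_ideals_over[OF p monic] card_mono[of "ideals_over p f" "big_ideals p"] n_def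
    by (auto simp: big_ideals_def)
  have p0: "p > 0" using p by (simp add: prime_gt_0_int)
  show thesis
  proof (rule that[of \<B>])
    show "finite \<B>" using big card_roots_mod[OF p] by (simp add: \<B>_def)
    have "card \<B> \<le> card (big_ideals p) + card ((\<lambda>r. root_ideal (p\<^sup>2) (l r)) ` roots_mod p)"
      unfolding \<B>_def by (rule card_Un_le)
    also have "\<dots> \<le> 2 ^ n + 2 ^ n"
      using big card_roots_mod[OF p] card_image_le[of "roots_mod p" "\<lambda>r. root_ideal (p\<^sup>2) (l r)"] by linarith
    finally show "card \<B> \<le> 2 * 2 ^ n" by simp
    show "is_ideal J \<and> f \<in> J \<and> p\<^sup>2 \<le> int (card (quot J))" if J: "J \<in> \<B>" for J
      using J unfolding \<B>_def
    proof
      assume "J \<in> big_ideals p" then show ?thesis by (simp add: big_ideals_def ideals_over_def)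
    next
      assume "J \<in> (\<lambda>r. root_ideal (p\<^sup>2) (l r)) ` roots_mod p"
      then obtain r where r: "r \<in> roots_mod p" "J = root_ideal (p\<^sup>2) (l r)" by blast
      have "f \<in> J" using l[of r] r by (simp add: root_ideal_def roots_mod_def)
      then show ?thesis using is_ideal_root_ideal r(2) card_quot_root_ideal[of "p\<^sup>2" "l r"] p0 by simp
    qed
    show "x \<in> \<Union>\<B> \<or> (\<exists>r\<in>roots_mod p. x \<in> root_ideal p r)" if x: "p dvd N x" for x
      using dvd_N_cases[OF p x] gen_ideal(3)[of x p] unfolding \<B>_def roots_mod_def by blast
    show "x \<in> \<Union>\<B>" if x: "p\<^sup>2 dvd N x" for x
      using square_dvd_N_cases[OF p disc x]
    proof
      assume "\<exists>J\<in>big_ideals p. x \<in> J" then show ?thesis unfolding \<B>_def by blast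
    next
      assume "\<exists>r\<in>{0..<p}. p dvd poly f r \<and> (\<forall>t. p dvd t - r \<longrightarrow> p\<^sup>2 dvd poly f t \<longrightarrow> p\<^sup>2 dvd poly x t)"
      then obtain r where "r \<in> roots_mod p" "p\<^sup>2 dvd poly x (l r)" using l unfolding roots_mod_def by blast
      then have "x \<in> root_ideal (p\<^sup>2) (l r)" by (simp add: root_ideal_def)
      then show ?thesis using \<open>r \<in> roots_mod p\<close> unfolding \<B>_def by blast
    qed
    show "x \<in> \<Union>\<B>" if rs: "r \<in> roots_mod p" "s \<in> roots_mod p" "r \<noteq> s" "x \<in> root_ideal p r" "x \<in> root_ideal p s" for x r s
    proof -
      \<comment> \<open>A proper ideal above \<open>p\<close> that is contained in two different
        root ideals is not a root ideal, so it has index at least \<open>p ^ 2\<close>.\<close>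
      let ?J = "root_ideal p r \<inter> root_ideal p s"
      have J: "?J \<in> ideals_over p f" "1 \<notin> ?J"
        using rs(1,2) is_ideal_root_ideal[of p] p not_prime_unit
        by (auto simp: ideals_over_def is_ideal_def roots_mod_def root_ideal_def)
      have "?J \<noteq> root_ideal p t" if t: "t \<in> {0..<p}" for t
      proof
        assume eq: "?J = root_ideal p t"
        have "[:- t, 1:] \<in> ?J" unfolding eq by (simp add: root_ideal_def)
        then have "r mod p = t mod p" "s mod p = t mod p" by (auto simp: root_ideal_def mod_eq_dvd_iff)
        then show False using rs(1-3) t by (simp add: roots_mod_def)
      qed
      then have "?J \<in> big_ideals p" using big_ideal_or_root[OF p J] by blast
      then show ?thesis using rs(4,5) unfolding \<B>_def by blast
    qed
  qed
qed

end

section \<open>Elementary estimates\<close>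

lemma prod_primes_dvd:
  fixes a :: nat
  assumes "finite Q" "\<And>p. p \<in> Q \<Longrightarrow> prime p \<and> p dvd a"
  shows "\<Prod>Q dvd a"
  using assms
proof (induction Q rule: finite_induct)
  case (insert p Q)
  have "coprime p (\<Prod>Q)"
    using insert by (intro prod_coprime_right) (auto intro: primes_coprime)
  then show ?case using insert by (auto intro: divides_mult)
qed simp

lemma sum_ln_primes_le:
  fixes a :: nat
  assumes "finite Q" "\<And>p. p \<in> Q \<Longrightarrow> prime p \<and> p dvd a" "a > 0"
  shows "(\<Sum>p\<in>Q. ln (real p)) \<le> ln (real a)"
proof -
  have pos: "p > 0" if "p \<in> Q" for p using assms(2)[OF that] by (auto intro: prime_gt_0_nat)
  have "\<Prod>Q \<le> a" using prod_primes_dvd[OF assms(1,2)] assms(3) by (rule dvd_imp_le)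
  moreover have "\<Prod>Q > 0" using pos by (intro prod_pos) auto
  ultimately have "ln (real (\<Prod>Q)) \<le> ln (real a)"
    by (subst ln_le_cancel_iff) (simp_all only: of_nat_0_less_iff of_nat_le_iff assms(3))
  moreover have "ln (real (\<Prod>Q)) = (\<Sum>p\<in>Q. ln (real p))"
    using pos assms(1) by (subst of_nat_prod, subst ln_prod) auto
  ultimately show ?thesis by simp
qed

lemma ln_eq_sum_multiplicity:
  fixes a :: nat
  assumes "finite Q" "\<And>p. p \<in> Q \<Longrightarrow> prime p" "prime_factors a \<subseteq> Q" "a > 0"
  shows "ln (real a) = (\<Sum>p\<in>Q. real (multiplicity p a) * ln (real p))"
proof -
  have pos: "p > 0" if "p \<in> prime_factors a" for p using that by (auto intro: prime_gt_0_nat)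
  have "ln (real a) = ln (real (\<Prod>p\<in>prime_factors a. p ^ multiplicity p a))"
    using assms(4) by (subst (1) prime_factorization_nat[of a]) auto
  also have "\<dots> = (\<Sum>p\<in>prime_factors a. real (multiplicity p a) * ln (real p))"
    using pos by (subst of_nat_prod, subst ln_prod) (auto simp: ln_realpow)
  also have "\<dots> = (\<Sum>p\<in>Q. real (multiplicity p a) * ln (real p))"
    using assms by (intro sum.mono_neutral_left)
      (auto simp: prime_factors_multiplicity)
  finally show ?thesis .
qed

lemma multiplicity_ln_le:
  fixes a :: nat
  assumes "prime p" "a > 0"
  shows "real (multiplicity p a) * ln (real p) \<le> ln (real a)"
proof -
  have "p ^ multiplicity p a dvd a" by (rule multiplicity_dvd)
  then have "p ^ multiplicity p a \<le> a" using assms(2) by (rule dvd_imp_le)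
  moreover have "p > 0" using assms(1) by (rule prime_gt_0_nat)
  ultimately have "ln (real (p ^ multiplicity p a)) \<le> ln (real a)"
    using assms(2) by (subst ln_le_cancel_iff) (simp_all only: of_nat_0_less_iff of_nat_le_iff zero_less_power)
  then show ?thesis using \<open>p > 0\<close> by (simp add: ln_realpow)
qed

text \<open>All primes in the interval divide the central binomial coefficient, which is at most
  \<open>4 ^ m\<close>.\<close>

lemma chebyshev_dyadic:
  assumes "m > 0"
  shows "(\<Sum>p | prime p \<and> m < p \<and> p \<le> 2 * m. ln (real p) / real p) \<le> ln 4"
proof -
  let ?Q = "{p. prime p \<and> m < p \<and> p \<le> 2 * m}"
  have fin: "finite ?Q" by (rule finite_subset[of _ "{..2*m}"]) auto
  have dvd: "p dvd (2 * m choose m)" if p: "p \<in> ?Q" for p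
  proof -
    have "p dvd fact (2 * m)" using p by (auto simp: prime_dvd_fact_iff)
    also have "fact (2 * m) = fact m * fact (2 * m - m) * (2 * m choose m)"
      by (rule binomial_fact_lemma[symmetric]) simp
    finally have "p dvd fact m * fact m * (2 * m choose m)" by (simp add: mult_2)
    moreover have "\<not> p dvd fact m" using p by (auto simp: prime_dvd_fact_iff)
    ultimately show ?thesis using p by (auto simp: prime_dvd_mult_iff)
  qed
  have le4: "(2 * m choose m) \<le> 4 ^ m"
  proof -
    have "(2 * m choose m) \<le> (\<Sum>k\<le>2 * m. (2 * m) choose k)" by (rule member_le_sum) auto
    also have "\<dots> = 4 ^ m" by (simp add: choose_row_sum power_mult)
    finally show ?thesis .
  qed
  have pos: "(2 * m choose m) > 0" by simp
  have "(\<Sum>p\<in>?Q. ln (real p)) \<le> ln (real (2 * m choose m))"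
    using dvd by (intro sum_ln_primes_le fin pos) auto
  also have "\<dots> \<le> ln (real (4 ^ m))" using le4 pos by (subst ln_le_cancel_iff) (auto simp del: of_nat_power zero_less_binomial_iff)
  also have "\<dots> = real m * ln 4" by (simp add: ln_realpow)
  finally have *: "(\<Sum>p\<in>?Q. ln (real p)) \<le> real m * ln 4" .
  have "(\<Sum>p\<in>?Q. ln (real p) / real p) \<le> (\<Sum>p\<in>?Q. ln (real p) / real m)"
    using assms by (intro sum_mono divide_left_mono) auto
  also have "\<dots> = (\<Sum>p\<in>?Q. ln (real p)) / real m" by (simp add: sum_divide_distrib)
  also have "\<dots> \<le> ln 4" using * assms by (simp add: divide_le_eq mult.commute)
  finally show ?thesis .
qed

lemma chebyshev_range:
  assumes "m > 0"
  shows "(\<Sum>p | prime p \<and> m < p \<and> p \<le> 2 ^ j * m. ln (real p) / real p) \<le> real j * ln 4"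
proof (induction j)
  case 0
  have "{p. prime p \<and> m < p \<and> p \<le> 2 ^ 0 * m} = {}" by auto
  then show ?case by (simp only: sum.empty)
next
  case (Suc j)
  let ?A = "{p. prime p \<and> m < p \<and> p \<le> 2 ^ j * m}" and ?B = "{p. prime p \<and> 2 ^ j * m < p \<and> p \<le> 2 * (2 ^ j * m)}"
  have fin: "finite ?A" "finite ?B"
    using finite_subset[of ?A "{..2 ^ j * m}"] finite_subset[of ?B "{..2 * (2 ^ j * m)}"] by blast+
  have "m \<le> 2 ^ j * m" by simp
  then have "m < p" if "2 ^ j * m < p" for p using that by (rule le_less_trans)
  then have "{p. prime p \<and> m < p \<and> p \<le> 2 ^ Suc j * m} = ?A \<union> ?B" by auto
  then have "(\<Sum>p | prime p \<and> m < p \<and> p \<le> 2 ^ Suc j * m. ln (real p) / real p) =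
    (\<Sum>p\<in>?A. ln (real p) / real p) + (\<Sum>p\<in>?B. ln (real p) / real p)"
    by (simp only:) (intro sum.union_disjoint fin, auto)
  also have "\<dots> \<le> real j * ln 4 + ln 4"
    using Suc chebyshev_dyadic[of "2 ^ j * m"] assms by (intro add_mono) auto
  finally show ?case by (simp add: algebra_simps)
qed

lemma sum_ln_over_square_bounded:
  obtains K :: real where "K \<ge> 0" "\<And>Q. finite Q \<Longrightarrow> (\<Sum>p\<in>Q. ln (real p) / (real p)\<^sup>2) \<le> K"
proof -
  have "summable (\<lambda>m::nat. ln (real m) / (real m)\<^sup>2)"
  proof (rule summable_comparison_test_bigo)
    show "summable (\<lambda>m. norm (real m powr (-3/2)))" by (simp add: summable_real_powr_iff)
    show "(\<lambda>m. ln (real m) / (real m)\<^sup>2) \<in> O(\<lambda>m. real m powr (-3/2))" by real_asymp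
  qed
  moreover have nn: "0 \<le> ln (real m) / (real m)\<^sup>2" for m
    by (cases "m = 0") auto
  ultimately have "(\<Sum>p\<in>Q. ln (real p) / (real p)\<^sup>2) \<le> (\<Sum>m. ln (real m) / (real m)\<^sup>2)" if "finite Q" for Q
    using that by (intro sum_le_suminf) auto
  moreover have "(\<Sum>m. ln (real m) / (real m)\<^sup>2) \<ge> 0"
    using \<open>summable _\<close> nn by (intro suminf_nonneg)
  ultimately show thesis using that by blast
qed

lemma sum_inverse_square_tail:
  assumes "finite Q" "\<And>p. p \<in> Q \<Longrightarrow> P < p" "P > (0::nat)"
  shows "(\<Sum>p\<in>Q. 1 / (real p)\<^sup>2) \<le> 1 / real P"
proof -
  obtain M where M: "\<And>p. p \<in> Q \<Longrightarrow> p \<le> M" "P \<le> M"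
    using assms(1) by (metis Max_ge finite_insert insertCI)
  have tele: "(\<Sum>p\<in>{P<..P+d}. 1 / (real p)\<^sup>2) \<le> 1 / real P - 1 / real (P + d)" for d
  proof (induction d)
    case (Suc d)
    have "{P<..P + Suc d} = insert (P + Suc d) {P<..P + d}" by auto
    then have "(\<Sum>p\<in>{P<..P+Suc d}. 1 / (real p)\<^sup>2) = 1 / (real (P + Suc d))\<^sup>2 + (\<Sum>p\<in>{P<..P+d}. 1 / (real p)\<^sup>2)"
      by simp
    also have "1 / (real (P + Suc d))\<^sup>2 \<le> 1 / real (P + d) - 1 / real (P + Suc d)"
    proof -
      define x where "x = real (P + d)"
      have x: "x > 0" using assms(3) by (simp add: x_def)
      have "1 / (x + 1)\<^sup>2 \<le> 1 / (x * (x + 1))"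
        using x by (intro divide_left_mono) (auto simp: power2_eq_square)
      also have "\<dots> = 1 / x - 1 / (x + 1)" using x by (simp add: divide_simps)
      finally show ?thesis by (simp add: x_def add.commute)
    qed
    finally show ?case using Suc by linarith
  qed simp
  have "(\<Sum>p\<in>Q. 1 / (real p)\<^sup>2) \<le> (\<Sum>p\<in>{P<..M}. 1 / (real p)\<^sup>2)"
    using M assms by (intro sum_mono2) auto
  also have "\<dots> \<le> 1 / real P" using tele[of "M - P"] M(2) by (simp add: order_trans)
  finally show ?thesis .
qed

lemma card_int_interval:
  fixes c \<rho> :: real assumes "\<rho> > 0"
  shows "finite {a::int. \<bar>real_of_int a + c\<bar> < \<rho>}" "real (card {a::int. \<bar>real_of_int a + c\<bar> < \<rho>}) \<le> 2 * \<rho> + 1"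
proof -
  have sub: "{a::int. \<bar>real_of_int a + c\<bar> < \<rho>} \<subseteq> {\<lceil>- c - \<rho>\<rceil>..\<lfloor>- c + \<rho>\<rfloor>}"
    by (auto simp: ceiling_le_iff le_floor_iff abs_less_iff)
  show "finite {a::int. \<bar>real_of_int a + c\<bar> < \<rho>}" using sub by (rule finite_subset) simp
  have "card {a::int. \<bar>real_of_int a + c\<bar> < \<rho>} \<le> card {\<lceil>- c - \<rho>\<rceil>..\<lfloor>- c + \<rho>\<rfloor>}"
    using sub by (intro card_mono) auto
  also have "\<dots> = nat (\<lfloor>- c + \<rho>\<rfloor> - \<lceil>- c - \<rho>\<rceil> + 1)" by simp
  finally have "real (card {a::int. \<bar>real_of_int a + c\<bar> < \<rho>}) \<le> real (nat (\<lfloor>- c + \<rho>\<rfloor> - \<lceil>- c - \<rho>\<rceil> + 1))"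
    by (simp only: of_nat_le_iff)
  also have "\<dots> \<le> 2 * \<rho> + 1" using assms by linarith
  finally show "real (card {a::int. \<bar>real_of_int a + c\<bar> < \<rho>}) \<le> 2 * \<rho> + 1" .
qed

lemma card_congruent_interval:
  fixes M r :: int assumes "M > 0"
  shows "real (card {a\<in>{- int B..int B}. M dvd a - r}) \<le> 2 * real B / real_of_int M + 1"
proof -
  let ?S = "{a\<in>{- int B..int B}. M dvd a - r}"
  have "inj_on (\<lambda>a. (a - r) div M) ?S"
  proof (rule inj_onI)
    fix a b assume "a \<in> ?S" "b \<in> ?S" "(a - r) div M = (b - r) div M"
    then have "a - r = b - r" by (metis (mono_tags, lifting) dvd_mult_div_cancel mem_Collect_eq)
    then show "a = b" by simp
  qed
  moreover have "(\<lambda>a. (a - r) div M) ` ?S \<subseteq> {\<lceil>(- real B - r) / M\<rceil>..\<lfloor>(real B - r) / M\<rfloor>}"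
  proof clarsimp
    fix a assume a: "- int B \<le> a" "a \<le> int B" "M dvd a - r"
    then obtain e where e: "a = r + M * e" by (metis dvd_def add_diff_cancel_left' diff_add_cancel add.commute)
    have "- real B - real_of_int r \<le> real_of_int M * real_of_int e" "real_of_int M * real_of_int e \<le> real B - real_of_int r"
    proof -
      have "real_of_int (- int B) \<le> real_of_int (r + M * e)" "real_of_int (r + M * e) \<le> real_of_int (int B)"
        using a(1,2) unfolding e by (simp_all only: of_int_le_iff)
      then show "- real B - real_of_int r \<le> real_of_int M * real_of_int e" "real_of_int M * real_of_int e \<le> real B - real_of_int r"
        by simp_all
    qed
    then show "\<lceil>(- real B - real_of_int r) / real_of_int M\<rceil> \<le> (a - r) div M \<and> (a - r) div M \<le> \<lfloor>(real B - real_of_int r) / real_of_int M\<rfloor>"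
      using assms by (simp add: e ceiling_le_iff le_floor_iff divide_le_eq le_divide_eq mult.commute)
  qed
  ultimately have "card ?S \<le> card {\<lceil>(- real B - r) / M\<rceil>..\<lfloor>(real B - r) / M\<rfloor>}"
    by (rule card_inj_on_le) auto
  also have "\<dots> = nat (\<lfloor>(real B - r) / M\<rfloor> - \<lceil>(- real B - r) / M\<rceil> + 1)" by simp
  finally have "real (card ?S) \<le> real (nat (\<lfloor>(real B - r) / M\<rfloor> - \<lceil>(- real B - r) / M\<rceil> + 1))" by (simp only: of_nat_le_iff)
  also have "\<dots> \<le> (real B - r) / M - (- real B - r) / M + 1"
  proof -
    have "0 \<le> 2 * real B / M" using assms by simp
    moreover have "(real B - r) / M - (- real B - r) / M = 2 * real B / M" by (simp add: diff_divide_distrib)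
    ultimately have "(- real B - r) / M \<le> (real B - r) / M" by linarith
    then show ?thesis by linarith
  qed
  also have "\<dots> = 2 * real B / M + 1" by (simp add: diff_divide_distrib)
  finally show ?thesis .
qed

text \<open>
  This controls the finitely many primes for which \<open>bad_family\<close> is too weak.
\<close>

lemma power_root_classes:
  fixes p :: int and G :: "int poly"
  assumes p: "prime p" and "monic G" "degree G = n" "J > n * k"
  shows "\<exists>R. finite R \<and> card R \<le> n \<and> (\<forall>y. p ^ J dvd poly G y \<longrightarrow> (\<exists>r\<in>R. p ^ k dvd y - r))"
  using assms(2-)
proof (induction n arbitrary: G J)
  case 0
  then have "G = 1" using monic_degree_0 by blast
  moreover have "\<not> p ^ J dvd 1" using p 0 not_prime_unit[of p] is_unit_power_iff[of p J] by auto
  ultimately show ?case by (intro exI[of _ "{}"]) simp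
next
  case (Suc n)
  show ?case
  proof (cases "\<exists>y0. p ^ J dvd poly G y0")
    case False then show ?thesis by (intro exI[of _ "{}"]) simp
  next
    case True
    then obtain y0 where y0: "p ^ J dvd poly G y0" by blast
    obtain G1 where G1: "G - [:poly G y0:] = [:- y0, 1:] * G1"
      using poly_eq_0_iff_dvd[of "G - [:poly G y0:]" y0] by (auto elim: dvdE)
    have Geq: "G = [:poly G y0:] + [:- y0, 1:] * G1" using G1 by (simp add: diff_eq_eq add.commute)
    have G1n: "G1 \<noteq> 0"
    proof
      assume "G1 = 0" then have "degree G = degree [:poly G y0:]" using Geq by (metis mult_zero_right add.right_neutral)
      then show False using Suc.prems by simp
    qed
    have deg1: "degree ([:- y0, 1:] * G1) = Suc (degree G1)" using G1n by (subst degree_mult_eq) auto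
    have degG: "degree G = Suc (degree G1)"
      by (subst Geq, subst degree_add_eq_right) (simp_all only: deg1 degree_pCons_eq_if, simp_all)
    have "lead_coeff G = lead_coeff ([:- y0, 1:] * G1)"
      unfolding degG deg1 by (subst (1) Geq) (simp add: coeff_pCons)
    then have "monic G1" using Suc.prems(1) by (simp only: lead_coeff_mult) simp
    moreover have "degree G1 = n" using degG Suc.prems by simp
    moreover have "J - k > n * k" using Suc.prems(3) by simp
    ultimately obtain R where R: "finite R" "card R \<le> n" "\<And>y. p ^ (J - k) dvd poly G1 y \<Longrightarrow> \<exists>r\<in>R. p ^ k dvd y - r"
      using Suc.IH[of G1 "J - k"] by blast
    have "\<exists>r\<in>insert y0 R. p ^ k dvd y - r" if y: "p ^ J dvd poly G y" for y
    proof (cases "p ^ k dvd y - y0")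
      case True then show ?thesis by blast
    next
      case False
      have "poly G y - poly G y0 = (y - y0) * poly G1 y" using arg_cong[OF G1, of "\<lambda>q. poly q y"] by (simp add: algebra_simps)
      then have "p ^ J dvd (y - y0) * poly G1 y" using y y0 by (metis dvd_diff)
      \<comment> \<open>Since \<open>p ^ k\<close> does not divide \<open>y - y0\<close>, fewer than
        \<open>k\<close> of the \<open>J\<close> factors go there, and at least \<open>J - k\<close>
        remain for \<open>G1\<close>.\<close>
      then obtain a b where ab: "a + b = J" "p ^ a dvd y - y0" "p ^ b dvd poly G1 y"
        using prime_elem_power_dvd_prod[OF _ prime_imp_prime_elem[OF p]] by blast
      have "a < k" using ab(2) False by (meson leI power_le_dvd)
      then have "p ^ (J - k) dvd poly G1 y" using ab by (intro power_le_dvd[OF ab(3)]) simp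
      then show ?thesis using R(3) by blast
    qed
    moreover have "card (insert y0 R) \<le> Suc n" using R(1,2) card_insert_le_m1[of "Suc n" R y0] by simp
    ultimately show ?thesis using R(1) by (intro exI[of _ "insert y0 R"]) auto
  qed
qed

section \<open>Norms of lattice points in a box\<close>

context monic_irreducible
begin

abbreviation M :: "int poly \<Rightarrow> nat" where "M x \<equiv> nat \<bar>N x\<bar>"

text \<open>The origin is left out because its norm is 0 and has no meaningful logarithm.\<close>

abbreviation pb :: "nat \<Rightarrow> int poly set" where "pb B \<equiv> pbox n B - {0}"

definition W :: "nat \<Rightarrow> real" where "W B = (2 * real B + 1) ^ n"

text \<open>A common bound for \<open>norm (ceval x z) / B\<close> over all roots \<open>z\<close>
  and all \<open>x\<close> in the box of radius \<open>B\<close>; the summand 1 makes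
  \<open>C1\<close> at least 1, so that \<open>ln C1\<close> is nonnegative.\<close>

definition E :: real where "E = 1 + (\<Sum>z\<in>Z. \<Sum>i<n. norm z ^ i)"

definition C1 :: real where "C1 = E ^ n"

lemma W_pos: "W B > 0" by (simp add: W_def)

lemma card_pbox_W: "real (card (pbox n B)) = W B"
  by (simp add: card_pbox W_def add.commute)

lemma B_le_W: "real B ^ n \<le> W B"
  unfolding W_def by (intro power_mono) auto

lemma E_ge_1: "E \<ge> 1" by (simp add: E_def sum_nonneg)

lemma C1_ge_1: "C1 \<ge> 1" using E_ge_1 by (simp add: C1_def)

lemma norm_M: "real (M x) = (\<Prod>z\<in>Z. norm (ceval x z))"
proof -
  have "real (M x) = norm (of_int (N x) :: complex)" by (simp add: norm_of_int)
  then show ?thesis unfolding of_int_N by (simp add: prod_norm)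
qed

lemma norm_upper:
  assumes "x \<in> pbox n B" shows "real (M x) \<le> C1 * real B ^ n"
proof -
  have "norm (ceval x z) \<le> E * real B" if z: "z \<in> Z" for z
  proof -
    have dx: "degree x < n" using gbox_degree[OF n_pos assms] .
    have "ceval x z = (\<Sum>i\<le>degree x. of_int (coeff x i) * z ^ i)" by (simp add: poly_altdef)
    also have "\<dots> = (\<Sum>i<n. of_int (coeff x i) * z ^ i)"
      using dx by (intro sum.mono_neutral_left) (auto simp: coeff_eq_0)
    finally have "norm (ceval x z) \<le> (\<Sum>i<n. norm (of_int (coeff x i) * z ^ i))"
      by (simp only: norm_sum)
    also have "\<dots> \<le> (\<Sum>i<n. real B * norm z ^ i)"
    proof (rule sum_mono)
      fix i assume "i \<in> {..<n}"
      have "real_of_int \<bar>coeff x i\<bar> \<le> real_of_int (int B)"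
        using pbox_coeff[OF assms, of i] by (simp only: of_int_le_iff)
      then show "norm (of_int (coeff x i) * z ^ i) \<le> real B * norm z ^ i"
        by (auto simp: norm_mult norm_power intro!: mult_right_mono)
    qed
    also have "\<dots> = real B * (\<Sum>i<n. norm z ^ i)" by (simp add: sum_distrib_left)
    also have "\<dots> \<le> real B * E"
    proof (intro mult_left_mono)
      have "(\<Sum>i<n. norm z ^ i) \<le> (\<Sum>z\<in>Z. \<Sum>i<n. norm z ^ i)"
        using z finite_Z by (intro member_le_sum[of z Z "\<lambda>z. \<Sum>i<n. norm z ^ i"]) (auto intro: sum_nonneg)
      then show "(\<Sum>i<n. norm z ^ i) \<le> E" by (simp add: E_def)
    qed simp
    finally show ?thesis by (simp add: mult.commute)
  qed
  then have "real (M x) \<le> (\<Prod>z\<in>Z. E * real B)" unfolding norm_M by (intro prod_mono) auto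
  then show ?thesis by (simp add: card_Z C1_def power_mult_distrib)
qed

lemma M_pos: "x \<in> pb B \<Longrightarrow> M x > 0"
  using N_nonzero[of x] gbox_degree[OF n_pos, of x] by auto

lemma ln_M_nonneg: "x \<in> pb B \<Longrightarrow> 0 \<le> ln (real (M x))"
  using M_pos[of x B] by (intro ln_ge_zero) linarith

lemma ln_M_le:
  assumes x: "x \<in> pb B" and B: "B \<ge> 1"
  shows "ln (real (M x)) \<le> real n * ln (real B) + ln C1"
proof -
  have "real (M x) \<le> C1 * real B ^ n" using x by (intro norm_upper) auto
  then have "ln (real (M x)) \<le> ln (C1 * real B ^ n)" using M_pos[OF x] C1_ge_1 B by (subst ln_le_cancel_iff) auto
  also have "\<dots> = real n * ln (real B) + ln C1" using C1_ge_1 B by (simp add: ln_mult ln_realpow)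
  finally show ?thesis .
qed

text \<open>Counting proceeds along lines on which only the constant coefficient varies: there the
  norm is a monic polynomial in that coefficient, and each conjugate is a translate of it.\<close>

lemma card_fibres:
  assumes "n = Suc m" and bd: "\<And>w. w \<in> gbox m (- int B) (int B) \<Longrightarrow> real (card {a\<in>{- int B..int B}. P (pCons a w)}) \<le> L"
  shows "real (card {x \<in> pbox n B. P x}) \<le> (2 * real B + 1) ^ m * L"
proof -
  have fin: "finite {a\<in>{- int B..int B}. P (pCons a w)}" for w
    by (rule finite_subset[of _ "{- int B..int B}"]) auto
  let ?G = "gbox m (- int B) (int B)"
  let ?F = "\<lambda>w. (\<lambda>a. pCons a w) ` {a\<in>{- int B..int B}. P (pCons a w)}"
  have "{x \<in> pbox n B. P x} \<subseteq> (\<Union>w\<in>?G. ?F w)" unfolding assms(1) gbox_Suc by auto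
  then have "card {x \<in> pbox n B. P x} \<le> card (\<Union>w\<in>?G. ?F w)" using fin by (intro card_mono) auto
  also have "\<dots> \<le> (\<Sum>w\<in>?G. card (?F w))" by (rule card_UN_le) simp
  finally have "real (card {x \<in> pbox n B. P x}) \<le> real (\<Sum>w\<in>?G. card (?F w))" by (simp only: of_nat_le_iff)
  also have "\<dots> = (\<Sum>w\<in>?G. real (card (?F w)))" by simp
  also have "\<dots> \<le> (\<Sum>w\<in>?G. L)"
  proof (rule sum_mono)
    fix w assume w: "w \<in> ?G"
    have "card (?F w) \<le> card {a\<in>{- int B..int B}. P (pCons a w)}" by (rule card_image_le[OF fin])
    then have "real (card (?F w)) \<le> real (card {a\<in>{- int B..int B}. P (pCons a w)})" by (simp only: of_nat_le_iff)
    also have "\<dots> \<le> L" by (rule bd[OF w])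
    finally show "real (card (?F w)) \<le> L" .
  qed
  also have "\<dots> = real (card ?G) * L" by simp
  also have "real (card ?G) = (2 * real B + 1) ^ m" unfolding card_pbox by (simp add: add.commute)
  finally show ?thesis .
qed

text \<open>
  For fixed higher coefficients and a fixed root \<open>z\<close>, few constant coefficients make \<open>x\<close> small at \<open>z\<close>.
\<close>

lemma sum_ln_norm_lower:
  fixes \<delta> :: real
  assumes d: "0 < \<delta>" "2 * real n * \<delta> \<le> 1" and B: "real B \<ge> 1 / \<delta>"
  shows "(1 - 2 * real n * \<delta>) * W B * (real n * (ln (real B) + ln \<delta>)) \<le> (\<Sum>x\<in>pb B. ln (real (M x)))"
proof -
  obtain m where m: "n = Suc m" using n_pos by (cases n) auto
  have WS: "W B = (2 * real B + 1) ^ m * (2 * real B + 1)" for B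
    unfolding W_def unfolding m power_Suc by (rule mult.commute)
  have "0 < 1 / \<delta>" using d by simp
  then have Bpos: "real B > 0" using B by linarith
  have dB: "\<delta> * real B \<ge> 1" using B d by (simp add: divide_le_eq mult.commute)
  define bad where "bad = (\<lambda>z. {x\<in>pbox n B. norm (ceval x z) < \<delta> * real B})"
  have bad: "real (card (bad z)) \<le> (2 * real B + 1) ^ m * (2 * (\<delta> * real B) + 1)" for z
    unfolding bad_def
  proof (rule card_fibres[OF m])
    fix w assume "w \<in> gbox m (- int B) (int B)"
    have "{a\<in>{- int B..int B}. norm (ceval (pCons a w) z) < \<delta> * real B}
      \<subseteq> {a. \<bar>real_of_int a + Re (z * ceval w z)\<bar> < \<delta> * real B}"
    proof clarify
      fix a assume *: "norm (ceval (pCons a w) z) < \<delta> * real B"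
      have eq: "ceval (pCons a w) z = of_int a + z * ceval w z"
      proof -
        have "pCons a w = [:a:] + pCons 0 w" by simp
        then have "ceval (pCons a w) z = ceval [:a:] z + ceval (pCons 0 w) z" by (simp only: of_int_poly_hom.hom_add poly_add)
        also have "ceval (pCons 0 w) z = z * ceval w z" by (cases "w = 0") (simp_all add: map_poly_pCons)
        finally show ?thesis by (simp add: ceval_const)
      qed
      have "\<bar>Re (ceval (pCons a w) z)\<bar> \<le> norm (ceval (pCons a w) z)" by (rule abs_Re_le_cmod)
      then show "\<bar>real_of_int a + Re (z * ceval w z)\<bar> < \<delta> * real B" using * unfolding eq by simp
    qed
    then have "card {a\<in>{- int B..int B}. norm (ceval (pCons a w) z) < \<delta> * real B}
      \<le> card {a::int. \<bar>real_of_int a + Re (z * ceval w z)\<bar> < \<delta> * real B}"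
      using card_int_interval(1)[of "\<delta> * real B"] dB by (intro card_mono) auto
    then have "real (card {a\<in>{- int B..int B}. norm (ceval (pCons a w) z) < \<delta> * real B})
      \<le> real (card {a::int. \<bar>real_of_int a + Re (z * ceval w z)\<bar> < \<delta> * real B})" by (simp only: of_nat_le_iff)
    also have "\<dots> \<le> 2 * (\<delta> * real B) + 1" using dB by (intro card_int_interval) auto
    finally show "real (card {a\<in>{- int B..int B}. norm (ceval (pCons a w) z) < \<delta> * real B}) \<le> 2 * (\<delta> * real B) + 1" .
  qed
  define good where "good = pbox n B - (\<Union>z\<in>Z. bad z)"
  have "pbox n B \<subseteq> good \<union> (\<Union>z\<in>Z. bad z)" unfolding good_def by auto
  then have "card (pbox n B) \<le> card (good \<union> (\<Union>z\<in>Z. bad z))"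
    using finite_Z by (intro card_mono) (auto simp: good_def bad_def)
  also have "\<dots> \<le> card good + card (\<Union>z\<in>Z. bad z)" by (rule card_Un_le)
  also have "\<dots> \<le> card good + (\<Sum>z\<in>Z. card (bad z))" using card_UN_le[OF finite_Z] by simp
  finally have "real (card (pbox n B)) \<le> real (card good + (\<Sum>z\<in>Z. card (bad z)))" by (simp only: of_nat_le_iff)
  then have "W B \<le> real (card good) + (\<Sum>z\<in>Z. real (card (bad z)))" unfolding card_pbox_W by simp
  also have "(\<Sum>z\<in>Z. real (card (bad z))) \<le> (\<Sum>z\<in>Z. (2 * real B + 1) ^ m * (2 * (\<delta> * real B) + 1))"
    by (intro sum_mono bad)
  also have "\<dots> = real n * ((2 * real B + 1) ^ m * (2 * (\<delta> * real B) + 1))" by (simp add: card_Z)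
  also have "\<dots> \<le> real n * ((2 * real B + 1) ^ m * (2 * \<delta> * (2 * real B + 1)))"
    using dB d by (intro mult_left_mono) (auto simp: algebra_simps)
  also have "\<dots> = 2 * real n * \<delta> * W B" by (simp add: WS)
  finally have cg: "(1 - 2 * real n * \<delta>) * W B \<le> real (card good)" by (simp add: algebra_simps)
  have Zne: "Z \<noteq> {}" using card_Z n_pos by auto
  have good_sub: "good \<subseteq> pb B"
  proof
    fix x assume x: "x \<in> good"
    have "x \<noteq> 0"
    proof
      assume x0: "x = 0"
      obtain z where "z \<in> Z" using Zne by blast
      then have "x \<in> bad z" using x dB unfolding bad_def good_def x0 by auto
      then show False using x \<open>z \<in> Z\<close> unfolding good_def by blast
    qed
    then show "x \<in> pb B" using x by (simp add: good_def)
  qed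
  have ln_good: "real n * (ln (real B) + ln \<delta>) \<le> ln (real (M x))" if x: "x \<in> good" for x
  proof -
    have "(\<Prod>z\<in>Z. \<delta> * real B) \<le> (\<Prod>z\<in>Z. norm (ceval x z))"
      using x dB by (intro prod_mono) (auto simp: good_def bad_def not_less)
    then have "(\<delta> * real B) ^ n \<le> real (M x)" unfolding norm_M by (simp add: card_Z)
    moreover have "(\<delta> * real B) ^ n > 0" using dB by simp
    ultimately have "ln ((\<delta> * real B) ^ n) \<le> ln (real (M x))" by (subst ln_le_cancel_iff) linarith+
    then show ?thesis using d Bpos by (simp add: ln_realpow ln_mult add.commute)
  qed
  have nn: "0 \<le> real n * (ln (real B) + ln \<delta>)"
  proof -
    have "ln (real B) + ln \<delta> = ln (\<delta> * real B)" using d Bpos by (simp add: ln_mult)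
    then show ?thesis using dB by simp
  qed
  have "(1 - 2 * real n * \<delta>) * W B * (real n * (ln (real B) + ln \<delta>)) \<le> real (card good) * (real n * (ln (real B) + ln \<delta>))"
    by (rule mult_right_mono[OF cg nn])
  also have "\<dots> = (\<Sum>x\<in>good. real n * (ln (real B) + ln \<delta>))" by simp
  also have "\<dots> \<le> (\<Sum>x\<in>good. ln (real (M x)))" by (intro sum_mono ln_good)
  also have "\<dots> \<le> (\<Sum>x\<in>pb B. ln (real (M x)))"
    using good_sub ln_M_nonneg by (intro sum_mono2) auto
  finally show ?thesis .
qed

text \<open>This serves a fixed prime, possibly dividing the discriminant. Multiplicities below
  \<open>J\<close> cost a constant per point. By \<open>power_root_classes\<close> the points with
  \<open>p ^ J\<close> dividing the norm have a share of order \<open>n / p ^ k\<close> once the box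
  is large, and each costs at most \<open>n * ln B + ln C1\<close>; a large \<open>k\<close> makes
  their total small.\<close>

lemma sum_multiplicity_small:
  fixes \<eta> :: real
  assumes p: "prime p" and eta: "\<eta> > 0"
  obtains K where "\<And>B. B \<ge> 1 \<Longrightarrow> (\<Sum>x\<in>pb B. real (multiplicity p (M x)) * ln (real p)) \<le> W B * (\<eta> * ln (real B) + K)"
proof -
  obtain m where m: "n = Suc m" using n_pos by (cases n) auto
  have WS: "W B = (2 * real B + 1) ^ m * (2 * real B + 1)" for B
    unfolding W_def unfolding m power_Suc by (rule mult.commute)
  \<comment> \<open>A share of at most \<open>2 * n / p ^ k\<close> of the points, each costing
    about \<open>n * ln B\<close>, has to stay below \<open>\<eta> * ln B\<close>.\<close>
  obtain k where k: "2 * real n * real n / \<eta> < 2 ^ k" using real_arch_pow[of 2 "2 * real n * real n / \<eta>"] by auto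
  have p2: "real p \<ge> 2" using prime_ge_2_nat[OF p] by simp
  define P where "P = real p ^ k"
  have "(2::real) ^ k \<le> P" unfolding P_def using p2 by (intro power_mono) auto
  then have kP: "2 * real n * real n / P \<le> \<eta>" and P1: "P \<ge> 1"
  proof -
    show "P \<ge> 1" using p2 by (simp add: P_def)
    have "2 * real n * real n / \<eta> \<le> P" using k \<open>2 ^ k \<le> P\<close> by linarith
    then show "2 * real n * real n / P \<le> \<eta>" using eta \<open>P \<ge> 1\<close> by (simp add: divide_le_eq mult.commute)
  qed
  define J where "J = n * k + 1"
  define L where "L = ln C1"
  have L0: "L \<ge> 0" using C1_ge_1 by (simp add: L_def)
  have lnp: "ln (real p) \<ge> 0" using p2 by simp
  define K where "K = real J * ln (real p) + 2 * real n * L + (real n * real k * ln (real p) + L)"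
  have "(\<Sum>x\<in>pb B. real (multiplicity p (M x)) * ln (real p)) \<le> W B * (\<eta> * ln (real B) + K)" if B: "B \<ge> 1" for B
  proof -
    have lnB: "ln (real B) \<ge> 0" using B by simp
    define D where "D = {x \<in> pbox n B. int p ^ J dvd N x}"
    define U where "U = real n * ln (real B) + L"
    have U0: "U \<ge> 0" using lnB L0 by (simp add: U_def)
    have "real (card D) \<le> (2 * real B + 1) ^ m * (real n * (2 * real B / P + 1))"
      unfolding D_def
    proof (rule card_fibres[OF m])
      fix w assume "w \<in> gbox m (- int B) (int B)"
      obtain G :: "int poly" where G: "degree G = n" "monic G" "\<And>c. N ([:c:] + pCons 0 w) = poly G c"
        by (rule N_shift[of "pCons 0 w"]) blast
      obtain R where R: "finite R" "card R \<le> n" "\<And>y. int p ^ J dvd poly G y \<Longrightarrow> \<exists>r\<in>R. int p ^ k dvd y - r"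
        using power_root_classes[of "int p" G n k J] p G(1,2) unfolding J_def by auto
      have "{a \<in> {- int B..int B}. int p ^ J dvd N (pCons a w)} \<subseteq> (\<Union>r\<in>R. {a\<in>{- int B..int B}. int p ^ k dvd a - r})"
      proof
        fix a assume a: "a \<in> {a \<in> {- int B..int B}. int p ^ J dvd N (pCons a w)}"
        have "N (pCons a w) = poly G a" using G(3)[of a] by simp
        then obtain r where "r \<in> R" "int p ^ k dvd a - r" using R(3)[of a] a by auto
        then show "a \<in> (\<Union>r\<in>R. {a\<in>{- int B..int B}. int p ^ k dvd a - r})" using a by blast
      qed
      then have "card {a \<in> {- int B..int B}. int p ^ J dvd N (pCons a w)} \<le> card (\<Union>r\<in>R. {a\<in>{- int B..int B}. int p ^ k dvd a - r})"
        using R(1) by (intro card_mono finite_UN_I finite_subset[of "{a\<in>{- int B..int B}. int p ^ k dvd a - r}" "{- int B..int B}" for r]) auto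
      also have "\<dots> \<le> (\<Sum>r\<in>R. card {a\<in>{- int B..int B}. int p ^ k dvd a - r})" by (rule card_UN_le[OF R(1)])
      finally have "real (card {a \<in> {- int B..int B}. int p ^ J dvd N (pCons a w)}) \<le> real (\<Sum>r\<in>R. card {a\<in>{- int B..int B}. int p ^ k dvd a - r})"
        by (simp only: of_nat_le_iff)
      also have "\<dots> = (\<Sum>r\<in>R. real (card {a\<in>{- int B..int B}. int p ^ k dvd a - r}))" by simp
      also have "\<dots> \<le> (\<Sum>r\<in>R. 2 * real B / P + 1)"
      proof (rule sum_mono)
        fix r assume "r \<in> R"
        have "real_of_int (int p ^ k) = P" by (simp add: P_def)
        moreover have "int p ^ k > 0" using prime_gt_0_nat[OF p] by simp
        ultimately show "real (card {a\<in>{- int B..int B}. int p ^ k dvd a - r}) \<le> 2 * real B / P + 1"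
          using card_congruent_interval[of "int p ^ k" B r] by metis
      qed
      also have "\<dots> = real (card R) * (2 * real B / P + 1)" by simp
      also have "\<dots> \<le> real n * (2 * real B / P + 1)" using R(2) P1 by (intro mult_right_mono) auto
      finally show "real (card {a \<in> {- int B..int B}. int p ^ J dvd N (pCons a w)}) \<le> real n * (2 * real B / P + 1)" .
    qed
    then have cD: "real (card D) \<le> (2 * real B + 1) ^ m * (real n * (2 * real B / P + 1))" .
    have "D \<subseteq> pbox n B" by (auto simp: D_def)
    then have "card D \<le> card (pbox n B)" by (intro card_mono) auto
    then have cDW: "real (card D) \<le> W B" unfolding card_pbox_W[symmetric] by (simp only: of_nat_le_iff)
    have DU: "real (card D) * U \<le> W B * (\<eta> * ln (real B) + 2 * real n * L + (real n * real k * ln (real p) + L))"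
    \<comment> \<open>When the box is shorter than \<open>p ^ k\<close> the congruence count is
      useless, but then \<open>ln B\<close> is at most the constant \<open>k * ln p\<close>.\<close>
    proof (cases "P \<le> 2 * real B + 1")
      case True
      have "2 * real B / P + 1 \<le> 2 / P * (2 * real B + 1)"
      proof -
        have "1 \<le> (2 * real B + 1) / P" using True P1 by (simp add: le_divide_eq)
        moreover have "2 * real B / P \<le> (2 * real B + 1) / P" using P1 by (intro divide_right_mono) auto
        moreover have "2 / P * (2 * real B + 1) = (2 * real B + 1) / P + (2 * real B + 1) / P"
          by (simp flip: add_divide_distrib)
        ultimately show ?thesis by linarith
      qed
      then have "(2 * real B + 1) ^ m * (real n * (2 * real B / P + 1)) \<le> (2 * real B + 1) ^ m * (real n * (2 / P * (2 * real B + 1)))"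
        by (intro mult_left_mono) auto
      also have "\<dots> = W B * (2 * real n / P)" by (simp add: WS)
      finally have "real (card D) \<le> W B * (2 * real n / P)" using cD by linarith
      then have "real (card D) * U \<le> W B * (2 * real n / P) * U" using U0 by (intro mult_right_mono)
      also have "\<dots> = W B * (2 * real n * real n / P * ln (real B) + 2 * real n / P * L)"
        by (simp add: U_def algebra_simps add_divide_distrib)
      also have "\<dots> \<le> W B * (\<eta> * ln (real B) + 2 * real n * L)"
      proof (intro mult_left_mono add_mono mult_right_mono kP lnB L0)
        show "2 * real n / P \<le> 2 * real n" using P1 by (simp add: divide_le_eq mult_le_cancel_left1)
      qed (use W_pos[of B] in auto)
      also have "\<dots> \<le> W B * (\<eta> * ln (real B) + 2 * real n * L + (real n * real k * ln (real p) + L))"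
        using W_pos[of B] L0 lnp by (intro mult_left_mono) auto
      finally show ?thesis .
    next
      case False
      then have "real B \<le> P" by simp
      then have "ln (real B) \<le> ln P" using B by (subst ln_le_cancel_iff) auto
      also have "\<dots> = real k * ln (real p)" using p2 by (simp add: P_def ln_realpow)
      finally have lB: "ln (real B) \<le> real k * ln (real p)" .
      have "real (card D) * U \<le> W B * U" using cDW U0 by (rule mult_right_mono)
      also have "\<dots> \<le> W B * (real n * (real k * ln (real p)) + L)"
        unfolding U_def using lB W_pos[of B] by (intro mult_left_mono add_right_mono) auto
      also have "\<dots> \<le> W B * (\<eta> * ln (real B) + 2 * real n * L + (real n * real k * ln (real p) + L))"
        using W_pos[of B] L0 lnB eta by (intro mult_left_mono) (auto simp: mult.assoc)
      finally show ?thesis .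
    qed
    have pt: "real (multiplicity p (M x)) * ln (real p) \<le> real J * ln (real p) + (if x \<in> D then U else 0)" if x: "x \<in> pb B" for x
    proof (cases "x \<in> D")
      case True
      have "real (multiplicity p (M x)) * ln (real p) \<le> ln (real (M x))" by (rule multiplicity_ln_le[OF p M_pos[OF x]])
      also have "\<dots> \<le> U" unfolding U_def L_def by (rule ln_M_le[OF x B])
      finally show ?thesis using True lnp by (simp add: add_increasing)
    next
      case False
      have "multiplicity p (M x) < J"
      proof (rule ccontr)
        assume "\<not> multiplicity p (M x) < J"
        then have "p ^ J dvd M x" by (intro multiplicity_dvd') linarith
        then have "int (p ^ J) dvd int (M x)" by (simp only: of_nat_dvd_iff)
        then have "int p ^ J dvd N x" by simp
        then show False using False x by (simp add: D_def)
      qed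
      then show ?thesis using False lnp by (auto intro: mult_right_mono)
    qed
    have "(\<Sum>x\<in>pb B. real (multiplicity p (M x)) * ln (real p)) \<le> (\<Sum>x\<in>pb B. real J * ln (real p) + (if x \<in> D then U else 0))"
      by (intro sum_mono pt)
    also have "\<dots> = real (card (pb B)) * (real J * ln (real p)) + (\<Sum>x\<in>pb B. if x \<in> D then U else 0)"
      by (simp add: sum.distrib)
    also have "\<dots> \<le> W B * (real J * ln (real p)) + real (card D) * U"
    proof (intro add_mono mult_right_mono)
      have "card (pb B) \<le> card (pbox n B)" by (intro card_mono) auto
      then show "real (card (pb B)) \<le> W B" unfolding card_pbox_W[symmetric] by (simp only: of_nat_le_iff)
      have "(\<Sum>x\<in>pb B. if x \<in> D then U else 0) = (\<Sum>x\<in>pb B \<inter> D. U)" by (rule sum.inter_restrict[symmetric]) simp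
      also have "\<dots> \<le> (\<Sum>x\<in>D. U)" using U0 by (intro sum_mono2) (auto simp: D_def)
      finally show "(\<Sum>x\<in>pb B. if x \<in> D then U else 0) \<le> real (card D) * U" by simp
    qed (use lnp in auto)
    also have "\<dots> \<le> W B * (real J * ln (real p)) + W B * (\<eta> * ln (real B) + 2 * real n * L + (real n * real k * ln (real p) + L))"
      using DU by linarith
    also have "\<dots> = W B * (\<eta> * ln (real B) + K)" unfolding K_def by (simp add: algebra_simps)
    finally show ?thesis .
  qed
  then show thesis using that by blast
qed

end

section \<open>Counting norms by their prime factors\<close>

lemma sum_of_bool_card:
  assumes "finite A"
  shows "(\<Sum>x\<in>A. of_bool (P x) :: real) = real (card {x\<in>A. P x})"
proof -
  have "(\<Sum>x\<in>A. of_bool (P x) :: real) = real (card (A \<inter> {x. P x}))" using assms by (simp add: sum_of_bool_eq)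
  also have "A \<inter> {x. P x} = {x\<in>A. P x}" by blast
  finally show ?thesis .
qed

context monic_irreducible
begin

definition Nf :: "nat \<Rightarrow> nat" where "Nf p = card (roots_mod (int p))"

definition K0 :: real where "K0 = real ((2 * cov + 3) ^ n)"

text \<open>The factor \<open>2 * 2 ^ n\<close> is the size of the family in
  \<open>bad_family\<close>; \<open>K0\<close> controls each of its ideals.\<close>

definition K1 :: real where "K1 = 2 * 2 ^ n * K0"

lemma K0_pos: "K0 > 0" and K1_pos: "K1 > 0"
  by (simp_all add: K0_def K1_def)

lemma Nf_le: "prime p \<Longrightarrow> Nf p \<le> 2 ^ n"
  unfolding Nf_def using card_roots_mod(2)[of "int p"] by simp

lemma finite_roots_mod: "finite (roots_mod p)"
  unfolding roots_mod_def by (rule finite_subset[of _ "{0..<p}"]) auto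

lemma ideal_count_W:
  assumes J: "is_ideal J" "f \<in> J" and B: "B \<ge> 1"
  shows "real (card (quot J)) * real (card (J \<inter> pb B)) \<le> K0 * W B"
proof -
  have "J \<inter> pb B = J \<inter> pbox n B - {0}" by blast
  then have "card (quot J) * card (J \<inter> pb B) \<le> (2 * cov + 3) ^ n * B ^ n" using ideal_count_nonzero[OF J, of B] B by simp
  then have "real (card (quot J) * card (J \<inter> pb B)) \<le> real ((2 * cov + 3) ^ n * B ^ n)" by (simp only: of_nat_le_iff)
  also have "\<dots> = K0 * real B ^ n" by (simp add: K0_def)
  also have "\<dots> \<le> K0 * W B" using K0_pos B_le_W by (intro mult_left_mono) auto
  finally show ?thesis by simp
qed

text \<open>\<open>D\<close> is the union of the bad family. Its share of the box is at most
  \<open>K1 / p ^ 2\<close>, which is summable over \<open>p\<close>; this holds for every box size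
  because the count of nonzero points does.\<close>

lemma bad_set:
  assumes p: "prime p" and disc: "\<not> int p dvd disc"
  obtains D where "\<And>B. B \<ge> 1 \<Longrightarrow> (real p)\<^sup>2 * real (card (D \<inter> pb B)) \<le> K1 * W B"
    "\<And>x. int p dvd N x \<Longrightarrow> x \<in> D \<or> (\<exists>r\<in>roots_mod (int p). x \<in> root_ideal (int p) r)"
    "\<And>x. (int p)\<^sup>2 dvd N x \<Longrightarrow> x \<in> D"
    "\<And>x r s. r \<in> roots_mod (int p) \<Longrightarrow> s \<in> roots_mod (int p) \<Longrightarrow> r \<noteq> s \<Longrightarrow> x \<in> root_ideal (int p) r \<Longrightarrow> x \<in> root_ideal (int p) s \<Longrightarrow> x \<in> D"
proof -
  have ip: "prime (int p)" using p by simp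
  obtain \<B> where \<B>: "finite \<B>" "card \<B> \<le> 2 * 2 ^ n"
    "\<And>J. J \<in> \<B> \<Longrightarrow> is_ideal J \<and> f \<in> J \<and> (int p)\<^sup>2 \<le> int (card (quot J))"
    "\<And>x. int p dvd N x \<Longrightarrow> x \<in> \<Union>\<B> \<or> (\<exists>r\<in>roots_mod (int p). x \<in> root_ideal (int p) r)"
    "\<And>x. (int p)\<^sup>2 dvd N x \<Longrightarrow> x \<in> \<Union>\<B>"
    "\<And>x r s. r \<in> roots_mod (int p) \<Longrightarrow> s \<in> roots_mod (int p) \<Longrightarrow> r \<noteq> s \<Longrightarrow> x \<in> root_ideal (int p) r \<Longrightarrow> x \<in> root_ideal (int p) s \<Longrightarrow> x \<in> \<Union>\<B>"
    by (rule bad_family[OF ip disc]) blast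
  have bound: "(real p)\<^sup>2 * real (card (\<Union>\<B> \<inter> pb B)) \<le> K1 * W B" if B: "B \<ge> 1" for B
  proof -
    have "card (\<Union>\<B> \<inter> pb B) = card (\<Union>J\<in>\<B>. J \<inter> pb B)" by (rule arg_cong[of _ _ card]) blast
    also have "\<dots> \<le> (\<Sum>J\<in>\<B>. card (J \<inter> pb B))" by (rule card_UN_le[OF \<B>(1)])
    finally have "real (card (\<Union>\<B> \<inter> pb B)) \<le> real (\<Sum>J\<in>\<B>. card (J \<inter> pb B))" by (simp only: of_nat_le_iff)
    then have "(real p)\<^sup>2 * real (card (\<Union>\<B> \<inter> pb B)) \<le> (real p)\<^sup>2 * real (\<Sum>J\<in>\<B>. card (J \<inter> pb B))"
      by (intro mult_left_mono) auto
    also have "\<dots> = (\<Sum>J\<in>\<B>. (real p)\<^sup>2 * real (card (J \<inter> pb B)))" by (simp add: sum_distrib_left)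
    also have "\<dots> \<le> (\<Sum>J\<in>\<B>. K0 * W B)"
    proof (rule sum_mono)
      fix J assume J: "J \<in> \<B>"
      have "real_of_int ((int p)\<^sup>2) \<le> real_of_int (int (card (quot J)))" using \<B>(3)[OF J] by (simp only: of_int_le_iff)
      then have "(real p)\<^sup>2 * real (card (J \<inter> pb B)) \<le> real (card (quot J)) * real (card (J \<inter> pb B))"
        by (intro mult_right_mono) auto
      also have "\<dots> \<le> K0 * W B" using \<B>(3)[OF J] B by (intro ideal_count_W) auto
      finally show "(real p)\<^sup>2 * real (card (J \<inter> pb B)) \<le> K0 * W B" .
    qed
    also have "\<dots> = real (card \<B>) * (K0 * W B)" by simp
    also have "\<dots> \<le> (2 * 2 ^ n) * (K0 * W B)"
    proof (rule mult_right_mono)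
      have "real (card \<B>) \<le> real (2 * 2 ^ n)" using \<B>(2) by (simp only: of_nat_le_iff)
      then show "real (card \<B>) \<le> 2 * 2 ^ n" by simp
    qed (use K0_pos W_pos[of B] in auto)
    finally show ?thesis by (simp add: K1_def mult.assoc)
  qed
  show thesis using that[of "\<Union>\<B>"] bound \<B>(4-6) by blast
qed

text \<open>For \<open>p\<close> not dividing the discriminant and \<open>x\<close> outside the set
  \<open>D\<close> of \<open>bad_set\<close>, this number equals the multiplicity of
  \<open>p\<close> in \<open>N x\<close>, and it is easy to average.\<close>

definition cnt :: "nat \<Rightarrow> int poly \<Rightarrow> nat" where
  "cnt p x = card {r\<in>roots_mod (int p). x \<in> root_ideal (int p) r}"

lemma sum_cnt: "(\<Sum>x\<in>pb B. real (cnt p x)) = (\<Sum>r\<in>roots_mod (int p). real (card (root_ideal (int p) r \<inter> pb B)))"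
proof -
  let ?R = "roots_mod (int p)"
  have "(\<Sum>x\<in>pb B. real (cnt p x)) = (\<Sum>x\<in>pb B. \<Sum>r\<in>?R. of_bool (x \<in> root_ideal (int p) r))"
  proof (rule sum.cong[OF refl])
    fix x
    have "(\<Sum>r\<in>?R. of_bool (x \<in> root_ideal (int p) r) :: real) = real (card (?R \<inter> {r. x \<in> root_ideal (int p) r}))"
      using finite_roots_mod by (simp add: sum_of_bool_eq)
    also have "?R \<inter> {r. x \<in> root_ideal (int p) r} = {r\<in>?R. x \<in> root_ideal (int p) r}" by blast
    finally show "real (cnt p x) = (\<Sum>r\<in>?R. of_bool (x \<in> root_ideal (int p) r))" by (simp add: cnt_def)
  qed
  also have "\<dots> = (\<Sum>r\<in>?R. \<Sum>x\<in>pb B. of_bool (x \<in> root_ideal (int p) r))" by (rule sum.swap)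
  also have "\<dots> = (\<Sum>r\<in>?R. real (card (root_ideal (int p) r \<inter> pb B)))"
  proof (rule sum.cong[OF refl])
    fix r
    have "(\<Sum>x\<in>pb B. of_bool (x \<in> root_ideal (int p) r) :: real) = real (card (pb B \<inter> {x. x \<in> root_ideal (int p) r}))"
      by (simp add: sum_of_bool_eq)
    also have "pb B \<inter> {x. x \<in> root_ideal (int p) r} = root_ideal (int p) r \<inter> pb B" by blast
    finally show "(\<Sum>x\<in>pb B. of_bool (x \<in> root_ideal (int p) r)) = real (card (root_ideal (int p) r \<inter> pb B))" .
  qed
  finally show ?thesis .
qed

lemma root_ideal_facts:
  assumes "prime p" "r \<in> roots_mod (int p)"
  shows "is_ideal (root_ideal (int p) r)" "f \<in> root_ideal (int p) r" "card (quot (root_ideal (int p) r)) = p" "finite (quot (root_ideal (int p) r))"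
proof -
  have p0: "p > 0" using assms(1) by (rule prime_gt_0_nat)
  show "is_ideal (root_ideal (int p) r)" by (rule is_ideal_root_ideal)
  show "f \<in> root_ideal (int p) r" using assms(2) by (simp add: root_ideal_def roots_mod_def)
  show c: "card (quot (root_ideal (int p) r)) = p" using card_quot_root_ideal[of "int p" r] p0 by simp
  show "finite (quot (root_ideal (int p) r))" by (rule card_ge_0_finite) (simp add: c p0)
qed

lemma root_count_large:
  assumes "prime p" "r \<in> roots_mod (int p)" "B \<ge> 1"
  shows "real (card (root_ideal (int p) r \<inter> pb B)) \<le> K0 * W B / real p"
  using ideal_count_W[OF root_ideal_facts(1,2)[OF assms(1,2)] assms(3)] root_ideal_facts(3)[OF assms(1,2)] prime_gt_0_nat[OF assms(1)]
  by (simp add: le_divide_eq mult.commute)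

text \<open>
  The point \<open>v\<close> found by pigeonhole makes the covering radius at most \<open>cov * b\<close>, a small multiple of
  the side \<open>c * b\<close> of the box.
\<close>

lemma root_count:
  assumes p: "prime p" and r: "r \<in> roots_mod (int p)" and pb: "p \<le> b ^ n" and c: "cov \<le> c" and b: "b \<ge> 1"
  shows "real (card (root_ideal (int p) r \<inter> pb (c * b))) \<le> (1 + real cov / real c) ^ n * W (c * b) / real p"
    and "((1 - real cov / real c) ^ n - (1 / (2 * real c)) ^ n) * W (c * b) / real p \<le> real (card (root_ideal (int p) r \<inter> pb (c * b)))"
proof -
  let ?J = "root_ideal (int p) r" and ?B = "c * b"
  note J = root_ideal_facts[OF p r]
  have p0: "real p > 0" using prime_gt_0_nat[OF p] by simp
  have c0: "c > 0" using c cov(1) by linarith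
  have "card (quot ?J) < (b + 1) ^ n" unfolding J(3)
    using pb n_pos power_strict_mono[of b "b + 1" n] by (simp add: order_le_less_trans)
  then obtain v where v: "v \<in> ?J" "v \<noteq> 0" "v \<in> pbox n b" by (rule pigeonhole_ideal[OF J(1,4)])
  have cb: "cov * b \<le> ?B" using c by (rule mult_right_mono) simp
  have "real (card (?J \<inter> pbox n ?B)) * real p = real (card (quot ?J) * card (?J \<inter> pbox n ?B))" by (simp add: J(3))
  also have "\<dots> \<le> real ((2 * (?B + cov * b) + 1) ^ n)" using ideal_count_upper[OF J(1,2) v, of ?B] by (simp only: of_nat_le_iff)
  also have "\<dots> = (2 * real ?B + 1 + 2 * real cov * real b) ^ n" by (simp add: algebra_simps)
  also have "\<dots> \<le> ((1 + real cov / real c) * (2 * real ?B + 1)) ^ n"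
  proof (rule power_mono)
    have "2 * real cov * real b \<le> real cov / real c * (2 * real ?B + 1)" using c0 by (simp add: field_simps)
    then show "2 * real ?B + 1 + 2 * real cov * real b \<le> (1 + real cov / real c) * (2 * real ?B + 1)" by (simp add: algebra_simps)
  qed simp
  finally have up: "real (card (?J \<inter> pbox n ?B)) * real p \<le> (1 + real cov / real c) ^ n * W ?B"
    by (simp add: power_mult_distrib W_def)
  have "card (?J \<inter> pb ?B) \<le> card (?J \<inter> pbox n ?B)" by (intro card_mono) auto
  then have "real (card (?J \<inter> pb ?B)) * real p \<le> real (card (?J \<inter> pbox n ?B)) * real p" by (intro mult_right_mono) auto
  then have "real (card (?J \<inter> pb ?B)) * real p \<le> (1 + real cov / real c) ^ n * W ?B" using up by linarith
  then show "real (card (?J \<inter> pb ?B)) \<le> (1 + real cov / real c) ^ n * W ?B / real p"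
    using p0 by (simp only: pos_le_divide_eq)
  have "((1 - real cov / real c) * (2 * real ?B + 1)) ^ n \<le> (2 * real ?B + 1 - 2 * real cov * real b) ^ n"
  proof (rule power_mono)
    have "2 * real cov * real b \<le> real cov / real c * (2 * real ?B + 1)" using c0 by (simp add: field_simps)
    then show "(1 - real cov / real c) * (2 * real ?B + 1) \<le> 2 * real ?B + 1 - 2 * real cov * real b"
      by (simp add: algebra_simps)
    show "0 \<le> (1 - real cov / real c) * (2 * real ?B + 1)" using c c0 by simp
  qed
  also have "2 * real ?B + 1 - 2 * real cov * real b = real (2 * (?B - cov * b) + 1)"
    using cb by (simp add: of_nat_diff algebra_simps)
  also have "real (2 * (?B - cov * b) + 1) ^ n = real ((2 * (?B - cov * b) + 1) ^ n)" by simp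
  also have "\<dots> \<le> real (card (quot ?J) * card (?J \<inter> pbox n ?B))" using ideal_count_lower[OF J(1,2) v cb] by (simp only: of_nat_le_iff)
  also have "\<dots> = real (card (?J \<inter> pbox n ?B)) * real p" by (simp add: J(3))
  finally have lo: "(1 - real cov / real c) ^ n * W ?B \<le> real (card (?J \<inter> pbox n ?B)) * real p"
    by (simp add: power_mult_distrib W_def)
  \<comment> \<open>Removing the point 0 costs one point, hence \<open>p\<close> after
    multiplication by the index; \<open>p \<le> b ^ n\<close> bounds this by the summand with
    \<open>1 / (2 * real c)\<close>.\<close>
  have "real p \<le> real (b ^ n)" using pb by (simp only: of_nat_le_iff)
  also have "real (b ^ n) = ((1 / (2 * real c)) * (2 * real ?B)) ^ n" using c0 by simp
  also have "\<dots> = (1 / (2 * real c)) ^ n * (2 * real ?B) ^ n" by (rule power_mult_distrib)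
  also have "\<dots> \<le> (1 / (2 * real c)) ^ n * W ?B" unfolding W_def by (intro mult_left_mono power_mono) auto
  finally have pW: "real p \<le> (1 / (2 * real c)) ^ n * W ?B" .
  have "0 \<in> pbox n ?B" by (rule pboxI) simp_all
  then have "?J \<inter> pbox n ?B = insert 0 (?J \<inter> pb ?B)" using ideal_0[OF J(1)] by blast
  moreover have "card (insert 0 (?J \<inter> pb ?B)) = Suc (card (?J \<inter> pb ?B))" by (rule card_insert_disjoint) blast+
  ultimately have "card (?J \<inter> pbox n ?B) = Suc (card (?J \<inter> pb ?B))" by (simp only:)
  then have "real (card (?J \<inter> pbox n ?B)) * real p = real (card (?J \<inter> pb ?B)) * real p + real p" by (simp add: algebra_simps)
  then have "((1 - real cov / real c) ^ n - (1 / (2 * real c)) ^ n) * W ?B \<le> real (card (?J \<inter> pb ?B)) * real p"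
    using lo pW by (simp add: left_diff_distrib)
  then show "((1 - real cov / real c) ^ n - (1 / (2 * real c)) ^ n) * W ?B / real p \<le> real (card (?J \<inter> pb ?B))"
    using p0 by (simp only: pos_divide_le_eq)
qed

definition S :: "nat \<Rightarrow> real" where
  "S X = (\<Sum>p | prime p \<and> p \<le> X. real (Nf p) * ln (real p) / real p)"

text \<open>The ratio \<open>c\<close> depends on \<open>f\<close> and the tolerance only, so
  passing from \<open>b\<close> to \<open>c * b\<close> shifts logarithms by a constant.\<close>

lemma exists_scale:
  fixes \<eta> :: real assumes "\<eta> > 0"
  obtains c where "cov \<le> c" "(1 + real cov / real c) ^ n \<le> 1 + \<eta>" "1 - \<eta> \<le> (1 - real cov / real c) ^ n - (1 / (2 * real c)) ^ n"
proof -
  have lim: "(\<lambda>c. a / real c) \<longlonglongrightarrow> 0" for a by (rule lim_const_over_n)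
  have "(\<lambda>c. (1 + real cov / real c) ^ n) \<longlonglongrightarrow> (1 + 0) ^ n" by (intro tendsto_intros lim)
  then have 1: "\<forall>\<^sub>F c in sequentially. (1 + real cov / real c) ^ n < 1 + \<eta>"
    using assms by (intro order_tendstoD(2)) auto
  have "(\<lambda>c. (1 - real cov / real c) ^ n - ((1/2) / real c) ^ n) \<longlonglongrightarrow> (1 - 0) ^ n - 0 ^ n" by (intro tendsto_intros lim)
  then have 2: "\<forall>\<^sub>F c in sequentially. 1 - \<eta> < (1 - real cov / real c) ^ n - ((1/2) / real c) ^ n"
    using assms n_pos by (intro order_tendstoD(1)) (auto simp: power_0_left)
  obtain c where "cov \<le> c \<and> (1 + real cov / real c) ^ n < 1 + \<eta> \<and> 1 - \<eta> < (1 - real cov / real c) ^ n - ((1/2) / real c) ^ n"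
    using eventually_happens[OF eventually_conj[OF eventually_ge_at_top[of cov] eventually_conj[OF 1 2]]] by auto
  then show thesis by (intro that[of c]) (auto simp: divide_simps)
qed

lemma not_dvd_disc: "nat \<bar>disc\<bar> < p \<Longrightarrow> \<not> int p dvd disc"
  using disc_nonzero zdvd_imp_le[of "int p" "\<bar>disc\<bar>"] by fastforce

lemma S_mono_split:
  "S X \<le> S P + (\<Sum>p | prime p \<and> P < p \<and> p \<le> X. real (Nf p) * ln (real p) / real p)"
proof -
  have fin: "finite {p. prime p \<and> p \<le> P}" "finite {p. prime p \<and> P < p \<and> p \<le> X}"
    using finite_subset[of "{p. prime p \<and> p \<le> P}" "{..P}"] finite_subset[of "{p. prime p \<and> P < p \<and> p \<le> X}" "{..X}"] by auto
  have nn: "0 \<le> real (Nf p) * ln (real p) / real p" for p by (cases "p = 0") auto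
  have "S X \<le> (\<Sum>p \<in> {p. prime p \<and> p \<le> P} \<union> {p. prime p \<and> P < p \<and> p \<le> X}. real (Nf p) * ln (real p) / real p)"
    unfolding S_def using fin nn by (intro sum_mono2) auto
  also have "\<dots> = S P + (\<Sum>p | prime p \<and> P < p \<and> p \<le> X. real (Nf p) * ln (real p) / real p)"
    unfolding S_def using fin by (intro sum.union_disjoint) auto
  finally show ?thesis .
qed

lemma S_nonneg: "S X \<ge> 0"
  unfolding S_def by (rule sum_nonneg) (auto simp: prime_gt_0_nat Suc_le_eq)

text \<open>
  Every prime dividing \<open>N x\<close> contributes at least \<open>ln p\<close> to \<open>ln \<bar>N x\<bar> \<le> n ln B + O(1)\<close>.
\<close>

lemma S_upper:
  fixes \<eta> :: real
  assumes eta: "0 < \<eta>" "\<eta> < 1"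
  obtains K where "\<And>b. b \<ge> 1 \<Longrightarrow> (1 - \<eta>) * S (b ^ n) \<le> real n * ln (real b) + K"
proof -
  obtain c where c: "cov \<le> c" "1 - \<eta> \<le> (1 - real cov / real c) ^ n - (1 / (2 * real c)) ^ n"
    by (rule exists_scale[OF eta(1)])
  have c0: "c > 0" using c cov(1) by linarith
  define P0 where "P0 = nat \<bar>disc\<bar>"
  obtain Ks :: real where Ks: "\<And>Q. finite Q \<Longrightarrow> (\<Sum>p\<in>Q. ln (real p) / (real p)\<^sup>2) \<le> Ks"
    by (rule sum_ln_over_square_bounded) blast
  define K where "K = S P0 + real n * ln (real c) + ln C1 + 2 ^ n * K1 * Ks"
  have "(1 - \<eta>) * S (b ^ n) \<le> real n * ln (real b) + K" if b: "b \<ge> 1" for b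
  proof -
    define B where "B = c * b"
    have B1: "B \<ge> 1" using c0 b by (simp add: B_def)
    define Q where "Q = {p. prime p \<and> P0 < p \<and> p \<le> b ^ n}"
    have finQ: "finite Q" unfolding Q_def by (rule finite_subset[of _ "{..b ^ n}"]) auto
    have W0: "W B > 0" by (rule W_pos)
    \<comment> \<open>The lattice count bounds from below the number of pairs of a point and a root
      ideal containing it. Outside \<open>D\<close> a point lies in at most one root ideal, and if
      it lies in one, \<open>p\<close> divides its norm.\<close>
    have main: "(1 - \<eta>) * W B * (real (Nf p) / real p) \<le> real (card {x\<in>pb B. p dvd M x}) + 2 ^ n * (K1 * W B / (real p)\<^sup>2)"
      if pQ: "p \<in> Q" for p
    proof -
      have p: "prime p" "p \<le> b ^ n" and nd: "\<not> int p dvd disc" using pQ not_dvd_disc by (auto simp: Q_def P0_def)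
      have p0: "real p > 0" using prime_gt_0_nat[OF p(1)] by simp
      obtain D where D: "\<And>B. B \<ge> 1 \<Longrightarrow> (real p)\<^sup>2 * real (card (D \<inter> pb B)) \<le> K1 * W B"
        "\<And>x r s. r \<in> roots_mod (int p) \<Longrightarrow> s \<in> roots_mod (int p) \<Longrightarrow> r \<noteq> s \<Longrightarrow> x \<in> root_ideal (int p) r \<Longrightarrow> x \<in> root_ideal (int p) s \<Longrightarrow> x \<in> D"
        by (rule bad_set[OF p(1) nd]) blast
      have cx: "real (cnt p x) \<le> of_bool (p dvd M x) + 2 ^ n * of_bool (x \<in> D)" for x
      proof (cases "x \<in> D")
        case True
        have "cnt p x \<le> Nf p" unfolding cnt_def Nf_def using finite_roots_mod by (intro card_mono) auto
        also have "\<dots> \<le> 2 ^ n" by (rule Nf_le[OF p(1)])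
        finally have "real (cnt p x) \<le> real (2 ^ n)" by (simp only: of_nat_le_iff)
        then have "real (cnt p x) \<le> 2 ^ n" by (simp only: of_nat_power of_nat_numeral)
        moreover have "2 ^ n * of_bool (x \<in> D) = (2 ^ n :: real)" using True by simp
        moreover have "0 \<le> (of_bool (p dvd M x) :: real)" by simp
        ultimately show ?thesis by linarith
      next
        case False
        let ?R = "{r\<in>roots_mod (int p). x \<in> root_ideal (int p) r}"
        show ?thesis
        proof (cases "?R = {}")
          case True then show ?thesis unfolding cnt_def by (simp only: True card.empty) simp
        next
          case ne: False
          then obtain r where r: "r \<in> ?R" by blast
          have "?R = {r}" using r D(2) False by blast
          then have "cnt p x = 1" by (simp add: cnt_def)
          moreover have "int p dvd N x" using r by (intro prime_dvd_N_if_root[of _ x r]) (auto simp: root_ideal_def roots_mod_def)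
          then have "p dvd M x" by (simp add: nat_dvd_iff int_dvd_int_iff[symmetric] del: int_dvd_int_iff)
          ultimately show ?thesis using False by simp
        qed
      qed
      have "(1 - \<eta>) * W B * (real (Nf p) / real p) = (\<Sum>r\<in>roots_mod (int p). (1 - \<eta>) * W B / real p)"
        by (simp add: Nf_def)
      also have "\<dots> \<le> (\<Sum>r\<in>roots_mod (int p). real (card (root_ideal (int p) r \<inter> pb B)))"
      proof (rule sum_mono)
        fix r assume r: "r \<in> roots_mod (int p)"
        have "(1 - \<eta>) * W B / real p \<le> ((1 - real cov / real c) ^ n - (1 / (2 * real c)) ^ n) * W B / real p"
          using c(2) W0 by (intro divide_right_mono mult_right_mono) auto
        also have "\<dots> \<le> real (card (root_ideal (int p) r \<inter> pb B))" unfolding B_def by (rule root_count(2)[OF p(1) r p(2) c(1) b])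
        finally show "(1 - \<eta>) * W B / real p \<le> real (card (root_ideal (int p) r \<inter> pb B))" .
      qed
      also have "\<dots> = (\<Sum>x\<in>pb B. real (cnt p x))" by (rule sum_cnt[symmetric])
      also have "\<dots> \<le> (\<Sum>x\<in>pb B. of_bool (p dvd M x) + 2 ^ n * of_bool (x \<in> D))" by (intro sum_mono cx)
      also have "\<dots> = (\<Sum>x\<in>pb B. of_bool (p dvd M x)) + 2 ^ n * (\<Sum>x\<in>pb B. of_bool (x \<in> D))"
        by (simp add: sum.distrib sum_distrib_left)
      also have "(\<Sum>x\<in>pb B. of_bool (p dvd M x) :: real) = real (card {x\<in>pb B. p dvd M x})"
        by (rule sum_of_bool_card) simp
      also have "(\<Sum>x\<in>pb B. of_bool (x \<in> D) :: real) = real (card {x\<in>pb B. x \<in> D})" by (rule sum_of_bool_card) simp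
      also have "{x\<in>pb B. x \<in> D} = D \<inter> pb B" by blast
      also have "real (card (D \<inter> pb B)) \<le> K1 * W B / (real p)\<^sup>2"
        using D(1)[OF B1] p0 by (simp add: le_divide_eq mult.commute)
      finally show ?thesis by simp
    qed
    have "(1 - \<eta>) * W B * (\<Sum>p\<in>Q. real (Nf p) * ln (real p) / real p) = (\<Sum>p\<in>Q. ((1 - \<eta>) * W B * (real (Nf p) / real p)) * ln (real p))"
      by (simp add: sum_distrib_left mult_ac)
    also have "\<dots> \<le> (\<Sum>p\<in>Q. (real (card {x\<in>pb B. p dvd M x}) + 2 ^ n * (K1 * W B / (real p)\<^sup>2)) * ln (real p))"
      using main by (intro sum_mono mult_right_mono) (auto simp: Q_def prime_gt_0_nat Suc_le_eq)
    also have "\<dots> = (\<Sum>p\<in>Q. real (card {x\<in>pb B. p dvd M x}) * ln (real p)) + 2 ^ n * K1 * W B * (\<Sum>p\<in>Q. ln (real p) / (real p)\<^sup>2)"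
      unfolding sum_distrib_left sum.distrib[symmetric] by (intro sum.cong refl) (simp add: distrib_right distrib_left mult_ac)
    also have "\<dots> \<le> W B * (real n * ln (real B) + ln C1) + 2 ^ n * K1 * W B * Ks"
    proof (intro add_mono mult_left_mono Ks[OF finQ])
      have "(\<Sum>p\<in>Q. real (card {x\<in>pb B. p dvd M x}) * ln (real p)) = (\<Sum>p\<in>Q. \<Sum>x\<in>pb B. of_bool (p dvd M x) * ln (real p))"
      proof (rule sum.cong[OF refl])
        fix p
        have "(\<Sum>x\<in>pb B. of_bool (p dvd M x) :: real) = real (card {x\<in>pb B. p dvd M x})"
          by (rule sum_of_bool_card) simp
        then show "real (card {x\<in>pb B. p dvd M x}) * ln (real p) = (\<Sum>x\<in>pb B. of_bool (p dvd M x) * ln (real p))"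
          by (simp only: sum_distrib_right[symmetric])
      qed
      also have "\<dots> = (\<Sum>x\<in>pb B. \<Sum>p\<in>Q. of_bool (p dvd M x) * ln (real p))" by (rule sum.swap)
      also have "\<dots> \<le> (\<Sum>x\<in>pb B. real n * ln (real B) + ln C1)"
      proof (rule sum_mono)
        fix x assume x: "x \<in> pb B"
        have "(\<Sum>p\<in>Q. of_bool (p dvd M x) * ln (real p)) = (\<Sum>p\<in>{p\<in>Q. p dvd M x}. ln (real p))"
          using finQ by (simp add: sum.inter_filter of_bool_def if_distrib[of "\<lambda>t. t * _"] cong: if_cong)
        also have "\<dots> \<le> ln (real (M x))" using finQ M_pos[OF x] by (intro sum_ln_primes_le) (auto simp: Q_def)
        also have "\<dots> \<le> real n * ln (real B) + ln C1" by (rule ln_M_le[OF x B1])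
        finally show "(\<Sum>p\<in>Q. of_bool (p dvd M x) * ln (real p)) \<le> real n * ln (real B) + ln C1" .
      qed
      also have "\<dots> = real (card (pb B)) * (real n * ln (real B) + ln C1)" by simp
      also have "\<dots> \<le> W B * (real n * ln (real B) + ln C1)"
      proof (rule mult_right_mono)
        have "card (pb B) \<le> card (pbox n B)" by (intro card_mono) auto
        then show "real (card (pb B)) \<le> W B" unfolding card_pbox_W[symmetric] by (simp only: of_nat_le_iff)
      qed (use B1 C1_ge_1 in auto)
      finally show "(\<Sum>p\<in>Q. real (card {x\<in>pb B. p dvd M x}) * ln (real p)) \<le> W B * (real n * ln (real B) + ln C1)" .
    qed (use K1_pos W0 in auto)
    finally have "W B * ((1 - \<eta>) * (\<Sum>p\<in>Q. real (Nf p) * ln (real p) / real p)) \<le> W B * (real n * ln (real B) + ln C1 + 2 ^ n * K1 * Ks)"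
      by (simp add: algebra_simps)
    then have Qb: "(1 - \<eta>) * (\<Sum>p\<in>Q. real (Nf p) * ln (real p) / real p) \<le> real n * ln (real B) + ln C1 + 2 ^ n * K1 * Ks"
      using W0 by (simp only: mult_le_cancel_left_pos)
    have "(1 - \<eta>) * S (b ^ n) \<le> (1 - \<eta>) * (S P0 + (\<Sum>p\<in>Q. real (Nf p) * ln (real p) / real p))"
      unfolding Q_def using eta by (intro mult_left_mono S_mono_split) auto
    also have "\<dots> \<le> S P0 + (1 - \<eta>) * (\<Sum>p\<in>Q. real (Nf p) * ln (real p) / real p)"
      using eta S_nonneg[of P0] by (simp add: algebra_simps)
    also have "\<dots> \<le> S P0 + (real n * ln (real B) + ln C1 + 2 ^ n * K1 * Ks)" using Qb by simp
    also have "\<dots> = real n * ln (real b) + K" using c0 b by (simp add: B_def K_def ln_mult algebra_simps)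
    finally show ?thesis .
  qed
  then show thesis using that by blast
qed


text \<open>
  Conversely \<open>ln \<bar>N x\<bar>\<close> is about \<open>n ln B\<close> on average. In its prime factorisation the primes up to \<open>P0\<close>,
  the multiple factors and the primes between \<open>b ^ n\<close> and a constant multiple of it (by
  Chebyshev's estimate) are negligible.
\<close>

lemma S_lower:
  fixes \<epsilon> :: real
  assumes eps: "0 < \<epsilon>" "\<epsilon> < 1"
  obtains K where "\<And>b. b \<ge> 1 \<Longrightarrow> (1 - \<epsilon>) * (real n * ln (real b)) \<le> (1 + \<epsilon>) * S (b ^ n) + K"
proof -
  obtain c where c: "cov \<le> c" "(1 + real cov / real c) ^ n \<le> 1 + \<epsilon>"
    by (rule exists_scale[OF eps(1)])
  have c0: "c > 0" using c cov(1) by linarith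
  have n1: "real n \<ge> 1" using n_pos by simp
  \<comment> \<open>Makes the share \<open>2 * n * \<delta>\<close> of points with a small conjugate
    equal to \<open>\<epsilon> / 3\<close>.\<close>
  define \<delta> where "\<delta> = \<epsilon> / (6 * real n)"
  have d0: "\<delta> > 0" using eps n1 by (simp add: \<delta>_def)
  have nd: "2 * real n * \<delta> = \<epsilon> / 3" using n1 by (simp add: \<delta>_def)
  \<comment> \<open>The bad sets of all primes beyond \<open>P0\<close> have total share at most
    \<open>K1 / P0\<close>, which is to be at most \<open>\<epsilon> / 3\<close>.\<close>
  obtain P1 :: nat where P1: "3 * K1 / \<epsilon> < real P1" using reals_Archimedean2 by blast
  define P0 where "P0 = max P1 (nat \<bar>disc\<bar>)"
  have "3 * K1 / \<epsilon> > 0" using K1_pos eps by simp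
  then have P0pos: "P0 > 0" using P1 unfolding P0_def by (simp add: max_def) linarith
  have K1P: "K1 / real P0 \<le> \<epsilon> / 3"
  proof -
    have "3 * K1 / \<epsilon> \<le> real P0" using P1 by (simp add: P0_def)
    then show ?thesis using eps P0pos by (simp add: field_simps)
  qed
  define Qs where "Qs = {p. prime p \<and> p \<le> P0}"
  have finQs: "finite Qs" unfolding Qs_def by (rule finite_subset[of _ "{..P0}"]) auto
  have cQs: "real (card Qs) \<le> real P0 + 1"
  proof -
    have "card Qs \<le> card {..P0}" unfolding Qs_def by (intro card_mono) auto
    then show ?thesis by simp
  qed
  \<comment> \<open>At most \<open>P0 + 1\<close> small primes share a loss of
    \<open>\<epsilon> / 3\<close> of the main term \<open>n * ln B\<close>.\<close>
  define \<eta> where "\<eta> = \<epsilon> * real n / (3 * (real P0 + 1))"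
  have eta0: "\<eta> > 0" using eps n1 by (simp add: \<eta>_def)
  have "\<forall>p. \<exists>K. prime p \<longrightarrow> (\<forall>B\<ge>1. (\<Sum>x\<in>pb B. real (multiplicity p (M x)) * ln (real p)) \<le> W B * (\<eta> * ln (real B) + K))"
    using sum_multiplicity_small[OF _ eta0] by metis
  then obtain Kp where Kp: "\<And>p B. prime p \<Longrightarrow> B \<ge> 1 \<Longrightarrow> (\<Sum>x\<in>pb B. real (multiplicity p (M x)) * ln (real p)) \<le> W B * (\<eta> * ln (real B) + Kp p)"
    by metis
  \<comment> \<open>Norms in the box of side \<open>c * b\<close> stay below
    \<open>2 ^ j * b ^ n\<close>, so \<open>j\<close> dyadic intervals above \<open>b ^ n\<close>
    contain all remaining prime factors.\<close>
  obtain j where j: "C1 * real c ^ n < 2 ^ j" using real_arch_pow[of 2 "C1 * real c ^ n"] by auto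
  define KK where "KK = (\<Sum>p\<in>Qs. Kp p) + 2 ^ n * K0 * (real j * ln 4) + ln C1"
  define K where "K = \<bar>KK\<bar> + real n * \<bar>ln \<delta>\<bar>"
  have "(1 - \<epsilon>) * (real n * ln (real b)) \<le> (1 + \<epsilon>) * S (b ^ n) + K" if b: "b \<ge> 1" for b
  proof -
    define B where "B = c * b"
    have B1: "B \<ge> 1" using c0 b by (simp add: B_def)
    have bB: "ln (real b) \<le> ln (real B)" using b c0 by (simp add: B_def)
    have lnb: "ln (real b) \<ge> 0" and lnB: "ln (real B) \<ge> 0" using b B1 by simp_all
    show ?thesis
    proof (cases "1 / \<delta> \<le> real B")
      \<comment> \<open>The box is too small for the lower bound on the average; \<open>b\<close> is
        then at most \<open>1 / \<delta>\<close> and \<open>K\<close> absorbs the left side.\<close>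
      case False
      have "b \<le> B" using c0 by (simp add: B_def)
      then have "real b \<le> real B" by (simp only: of_nat_le_iff)
      then have "real b \<le> 1 / \<delta>" using False by linarith
      then have "ln (real b) \<le> ln (1 / \<delta>)" using b d0 by (subst ln_le_cancel_iff) auto
      also have "\<dots> \<le> \<bar>ln \<delta>\<bar>" using d0 by (simp add: ln_div)
      finally have "real n * ln (real b) \<le> real n * \<bar>ln \<delta>\<bar>" by (intro mult_left_mono) auto
      moreover have "(1 - \<epsilon>) * (real n * ln (real b)) \<le> 1 * (real n * ln (real b))" using eps lnb by (intro mult_right_mono) auto
      moreover have "(1 + \<epsilon>) * S (b ^ n) \<ge> 0" using eps S_nonneg by simp
      ultimately show ?thesis unfolding K_def by linarith
    next
      case True
      have W0: "W B > 0" by (rule W_pos)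
      define U where "U = real n * ln (real B) + ln C1"
      have U0: "U \<ge> 0" using lnB C1_ge_1 by (simp add: U_def)
      have low: "(1 - \<epsilon> / 3) * W B * (real n * (ln (real B) + ln \<delta>)) \<le> (\<Sum>x\<in>pb B. ln (real (M x)))"
        using sum_ln_norm_lower[OF d0 _ True] eps unfolding nd by auto
      define Qm where "Qm = {p. prime p \<and> P0 < p \<and> p \<le> b ^ n}"
      define Ql where "Ql = {p. prime p \<and> P0 < p \<and> b ^ n < p \<and> p \<le> 2 ^ j * b ^ n}"
      have fin: "finite Qm" "finite Ql"
        using finite_subset[of Qm "{..b ^ n}"] finite_subset[of Ql "{..2 ^ j * b ^ n}"] unfolding Qm_def Ql_def by auto
      let ?Q = "Qs \<union> (Qm \<union> Ql)"
      have finQ: "finite ?Q" using fin finQs by simp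
      have dec: "ln (real (M x)) = (\<Sum>p\<in>?Q. real (multiplicity p (M x)) * ln (real p))" if x: "x \<in> pb B" for x
      proof (rule ln_eq_sum_multiplicity[OF finQ])
        show "prime p" if "p \<in> ?Q" for p using that by (auto simp: Qs_def Qm_def Ql_def)
        show "M x > 0" by (rule M_pos[OF x])
        show "prime_factors (M x) \<subseteq> ?Q"
        proof
          fix p assume p: "p \<in> prime_factors (M x)"
          then have pp: "prime p" "p dvd M x" by (auto simp: prime_factors_dvd)
          have "p \<le> M x" using pp(2) M_pos[OF x] by (rule dvd_imp_le)
          then have "real p \<le> real (M x)" by (simp only: of_nat_le_iff)
          also have "\<dots> \<le> C1 * real B ^ n" using x by (intro norm_upper) auto
          also have "\<dots> = C1 * real c ^ n * real b ^ n" by (simp add: B_def power_mult_distrib)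
          also have "\<dots> \<le> 2 ^ j * real b ^ n" using j by (intro mult_right_mono) auto
          also have "\<dots> = real (2 ^ j * b ^ n)" by simp
          finally have "p \<le> 2 ^ j * b ^ n" by (simp only: of_nat_le_iff)
          then show "p \<in> ?Q" using pp(1) unfolding Qs_def Qm_def Ql_def by (cases "p \<le> P0"; cases "p \<le> b ^ n") auto
        qed
      qed
      let ?T = "\<lambda>p. \<Sum>x\<in>pb B. real (multiplicity p (M x)) * ln (real p)"
      have "(\<Sum>x\<in>pb B. ln (real (M x))) = (\<Sum>x\<in>pb B. \<Sum>p\<in>?Q. real (multiplicity p (M x)) * ln (real p))"
        by (intro sum.cong refl dec)
      also have "\<dots> = (\<Sum>p\<in>?Q. ?T p)" by (rule sum.swap)
      also have "\<dots> = (\<Sum>p\<in>Qs. ?T p) + (\<Sum>p\<in>Qm \<union> Ql. ?T p)"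
        using fin finQs by (intro sum.union_disjoint) (auto simp: Qs_def Qm_def Ql_def)
      also have "(\<Sum>p\<in>Qm \<union> Ql. ?T p) = (\<Sum>p\<in>Qm. ?T p) + (\<Sum>p\<in>Ql. ?T p)"
        using fin by (intro sum.union_disjoint) (auto simp: Qm_def Ql_def)
      finally have split: "(\<Sum>x\<in>pb B. ln (real (M x))) = (\<Sum>p\<in>Qs. ?T p) + ((\<Sum>p\<in>Qm. ?T p) + (\<Sum>p\<in>Ql. ?T p))" .
      have small: "(\<Sum>p\<in>Qs. ?T p) \<le> W B * (\<epsilon> / 3 * (real n * ln (real B)) + (\<Sum>p\<in>Qs. Kp p))"
      proof -
        have "(\<Sum>p\<in>Qs. ?T p) \<le> (\<Sum>p\<in>Qs. W B * (\<eta> * ln (real B) + Kp p))"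
          by (intro sum_mono Kp B1) (simp add: Qs_def)
        also have "\<dots> = W B * (real (card Qs) * (\<eta> * ln (real B)) + (\<Sum>p\<in>Qs. Kp p))"
          by (simp add: sum_distrib_left[symmetric] sum.distrib)
        also have "\<dots> \<le> W B * ((real P0 + 1) * (\<eta> * ln (real B)) + (\<Sum>p\<in>Qs. Kp p))"
          using cQs eta0 lnB W0 by (intro mult_left_mono add_right_mono mult_right_mono) auto
        also have "(real P0 + 1) * (\<eta> * ln (real B)) = \<epsilon> / 3 * (real n * ln (real B))"
        proof -
          have "t * (e * m / (3 * t)) = e / 3 * m" if "t > 0" for t e m :: real using that by simp
          from this[of "real P0 + 1" \<epsilon> "real n"] have "(real P0 + 1) * \<eta> = \<epsilon> / 3 * real n"
            unfolding \<eta>_def by (simp only: of_nat_0_le_iff add_nonneg_pos zero_less_one)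
          then show ?thesis by (simp only: mult.assoc[symmetric])
        qed
        finally show ?thesis .
      qed
      \<comment> \<open>Outside the bad set the multiplicity is at most \<open>cnt\<close>; on it,
        the whole logarithm of the norm, at most \<open>U\<close>, is conceded.\<close>
      have big: "?T p \<le> ln (real p) * (\<Sum>r\<in>roots_mod (int p). real (card (root_ideal (int p) r \<inter> pb B))) + K1 * W B * U * (1 / (real p)\<^sup>2)"
        if pp: "prime p" and pP: "P0 < p" for p
      proof -
        have nd: "\<not> int p dvd disc" using pP by (intro not_dvd_disc) (simp add: P0_def)
        have p0: "real p > 0" and lnp: "ln (real p) \<ge> 0" using prime_gt_1_nat[OF pp] by simp_all
        obtain D where D: "\<And>B. B \<ge> 1 \<Longrightarrow> (real p)\<^sup>2 * real (card (D \<inter> pb B)) \<le> K1 * W B"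
          "\<And>x. int p dvd N x \<Longrightarrow> x \<in> D \<or> (\<exists>r\<in>roots_mod (int p). x \<in> root_ideal (int p) r)"
          "\<And>x. (int p)\<^sup>2 dvd N x \<Longrightarrow> x \<in> D"
          by (rule bad_set[OF pp nd]) blast
        have pt: "real (multiplicity p (M x)) * ln (real p) \<le> real (cnt p x) * ln (real p) + of_bool (x \<in> D) * U"
          if x: "x \<in> pb B" for x
        proof (cases "x \<in> D")
          case True
          have "real (multiplicity p (M x)) * ln (real p) \<le> ln (real (M x))" by (rule multiplicity_ln_le[OF pp M_pos[OF x]])
          also have "\<dots> \<le> U" unfolding U_def by (rule ln_M_le[OF x B1])
          finally show ?thesis using True lnp by (simp add: add_increasing)
        next
          case False
          have "multiplicity p (M x) < 2"
          proof (rule ccontr)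
            assume "\<not> multiplicity p (M x) < 2"
            then have "p ^ 2 dvd M x" by (intro multiplicity_dvd') linarith
            then have "int (p ^ 2) dvd int (M x)" by (simp only: of_nat_dvd_iff)
            then have "(int p)\<^sup>2 dvd N x" by simp
            then show False using D(3) False by blast
          qed
          moreover have "1 \<le> cnt p x" if "multiplicity p (M x) \<noteq> 0"
          proof -
            have "p dvd M x" using that by (metis not_dvd_imp_multiplicity_0)
            then have "int p dvd int (M x)" by (simp only: of_nat_dvd_iff)
            then have "int p dvd N x" by simp
            then have "{r\<in>roots_mod (int p). x \<in> root_ideal (int p) r} \<noteq> {}" using D(2)[of x] False by blast
            moreover have "finite {r\<in>roots_mod (int p). x \<in> root_ideal (int p) r}"
              using finite_roots_mod[of "int p"] by (rule rev_finite_subset) blast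
            ultimately show ?thesis unfolding cnt_def by (simp add: Suc_le_eq card_gt_0_iff)
          qed
          ultimately have "multiplicity p (M x) \<le> cnt p x" by linarith
          then have "real (multiplicity p (M x)) \<le> real (cnt p x)" by (simp only: of_nat_le_iff)
          then show ?thesis using lnp False by (simp add: mult_right_mono)
        qed
        have "?T p \<le> (\<Sum>x\<in>pb B. real (cnt p x) * ln (real p) + of_bool (x \<in> D) * U)" by (intro sum_mono pt)
        also have "\<dots> = (\<Sum>x\<in>pb B. real (cnt p x)) * ln (real p) + (\<Sum>x\<in>pb B. of_bool (x \<in> D)) * U"
          by (simp only: sum.distrib sum_distrib_right)
        also have "(\<Sum>x\<in>pb B. of_bool (x \<in> D) :: real) = real (card {x\<in>pb B. x \<in> D})" by (rule sum_of_bool_card) simp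
        also have "{x\<in>pb B. x \<in> D} = D \<inter> pb B" by blast
        also have "real (card (D \<inter> pb B)) * U \<le> K1 * W B / (real p)\<^sup>2 * U"
        proof (rule mult_right_mono[OF _ U0])
          have "(real p)\<^sup>2 > 0" using p0 by simp
          then show "real (card (D \<inter> pb B)) \<le> K1 * W B / (real p)\<^sup>2"
            using D(1)[OF B1] by (simp only: pos_le_divide_eq mult.commute)
        qed
        finally show ?thesis unfolding sum_cnt by (simp add: mult_ac)
      qed
      have mid: "(\<Sum>p\<in>Qm. ?T p) \<le> W B * ((1 + \<epsilon>) * S (b ^ n)) + K1 * W B * U * (\<Sum>p\<in>Qm. 1 / (real p)\<^sup>2)"
      proof -
        have "(\<Sum>p\<in>Qm. ?T p) \<le> (\<Sum>p\<in>Qm. W B * (1 + \<epsilon>) * (real (Nf p) * ln (real p) / real p) + K1 * W B * U * (1 / (real p)\<^sup>2))"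
        proof (rule sum_mono)
          fix p assume "p \<in> Qm"
          then have p: "prime p" "P0 < p" "p \<le> b ^ n" by (auto simp: Qm_def)
          have lnp: "ln (real p) \<ge> 0" using prime_gt_1_nat[OF p(1)] by simp
          have "(\<Sum>r\<in>roots_mod (int p). real (card (root_ideal (int p) r \<inter> pb B))) \<le> (\<Sum>r\<in>roots_mod (int p). (1 + \<epsilon>) * W B / real p)"
          proof (rule sum_mono)
            fix r assume r: "r \<in> roots_mod (int p)"
            have "real (card (root_ideal (int p) r \<inter> pb B)) \<le> (1 + real cov / real c) ^ n * W B / real p"
              unfolding B_def by (rule root_count(1)[OF p(1) r p(3) c(1) b])
            also have "\<dots> \<le> (1 + \<epsilon>) * W B / real p" using c(2) W0 by (intro divide_right_mono mult_right_mono) auto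
            finally show "real (card (root_ideal (int p) r \<inter> pb B)) \<le> (1 + \<epsilon>) * W B / real p" .
          qed
          then have "ln (real p) * (\<Sum>r\<in>roots_mod (int p). real (card (root_ideal (int p) r \<inter> pb B))) \<le> ln (real p) * (real (Nf p) * ((1 + \<epsilon>) * W B / real p))"
            using lnp by (intro mult_left_mono) (auto simp: Nf_def)
          moreover have "ln (real p) * (real (Nf p) * ((1 + \<epsilon>) * W B / real p)) = W B * (1 + \<epsilon>) * (real (Nf p) * ln (real p) / real p)"
            by (simp add: mult_ac)
          ultimately show "?T p \<le> W B * (1 + \<epsilon>) * (real (Nf p) * ln (real p) / real p) + K1 * W B * U * (1 / (real p)\<^sup>2)"
            using big[OF p(1,2)] by linarith
        qed
        also have "\<dots> = W B * (1 + \<epsilon>) * (\<Sum>p\<in>Qm. real (Nf p) * ln (real p) / real p) + K1 * W B * U * (\<Sum>p\<in>Qm. 1 / (real p)\<^sup>2)"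
          unfolding sum.distrib sum_distrib_left by (rule refl)
        also have "(\<Sum>p\<in>Qm. real (Nf p) * ln (real p) / real p) \<le> S (b ^ n)"
          unfolding S_def
        proof (rule sum_mono2)
          show "finite {p. prime p \<and> p \<le> b ^ n}" by (rule finite_subset[of _ "{..b ^ n}"]) auto
          show "0 \<le> real (Nf p) * ln (real p) / real p" for p by (cases "p = 0") auto
        qed (auto simp: Qm_def)
        finally show ?thesis using W0 eps by (simp add: mult_left_mono mult.assoc)
      qed
      have large: "(\<Sum>p\<in>Ql. ?T p) \<le> W B * (2 ^ n * K0 * (real j * ln 4)) + K1 * W B * U * (\<Sum>p\<in>Ql. 1 / (real p)\<^sup>2)"
      proof -
        have "(\<Sum>p\<in>Ql. ?T p) \<le> (\<Sum>p\<in>Ql. W B * (2 ^ n * K0) * (ln (real p) / real p) + K1 * W B * U * (1 / (real p)\<^sup>2))"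
        proof (rule sum_mono)
          fix p assume "p \<in> Ql"
          then have p: "prime p" "P0 < p" by (auto simp: Ql_def)
          have lnp: "ln (real p) \<ge> 0" using prime_gt_1_nat[OF p(1)] by simp
          have "(\<Sum>r\<in>roots_mod (int p). real (card (root_ideal (int p) r \<inter> pb B))) \<le> (\<Sum>r\<in>roots_mod (int p). K0 * W B / real p)"
            by (intro sum_mono root_count_large p B1)
          also have "\<dots> = real (Nf p) * (K0 * W B / real p)" by (simp add: Nf_def)
          also have "\<dots> \<le> 2 ^ n * (K0 * W B / real p)"
          proof (rule mult_right_mono)
            have "real (Nf p) \<le> real (2 ^ n)" using Nf_le[OF p(1)] by (simp only: of_nat_le_iff)
            then show "real (Nf p) \<le> 2 ^ n" by (simp only: of_nat_power of_nat_numeral)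
          qed (use K0_pos W0 in auto)
          finally have "ln (real p) * (\<Sum>r\<in>roots_mod (int p). real (card (root_ideal (int p) r \<inter> pb B))) \<le> ln (real p) * (2 ^ n * (K0 * W B / real p))"
            using lnp by (intro mult_left_mono)
          moreover have "ln (real p) * (2 ^ n * (K0 * W B / real p)) = W B * (2 ^ n * K0) * (ln (real p) / real p)"
            by (simp add: mult_ac)
          ultimately show "?T p \<le> W B * (2 ^ n * K0) * (ln (real p) / real p) + K1 * W B * U * (1 / (real p)\<^sup>2)"
            using big[OF p] by linarith
        qed
        also have "\<dots> = W B * (2 ^ n * K0) * (\<Sum>p\<in>Ql. ln (real p) / real p) + K1 * W B * U * (\<Sum>p\<in>Ql. 1 / (real p)\<^sup>2)"
          unfolding sum.distrib sum_distrib_left by (rule refl)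
        also have "(\<Sum>p\<in>Ql. ln (real p) / real p) \<le> real j * ln 4"
        proof -
          have "(\<Sum>p\<in>Ql. ln (real p) / real p) \<le> (\<Sum>p | prime p \<and> b ^ n < p \<and> p \<le> 2 ^ j * b ^ n. ln (real p) / real p)"
          proof (rule sum_mono2)
            show "finite {p. prime p \<and> b ^ n < p \<and> p \<le> 2 ^ j * b ^ n}" by (rule finite_subset[of _ "{..2 ^ j * b ^ n}"]) auto
            show "0 \<le> ln (real p) / real p" for p by (cases "p = 0") auto
          qed (auto simp: Ql_def)
          also have "\<dots> \<le> real j * ln 4" using b by (intro chebyshev_range) simp
          finally show ?thesis .
        qed
        finally show ?thesis using W0 K0_pos by (simp add: mult_left_mono mult.assoc)
      qed
      have sq: "(\<Sum>p\<in>Qm. 1 / (real p)\<^sup>2) + (\<Sum>p\<in>Ql. 1 / (real p)\<^sup>2) \<le> 1 / real P0"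
      proof -
        have "(\<Sum>p\<in>Qm. 1 / (real p)\<^sup>2) + (\<Sum>p\<in>Ql. 1 / (real p)\<^sup>2) = (\<Sum>p\<in>Qm \<union> Ql. 1 / (real p)\<^sup>2)"
          using fin by (intro sum.union_disjoint[symmetric]) (auto simp: Qm_def Ql_def)
        also have "\<dots> \<le> 1 / real P0" using fin P0pos by (intro sum_inverse_square_tail) (auto simp: Qm_def Ql_def)
        finally show ?thesis .
      qed
      have "K1 * W B * U * ((\<Sum>p\<in>Qm. 1 / (real p)\<^sup>2) + (\<Sum>p\<in>Ql. 1 / (real p)\<^sup>2)) \<le> K1 * W B * U * (1 / real P0)"
        using sq K1_pos W0 U0 by (intro mult_left_mono) auto
      also have "\<dots> = W B * (K1 / real P0 * U)" by simp
      also have "\<dots> \<le> W B * (\<epsilon> / 3 * U)" using K1P U0 W0 by (intro mult_left_mono mult_right_mono) auto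
      finally have bads: "K1 * W B * U * (\<Sum>p\<in>Qm. 1 / (real p)\<^sup>2) + K1 * W B * U * (\<Sum>p\<in>Ql. 1 / (real p)\<^sup>2) \<le> W B * (\<epsilon> / 3 * U)"
        by (simp only: distrib_left)
      define L where "L = real n * ln (real B)"
      have L0: "L \<ge> 0" using lnB by (simp add: L_def)
      have "(\<Sum>x\<in>pb B. ln (real (M x))) \<le> W B * (\<epsilon> / 3 * L + (\<Sum>p\<in>Qs. Kp p)) + W B * ((1 + \<epsilon>) * S (b ^ n)) + W B * (2 ^ n * K0 * (real j * ln 4)) + W B * (\<epsilon> / 3 * U)"
        using split small mid large bads unfolding L_def by linarith
      also have "\<dots> = W B * (\<epsilon> / 3 * L + (\<Sum>p\<in>Qs. Kp p) + (1 + \<epsilon>) * S (b ^ n) + 2 ^ n * K0 * (real j * ln 4) + \<epsilon> / 3 * U)"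
        by (simp only: distrib_left add.assoc)
      finally have up: "(\<Sum>x\<in>pb B. ln (real (M x))) \<le> W B * (\<epsilon> / 3 * L + (\<Sum>p\<in>Qs. Kp p) + (1 + \<epsilon>) * S (b ^ n) + 2 ^ n * K0 * (real j * ln 4) + \<epsilon> / 3 * U)" .
      have "W B * ((1 - \<epsilon> / 3) * (real n * (ln (real B) + ln \<delta>))) = (1 - \<epsilon> / 3) * W B * (real n * (ln (real B) + ln \<delta>))" by simp
      then have "W B * ((1 - \<epsilon> / 3) * (real n * (ln (real B) + ln \<delta>))) \<le> W B * (\<epsilon> / 3 * L + (\<Sum>p\<in>Qs. Kp p) + (1 + \<epsilon>) * S (b ^ n) + 2 ^ n * K0 * (real j * ln 4) + \<epsilon> / 3 * U)"
        using low up by linarith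
      then have "(1 - \<epsilon> / 3) * (real n * (ln (real B) + ln \<delta>)) \<le> \<epsilon> / 3 * L + (\<Sum>p\<in>Qs. Kp p) + (1 + \<epsilon>) * S (b ^ n) + 2 ^ n * K0 * (real j * ln 4) + \<epsilon> / 3 * U"
        using W0 by (simp only: mult_le_cancel_left_pos)
      moreover have "(1 - \<epsilon> / 3) * (real n * (ln (real B) + ln \<delta>)) \<ge> (1 - \<epsilon> / 3) * L - real n * \<bar>ln \<delta>\<bar>"
      proof -
        have "(1 - \<epsilon> / 3) * (real n * \<bar>ln \<delta>\<bar>) \<le> 1 * (real n * \<bar>ln \<delta>\<bar>)" using eps by (intro mult_right_mono) auto
        moreover have "(1 - \<epsilon> / 3) * (real n * (ln (real B) + ln \<delta>)) \<ge> (1 - \<epsilon> / 3) * (L - real n * \<bar>ln \<delta>\<bar>)"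
        proof (rule mult_left_mono)
          have "real n * (- \<bar>ln \<delta>\<bar>) \<le> real n * ln \<delta>" by (intro mult_left_mono) auto
          then show "L - real n * \<bar>ln \<delta>\<bar> \<le> real n * (ln (real B) + ln \<delta>)" by (simp add: L_def distrib_left)
        qed (use eps in simp)
        ultimately show ?thesis by (simp add: right_diff_distrib)
      qed
      moreover have "\<epsilon> / 3 * U \<le> \<epsilon> / 3 * L + ln C1"
      proof -
        have "\<epsilon> / 3 * ln C1 \<le> 1 * ln C1" using eps C1_ge_1 by (intro mult_right_mono) auto
        then show ?thesis unfolding U_def L_def by (simp add: distrib_left)
      qed
      \<comment> \<open>The three losses of \<open>\<epsilon> / 3\<close> come from points with a
        small conjugate, from the primes up to \<open>P0\<close>, and from the bad sets of the
        larger primes.\<close>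
      ultimately have "(1 - \<epsilon> / 3) * L \<le> \<epsilon> / 3 * L + \<epsilon> / 3 * L + (1 + \<epsilon>) * S (b ^ n) + K"
        unfolding K_def KK_def by linarith
      then have "(1 - \<epsilon>) * L \<le> (1 + \<epsilon>) * S (b ^ n) + K" by (simp add: algebra_simps)
      moreover have "(1 - \<epsilon>) * (real n * ln (real b)) \<le> (1 - \<epsilon>) * L"
        unfolding L_def using bB eps by (intro mult_left_mono) auto
      ultimately show ?thesis by linarith
    qed
  qed
  then show thesis using that by blast
qed

end

section \<open>A Mertens theorem for irreducible polynomials\<close>

definition nroots :: "int poly \<Rightarrow> nat \<Rightarrow> nat" where
  "nroots f p = card {r\<in>{0..<int p}. int p dvd poly f r}"

text \<open>The weight \<open>ln p / p\<close> gives all primes up to \<open>X\<close> a total of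
  about \<open>ln X\<close>, so a sum that is \<open>o(ln X)\<close> is one of weighted density
  zero.\<close>

definition psum :: "(nat \<Rightarrow> real) \<Rightarrow> nat \<Rightarrow> real" where
  "psum h X = (\<Sum>p | prime p \<and> p \<le> X. h p * (ln (real p) / real p))"

lemma finite_primes_le [simp]: "finite {p::nat. prime p \<and> p \<le> X}"
  by (rule finite_subset[of _ "{..X}"]) auto

lemma exists_floor_root:
  assumes "n > 0" "X \<ge> (1::nat)"
  obtains b where "b \<ge> 1" "b ^ n \<le> X" "X < (b + 1) ^ n"
proof -
  define A where "A = {b. b \<le> X \<and> b ^ n \<le> X}"
  have fin: "finite A" by (simp add: A_def)
  have "1 \<in> A" using assms by (simp add: A_def)
  define b where "b = Max A"
  have "b \<in> A" unfolding b_def using fin \<open>1 \<in> A\<close> by (intro Max_in) auto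
  moreover have "b \<ge> 1" unfolding b_def using fin \<open>1 \<in> A\<close> by (intro Max_ge)
  moreover have "X < (b + 1) ^ n"
  proof (rule ccontr)
    assume "\<not> X < (b + 1) ^ n"
    moreover have "b + 1 \<le> (b + 1) ^ n" using assms(1) by (intro self_le_power) auto
    ultimately have "b + 1 \<in> A" by (simp add: A_def)
    then have "b + 1 \<le> b" unfolding b_def using fin by (intro Max_ge)
    then show False by simp
  qed
  ultimately show thesis using that by (simp add: A_def)
qed

context monic_irreducible
begin

lemma S_mono: "X \<le> Y \<Longrightarrow> S X \<le> S Y"
  unfolding S_def
proof (rule sum_mono2)
  show "0 \<le> real (Nf p) * ln (real p) / real p" for p by (cases "p = 0") auto
qed auto

text \<open>\<open>X\<close> is enclosed between \<open>b ^ n\<close> and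
  \<open>(b + 1) ^ n\<close>; the logarithms of these differ by at most
  \<open>n * ln 2\<close>.\<close>

lemma S_bounds:
  fixes \<epsilon> :: real
  assumes eps: "0 < \<epsilon>" "\<epsilon> < 1"
  obtains K where "\<And>X. X \<ge> 1 \<Longrightarrow> (1 - \<epsilon>) * S X \<le> ln (real X) + K"
    "\<And>X. X \<ge> 1 \<Longrightarrow> (1 - \<epsilon>) * ln (real X) \<le> (1 + \<epsilon>) * S X + K"
proof -
  obtain Ka where Ka: "\<And>b. b \<ge> 1 \<Longrightarrow> (1 - \<epsilon>) * S (b ^ n) \<le> real n * ln (real b) + Ka"
    using S_upper[OF eps] by blast
  obtain Kb where Kb: "\<And>b. b \<ge> 1 \<Longrightarrow> (1 - \<epsilon>) * (real n * ln (real b)) \<le> (1 + \<epsilon>) * S (b ^ n) + Kb"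
    using S_lower[OF eps] by blast
  define K where "K = \<bar>Ka\<bar> + \<bar>Kb\<bar> + real n * ln 2"
  have "(1 - \<epsilon>) * S X \<le> ln (real X) + K \<and> (1 - \<epsilon>) * ln (real X) \<le> (1 + \<epsilon>) * S X + K" if X: "X \<ge> 1" for X
  proof -
    obtain b where b: "b \<ge> 1" "b ^ n \<le> X" "X < (b + 1) ^ n" by (rule exists_floor_root[OF n_pos X])
    have "real (b + 1) \<le> 2 * real b" using b(1) by simp
    then have "ln (real (b + 1)) \<le> ln (2 * real b)" using b(1) by (subst ln_le_cancel_iff) auto
    also have "\<dots> = ln 2 + ln (real b)" using b(1) by (simp add: ln_mult)
    finally have "real n * ln (real (b + 1)) \<le> real n * (ln 2 + ln (real b))" by (intro mult_left_mono) auto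
    then have l1: "real n * ln (real (b + 1)) \<le> real n * ln 2 + real n * ln (real b)" by (simp add: distrib_left)
    have "real (b ^ n) \<le> real X" using b(2) by (simp only: of_nat_le_iff)
    then have "ln (real (b ^ n)) \<le> ln (real X)" using b(1) X by (subst ln_le_cancel_iff) auto
    then have l2: "real n * ln (real b) \<le> ln (real X)" using b(1) by (simp add: ln_realpow)
    have "real X \<le> real ((b + 1) ^ n)" using b(3) by (simp only: of_nat_le_iff)
    then have "ln (real X) \<le> ln (real ((b + 1) ^ n))" using X by (subst ln_le_cancel_iff) (auto simp del: of_nat_Suc)
    then have l3: "ln (real X) \<le> real n * ln (real (b + 1))" by (simp add: ln_realpow del: of_nat_Suc)
    have "(1 - \<epsilon>) * S X \<le> (1 - \<epsilon>) * S ((b + 1) ^ n)" using b(3) eps by (intro mult_left_mono S_mono) auto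
    also have "\<dots> \<le> real n * ln (real (b + 1)) + Ka" by (rule Ka) simp
    also have "\<dots> \<le> ln (real X) + K" using l1 l2 unfolding K_def by linarith
    finally have 1: "(1 - \<epsilon>) * S X \<le> ln (real X) + K" .
    have "(1 - \<epsilon>) * ln (real X) \<le> (1 - \<epsilon>) * (real n * ln 2 + real n * ln (real b))"
      using l1 l3 eps by (intro mult_left_mono) auto
    also have "\<dots> = (1 - \<epsilon>) * (real n * ln 2) + (1 - \<epsilon>) * (real n * ln (real b))" by (rule distrib_left)
    also have "(1 - \<epsilon>) * (real n * ln 2) \<le> 1 * (real n * ln 2)" using eps by (intro mult_right_mono) auto
    finally have "(1 - \<epsilon>) * ln (real X) \<le> real n * ln 2 + (1 - \<epsilon>) * (real n * ln (real b))" by simp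
    also have "(1 - \<epsilon>) * (real n * ln (real b)) \<le> (1 + \<epsilon>) * S (b ^ n) + Kb" by (rule Kb[OF b(1)])
    also have "(1 + \<epsilon>) * S (b ^ n) \<le> (1 + \<epsilon>) * S X" using b(2) eps by (intro mult_left_mono S_mono) auto
    finally have "(1 - \<epsilon>) * ln (real X) \<le> (1 + \<epsilon>) * S X + K" unfolding K_def by linarith
    with 1 show ?thesis by blast
  qed
  then show thesis using that by blast
qed

lemma S_eq_psum: "S = psum (\<lambda>p. real (nroots f p))"
  by (rule ext) (simp add: S_def psum_def Nf_def roots_mod_def nroots_def)

lemma prime_root_sum_asymp:
  "(\<lambda>X. psum (\<lambda>p. real (nroots f p)) X - ln (real X)) \<in> o(\<lambda>X. ln (real X))"
proof (rule landau_o.smallI)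
  fix c :: real assume c: "c > 0"
  \<comment> \<open>With \<open>\<epsilon> \<le> 1/2\<close> the sum is at most
    \<open>2 * (L + \<bar>K\<bar>)\<close>, so either error is at most
    \<open>3 * \<epsilon> * L + 2 * \<bar>K\<bar>\<close>; the choice \<open>c / 8\<close> and
    \<open>4 * \<bar>K\<bar> \<le> c * L\<close> bring this below \<open>c * L\<close>.\<close>
  define \<epsilon> where "\<epsilon> = min (1/2) (c / 8)"
  have eps: "0 < \<epsilon>" "\<epsilon> < 1" "\<epsilon> \<le> 1/2" "\<epsilon> \<le> c / 8" using c by (auto simp: \<epsilon>_def)
  obtain K where K: "\<And>X. X \<ge> 1 \<Longrightarrow> (1 - \<epsilon>) * S X \<le> ln (real X) + K"
    "\<And>X. X \<ge> 1 \<Longrightarrow> (1 - \<epsilon>) * ln (real X) \<le> (1 + \<epsilon>) * S X + K"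
    by (rule S_bounds[OF eps(1,2)]) blast
  have "filterlim (\<lambda>X. ln (real X)) at_top sequentially" by real_asymp
  then have "\<forall>\<^sub>F X in sequentially. ln (real X) \<ge> 4 * \<bar>K\<bar> / c" unfolding filterlim_at_top by blast
  then show "\<forall>\<^sub>F X in sequentially. norm (psum (\<lambda>p. real (nroots f p)) X - ln (real X)) \<le> c * norm (ln (real X))"
    using eventually_ge_at_top[of 1]
  proof eventually_elim
    case (elim X)
    define L where "L = ln (real X)"
    have L0: "L \<ge> 0" using elim by (simp add: L_def)
    have KL: "4 * \<bar>K\<bar> \<le> c * L" using elim c by (simp add: L_def divide_le_eq mult.commute)
    have a: "(1 - \<epsilon>) * S X \<le> L + K" and b: "(1 - \<epsilon>) * L \<le> (1 + \<epsilon>) * S X + K" using K elim by (auto simp: L_def)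
    have eL: "8 * (\<epsilon> * L) \<le> c * L" using mult_right_mono[OF eps(4) L0] by simp
    have "1/2 * S X \<le> (1 - \<epsilon>) * S X" using eps S_nonneg[of X] by (intro mult_right_mono) auto
    then have "S X \<le> 2 * ((1 - \<epsilon>) * S X)" by simp
    also have "\<dots> \<le> 2 * (L + \<bar>K\<bar>)" using a abs_ge_self[of K] by (intro mult_left_mono) auto
    finally have S2: "S X \<le> 2 * (L + \<bar>K\<bar>)" .
    have "\<epsilon> * S X \<le> \<epsilon> * (2 * (L + \<bar>K\<bar>))" using S2 eps by (intro mult_left_mono) auto
    moreover have "\<epsilon> * (2 * (L + \<bar>K\<bar>)) \<le> 2 * (\<epsilon> * L) + \<bar>K\<bar>"
    proof -
      have "2 * \<epsilon> * \<bar>K\<bar> \<le> 1 * \<bar>K\<bar>" using eps by (intro mult_right_mono) auto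
      then show ?thesis by (simp add: algebra_simps)
    qed
    ultimately have eS: "\<epsilon> * S X \<le> 2 * (\<epsilon> * L) + \<bar>K\<bar>" by linarith
    have "S X - L \<le> c * L" using a eS KL eL L0 unfolding left_diff_distrib mult_1_left by linarith
    moreover have "L - S X \<le> c * L" using b eS KL eL L0 unfolding left_diff_distrib distrib_right mult_1_left by linarith
    ultimately show ?case using L0 unfolding S_eq_psum[symmetric] L_def[symmetric] by simp
  qed
qed

end

section \<open>From relative density to weighted sums over primes\<close>

lemma abel_sum_bound:
  fixes u w :: "nat \<Rightarrow> real"
  assumes part: "\<And>N. (\<Sum>m=a..N. u m) \<le> C" and C: "C \<ge> 0"
    and dec: "\<And>m. m \<ge> a \<Longrightarrow> w (Suc m) \<le> w m" and nn: "\<And>m. w m \<ge> 0"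
  shows "(\<Sum>m=a..N. u m * w m) \<le> C * w a"
proof (cases "a \<le> N")
  case True
  then have "(\<Sum>m=a..N. u m * w m) \<le> C * (w a - w N) + (\<Sum>m=a..N. u m) * w N"
  proof (induction N rule: dec_induct)
    case base then show ?case by simp
  next
    case (step k)
    let ?U = "\<Sum>m=a..k. u m"
    have "(\<Sum>m=a..Suc k. u m * w m) = (\<Sum>m=a..k. u m * w m) + u (Suc k) * w (Suc k)" using step by simp
    also have "\<dots> \<le> C * (w a - w k) + ?U * w k + u (Suc k) * w (Suc k)" using step by simp
    also have "\<dots> = C * (w a - w (Suc k)) + (?U + u (Suc k)) * w (Suc k) - (C - ?U) * (w k - w (Suc k))"
      by (simp add: algebra_simps)
    also have "\<dots> \<le> C * (w a - w (Suc k)) + (?U + u (Suc k)) * w (Suc k)"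
      using part[of k] dec[of k] step by simp
    also have "?U + u (Suc k) = (\<Sum>m=a..Suc k. u m)" using step by simp
    finally show ?case .
  qed
  also have "(\<Sum>m=a..N. u m) * w N \<le> C * w N" using part nn by (intro mult_right_mono)
  finally show ?thesis by (simp add: algebra_simps)
next
  case False then show ?thesis using C nn by simp
qed

text \<open>The function \<open>ln t / t\<close> decreases only from \<open>e\<close> on, hence the
  start at 3 and the separate treatment of the prime 2 later.\<close>

lemma ln_over_decreasing:
  assumes "m \<ge> (3::nat)"
  shows "ln (real (Suc m)) / real (Suc m) \<le> ln (real m) / real m"
proof -
  have m: "real m > 0" using assms by simp
  have "ln (real (Suc m)) = ln (real m * (1 + 1 / real m))" using m by (simp add: distrib_left add.commute)
  also have "\<dots> = ln (real m) + ln (1 + 1 / real m)"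
  proof -
    have "1 + 1 / real m > 0" using m by (intro add_pos_pos) auto
    then have "1 + 1 / real m \<noteq> 0" by linarith
    then show ?thesis using m by (subst ln_mult) auto
  qed
  also have "ln (1 + 1 / real m) \<le> 1 / real m" using m by (intro ln_add_one_self_le_self) auto
  finally have 1: "real m * ln (real (Suc m)) \<le> real m * ln (real m) + 1" using m by (simp add: field_simps)
  have "exp 1 \<le> real m" using exp_le assms by linarith
  then have "1 \<le> ln (real m)" using m by (subst ln_ge_iff) auto
  then have "real m * ln (real (Suc m)) \<le> real (Suc m) * ln (real m)" using 1 by (simp add: algebra_simps)
  then show ?thesis using m by (simp add: field_simps del: of_nat_Suc)
qed

lemma monic_irreducibleI:
  fixes f :: "int poly"
  assumes mon: "monic f" and deg: "degree f > 0"
    and fac: "\<And>g h. f = g * h \<Longrightarrow> degree g = 0 \<or> degree h = 0"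
  shows "irreducible f"
proof (rule irreducibleI)
  show "f \<noteq> 0" using deg by auto
  show "\<not> is_unit f" using deg by (auto simp: poly_dvd_1)
  have unit: "is_unit g" if "f = g * h" "degree g = 0" for g h
  proof -
    have "lead_coeff g * lead_coeff h = 1" using mon that(1) by (simp add: lead_coeff_mult)
    then have "is_unit (lead_coeff g)" by (metis dvd_triv_left)
    moreover have "g = [:lead_coeff g:]" using that(2) by (simp add: degree_0_id)
    ultimately show ?thesis by (metis is_unit_const_poly_iff)
  qed
  fix g h assume gh: "f = g * h"
  show "is_unit g \<or> is_unit h" using fac[OF gh] unit[of g h] unit[of h g] gh by (auto simp: mult.commute)
qed

lemma monic_irreducible_X: "monic_irreducible [:0, 1:] 1"
proof
  show "irreducible [:0, 1 :: int:]"
  proof (rule monic_irreducibleI)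
    fix g h :: "int poly" assume gh: "[:0, 1:] = g * h"
    then have "g * h \<noteq> 0" by (metis pCons_eq_0_iff zero_neq_one)
    then have "degree (g * h) = degree g + degree h" by (intro degree_mult_eq) auto
    then have "degree g + degree h = 1" unfolding gh[symmetric] by simp
    then show "degree g = 0 \<or> degree h = 0" by linarith
  qed auto
qed auto

lemma nroots_X: "prime p \<Longrightarrow> nroots [:0, 1:] p = 1"
proof -
  assume "prime p"
  then have "p > 0" by (rule prime_gt_0_nat)
  then have "{r\<in>{0..<int p}. int p dvd poly [:0, 1:] r} = {0}" by (auto dest: zdvd_imp_le)
  then show ?thesis by (simp only: nroots_def card.insert card.empty finite.emptyI) simp
qed

lemma psum_cong: "(\<And>p. prime p \<Longrightarrow> h p = g p) \<Longrightarrow> psum h = psum g"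
  unfolding psum_def by (intro ext sum.cong) auto

text \<open>The case of the polynomial \<open>X\<close>, which has exactly one root modulo every
  prime.\<close>

lemma mertens: "(\<lambda>X. psum (\<lambda>_. 1) X - ln (real X)) \<in> o(\<lambda>X. ln (real X))"
proof -
  have "psum (\<lambda>p. real (nroots [:0, 1:] p)) = psum (\<lambda>_. 1)" by (rule psum_cong) (simp add: nroots_X)
  then show ?thesis using monic_irreducible.prime_root_sum_asymp[OF monic_irreducible_X] by simp
qed

lemma primes_le_subset: "{p::nat. prime p \<and> p \<le> N} \<subseteq> insert 2 {m\<in>{3..N}. prime m}"
proof
  fix p :: nat assume "p \<in> {p. prime p \<and> p \<le> N}"
  then have "prime p" "p \<le> N" by auto
  moreover have "p \<ge> 2" using \<open>prime p\<close> by (rule prime_ge_2_nat)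
  ultimately show "p \<in> insert 2 {m\<in>{3..N}. prime m}" by (cases "p = 2") auto
qed

text \<open>Eventually \<open>T\<close> has at most \<open>\<epsilon>\<close> times as many elements
  up to \<open>N\<close> as there are primes. Partial summation against a decreasing weight carries
  this one-sided comparison over to the weighted sums.\<close>

lemma sparse_prime_sum:
  assumes T: "T \<subseteq> {p::nat. prime p}" and dens: "rel_density_primes ({p. prime p} - T) 1"
  shows "psum (\<lambda>p. of_bool (p \<in> T)) \<in> o(\<lambda>X. ln (real X))"
proof (rule landau_o.smallI)
  fix c :: real assume c: "c > 0"
  define \<epsilon> where "\<epsilon> = c / 4"
  have eps: "\<epsilon> > 0" using c by (simp add: \<epsilon>_def)
  define t where "t = (\<lambda>N. real (card (T \<inter> {1..N})))"
  define \<pi> where "\<pi> = (\<lambda>N. real (card {p::nat. prime p \<and> p \<le> N}))"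
  have split: "real (card (({p. prime p} - T) \<inter> {1..N})) = \<pi> N - t N" for N
  proof -
    have "{p. prime p \<and> p \<le> N} = (({p. prime p} - T) \<inter> {1..N}) \<union> (T \<inter> {1..N})"
      using T by (auto dest: prime_gt_0_nat simp: Suc_le_eq)
    then have "card {p. prime p \<and> p \<le> N} = card (({p. prime p} - T) \<inter> {1..N}) + card (T \<inter> {1..N})"
      by (simp only:) (intro card_Un_disjoint, auto)
    then show ?thesis by (simp add: \<pi>_def t_def)
  qed
  have pi_pos: "\<pi> N > 0" if "N \<ge> 2" for N
  proof -
    have "2 \<in> {p. prime p \<and> p \<le> N}" using that by simp
    then have "card {p. prime p \<and> p \<le> N} > 0" using finite_primes_le[of N] card_gt_0_iff by blast
    then show ?thesis by (simp add: \<pi>_def)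
  qed
  have "(\<lambda>N. (\<pi> N - t N) / \<pi> N) \<longlonglongrightarrow> 1"
    using dens unfolding rel_density_primes_def split \<pi>_def .
  then have "\<forall>\<^sub>F N in sequentially. (\<pi> N - t N) / \<pi> N > 1 - \<epsilon>" using eps by (intro order_tendstoD(1)) auto
  then have "\<forall>\<^sub>F N in sequentially. t N \<le> \<epsilon> * \<pi> N"
    using eventually_ge_at_top[of 2]
  proof eventually_elim
    case (elim N)
    then have "(1 - \<epsilon>) * \<pi> N < \<pi> N - t N" using pi_pos[of N] by (simp add: less_divide_eq)
    then show ?case by (simp add: algebra_simps)
  qed
  then obtain N0 where N0: "\<And>N. N \<ge> N0 \<Longrightarrow> t N \<le> \<epsilon> * \<pi> N" unfolding eventually_sequentially by blast
  \<comment> \<open>The excess of \<open>T\<close> over an \<open>\<epsilon>\<close> share of the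
    primes: its partial sums are bounded above, so its weighted sum is too.\<close>
  define u where "u = (\<lambda>m::nat. of_bool (m \<in> T) - \<epsilon> * of_bool (prime m) :: real)"
  define w where "w = (\<lambda>m::nat. ln (real m) / real m)"
  \<comment> \<open>\<open>N0\<close> covers the range before the comparison holds, and
    \<open>\<epsilon>\<close> the prime 2 missing from sums that start at 3.\<close>
  define C where "C = real N0 + \<epsilon>"
  have wnn: "w m \<ge> 0" for m unfolding w_def by (cases "m = 0") auto
  have part: "(\<Sum>m=3..N. u m) \<le> C" for N
  proof -
    have tt: "(\<Sum>m=3..N. of_bool (m \<in> T) :: real) \<le> t N"
    proof -
      have "(\<Sum>m=3..N. of_bool (m \<in> T) :: real) = real (card {m\<in>{3..N}. m \<in> T})" by (rule sum_of_bool_card) simp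
      also have "card {m\<in>{3..N}. m \<in> T} \<le> card (T \<inter> {1..N})" by (intro card_mono) auto
      finally show ?thesis by (simp add: t_def)
    qed
    have pp: "\<pi> N - 1 \<le> (\<Sum>m=3..N. of_bool (prime m) :: real)"
    proof -
      have "card {p. prime p \<and> p \<le> N} \<le> card (insert 2 {m\<in>{3..N}. prime m})" by (intro card_mono primes_le_subset) auto
      also have "\<dots> \<le> Suc (card {m\<in>{3..N}. prime m})" by (rule card_insert_le_m1) auto
      finally have "\<pi> N \<le> 1 + real (card {m\<in>{3..N}. prime m})" by (simp add: \<pi>_def)
      moreover have "(\<Sum>m=3..N. of_bool (prime m) :: real) = real (card {m\<in>{3..N}. prime m})" by (rule sum_of_bool_card) simp
      ultimately show ?thesis by simp
    qed
    have su: "(\<Sum>m=3..N. u m) = (\<Sum>m=3..N. of_bool (m \<in> T)) - \<epsilon> * (\<Sum>m=3..N. of_bool (prime m))"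
      unfolding u_def sum_subtractf sum_distrib_left ..
    show ?thesis
    proof (cases "N \<ge> N0")
      case True
      have "\<epsilon> * (\<pi> N - 1) \<le> \<epsilon> * (\<Sum>m=3..N. of_bool (prime m))" using pp eps by (intro mult_left_mono) auto
      then have "(\<Sum>m=3..N. u m) \<le> \<epsilon>" using su tt N0[OF True] by (simp add: right_diff_distrib)
      then show ?thesis by (simp add: C_def)
    next
      case False
      have "0 \<le> \<epsilon> * (\<Sum>m=3..N. of_bool (prime m))" using eps by (intro mult_nonneg_nonneg sum_nonneg) auto
      moreover have "t N \<le> real N"
      proof -
        have "card (T \<inter> {1..N}) \<le> card {1..N}" by (intro card_mono) auto
        then show ?thesis by (simp add: t_def)
      qed
      ultimately have "(\<Sum>m=3..N. u m) \<le> real N" using su tt by linarith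
      also have "\<dots> \<le> real N0" using False by simp
      finally show ?thesis using eps by (simp add: C_def)
    qed
  qed
  have abel: "(\<Sum>m=3..X. u m * w m) \<le> C * w 3" for X
  proof (rule abel_sum_bound[OF part])
    show "C \<ge> 0" using eps by (simp add: C_def)
    show "w (Suc m) \<le> w m" if "m \<ge> 3" for m unfolding w_def by (rule ln_over_decreasing[OF that])
  qed (rule wnn)
  have bound: "psum (\<lambda>p. of_bool (p \<in> T)) X \<le> \<epsilon> * psum (\<lambda>_. 1) X + (C * w 3 + w 2)" for X
  proof -
    have "psum (\<lambda>p. of_bool (p \<in> T)) X \<le> (\<Sum>m\<in>insert 2 {3..X}. of_bool (m \<in> T) * w m)"
    proof -
      have "psum (\<lambda>p. of_bool (p \<in> T)) X = (\<Sum>p | prime p \<and> p \<le> X. of_bool (p \<in> T) * w p)" by (simp add: psum_def w_def)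
      also have "\<dots> \<le> (\<Sum>m\<in>insert 2 {3..X}. of_bool (m \<in> T) * w m)"
        using wnn primes_le_subset[of X] by (intro sum_mono2) auto
      finally show ?thesis .
    qed
    also have "\<dots> = of_bool (2 \<in> T) * w 2 + (\<Sum>m=3..X. of_bool (m \<in> T) * w m)" by simp
    also have "of_bool (2 \<in> T) * w 2 \<le> w 2" using wnn[of 2] by (simp add: of_bool_def)
    also have "(\<Sum>m=3..X. of_bool (m \<in> T) * w m) = (\<Sum>m=3..X. u m * w m) + \<epsilon> * (\<Sum>m=3..X. of_bool (prime m) * w m)"
      unfolding sum_distrib_left sum.distrib[symmetric] by (intro sum.cong refl) (simp add: u_def algebra_simps)
    also have "(\<Sum>m=3..X. of_bool (prime m) * w m) \<le> psum (\<lambda>_. 1) X"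
    proof -
      have "(\<Sum>m=3..X. of_bool (prime m) * w m) = (\<Sum>m\<in>{m\<in>{3..X}. prime m}. w m)"
        by (rule sum.mono_neutral_cong_right) auto
      also have "\<dots> \<le> (\<Sum>p | prime p \<and> p \<le> X. w p)" using wnn by (intro sum_mono2) auto
      finally show ?thesis by (simp add: psum_def w_def)
    qed
    finally show ?thesis using abel[of X] eps by (simp add: mult_left_mono)
  qed
  have "filterlim (\<lambda>X. ln (real X)) at_top sequentially" by real_asymp
  then have "\<forall>\<^sub>F X in sequentially. ln (real X) \<ge> (C * w 3 + w 2) / (c / 2)" unfolding filterlim_at_top by blast
  moreover have "\<forall>\<^sub>F X in sequentially. norm (psum (\<lambda>_. 1) X - ln (real X)) \<le> 1 * norm (ln (real X))"
    using landau_o.smallD[OF mertens, of 1] by simp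
  ultimately show "\<forall>\<^sub>F X in sequentially. norm (psum (\<lambda>p. of_bool (p \<in> T)) X) \<le> c * norm (ln (real X))"
    using eventually_ge_at_top[of 1]
  proof eventually_elim
    case (elim X)
    have L0: "ln (real X) \<ge> 0" using elim by simp
    have nn: "psum (\<lambda>p. of_bool (p \<in> T)) X \<ge> 0" unfolding psum_def by (intro sum_nonneg) (auto simp: prime_gt_0_nat Suc_le_eq)
    have "psum (\<lambda>_. 1) X \<le> 2 * ln (real X)" using elim(2) L0 by (simp add: abs_le_iff)
    then have "\<epsilon> * psum (\<lambda>_. 1) X \<le> \<epsilon> * (2 * ln (real X))" using eps by (intro mult_left_mono) auto
    also have "\<dots> = c / 2 * ln (real X)" by (simp add: \<epsilon>_def)
    finally have "\<epsilon> * psum (\<lambda>_. 1) X \<le> c / 2 * ln (real X)" .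
    moreover have "C * w 3 + w 2 \<le> c / 2 * ln (real X)" using elim(1) c by (simp add: divide_le_eq mult.commute)
    ultimately have "psum (\<lambda>p. of_bool (p \<in> T)) X \<le> c * ln (real X)" using bound[of X] by (simp add: field_simps)
    then show ?case using nn L0 by simp
  qed
qed

section \<open>Power residues and the polynomials X ^ q - a\<close>

lemma card_linear_congruence:
  fixes q m t :: nat
  assumes q: "prime q" and m: "m > 0"
  shows "card {j. j < m \<and> [q * j = t] (mod m)} = (if q dvd m then if q dvd t then q else 0 else 1)"
proof (cases "q dvd m")
  case True
  then obtain m' where m': "m = q * m'" by blast
  have q0: "q > 0" using q by (rule prime_gt_0_nat)
  have m'0: "m' > 0" using m m' by (cases m') auto
  show ?thesis
  proof (cases "q dvd t")
    case False
    have "\<not> [q * j = t] (mod m)" for j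
    proof
      assume "[q * j = t] (mod m)"
      then have "[q * j = t] (mod q)" using True by (rule cong_dvd_modulus_nat)
      then have "[t = 0] (mod q)" by (simp add: cong_def)
      then show False using False by (simp add: cong_0_iff)
    qed
    then show ?thesis using True False by simp
  next
    case qt: True
    then obtain t' where t': "t = q * t'" by blast
    have iff: "[q * j = t] (mod m) \<longleftrightarrow> [j = t'] (mod m')" for j
      unfolding m' t' cong_def using q0 by (simp add: mult_mod_right[symmetric])
    have "{j. j < m \<and> [q * j = t] (mod m)} = (\<lambda>i. t' mod m' + m' * i) ` {..<q}"
    proof (intro equalityI subsetI)
      fix j assume "j \<in> {j. j < m \<and> [q * j = t] (mod m)}"
      then have j: "j < q * m'" "j mod m' = t' mod m'" using iff by (auto simp: m' cong_def)
      have "j = t' mod m' + m' * (j div m')" using mod_mult_div_eq[of j m'] j(2) by simp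
      moreover have "j div m' < q" using j(1) m'0 by (simp add: div_less_iff_less_mult)
      ultimately show "j \<in> (\<lambda>i. t' mod m' + m' * i) ` {..<q}" by blast
    next
      fix j assume "j \<in> (\<lambda>i. t' mod m' + m' * i) ` {..<q}"
      then obtain i where i: "i < q" "j = t' mod m' + m' * i" by blast
      have "j < m' * (i + 1)" using m'0 i(2) by simp
      also have "\<dots> \<le> m' * q" using i(1) by (intro mult_left_mono) auto
      finally have "j < m" by (simp add: m' mult.commute)
      moreover have "[j = t'] (mod m')" by (simp add: i(2) cong_def)
      ultimately show "j \<in> {j. j < m \<and> [q * j = t] (mod m)}" using iff by simp
    qed
    moreover have "inj_on (\<lambda>i. t' mod m' + m' * i) {..<q}" using m'0 by (auto simp: inj_on_def)
    ultimately have "card {j. j < m \<and> [q * j = t] (mod m)} = q" by (simp add: card_image)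
    then show ?thesis using True qt by simp
  qed
next
  case False
  then have cop: "coprime q m" using q by (simp add: prime_imp_coprime)
  obtain y where y: "[q * y = 1] (mod m)" using cong_solve_coprime_nat[OF cop] by auto
  have "[q * (y * t) = 1 * t] (mod m)" using cong_scalar_right[OF y, of t] by (simp add: mult.assoc)
  then have "[q * (y * t mod m) = t] (mod m)" by (simp add: cong_def mod_mult_right_eq)
  moreover have "j = y * t mod m" if "j < m" "[q * j = t] (mod m)" for j
  proof -
    have "[q * j = q * (y * t mod m)] (mod m)" using that(2) \<open>[q * (y * t mod m) = t] (mod m)\<close> by (metis cong_trans cong_sym)
    then have "[j = y * t mod m] (mod m)" using cop by (simp add: cong_mult_lcancel_nat)
    then show ?thesis using that(1) m by (simp add: cong_def)
  qed
  ultimately have "{j. j < m \<and> [q * j = t] (mod m)} = {y * t mod m}" using m by auto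
  then show ?thesis using False by simp
qed

text \<open>\<open>ind\<close> is the discrete logarithm to a primitive root \<open>g\<close>; it
  turns questions about powers into linear congruences modulo \<open>p - 1\<close>.\<close>

lemma exists_index:
  assumes p: "prime (p::nat)"
  obtains g :: int and ind :: "int \<Rightarrow> nat" where
    "\<And>a. \<not> int p dvd a \<Longrightarrow> [a = g ^ ind a] (mod int p)"
    "\<And>i j. [g ^ i = g ^ j] (mod int p) \<longleftrightarrow> [i = j] (mod (p - 1))"
    "\<not> int p dvd g"
proof -
  have p1: "p > 1" using p by (rule prime_gt_1_nat)
  obtain g where g: "residue_primroot p g" using prime_primitive_root_exists[of p] p p1 by auto
  have tot: "totient p = p - 1" using p by (rule totient_prime)
  have bij: "bij_betw (\<lambda>i. g ^ i mod p) {..<p - 1} (totatives p)"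
    using residue_primroot_is_generator[OF p1 g] by (simp only: tot)
  have "\<exists>i. [a = int g ^ i] (mod int p)" if a: "\<not> int p dvd a" for a
  proof -
    define b where "b = nat (a mod int p)"
    have b: "int b = a mod int p" using p1 by (simp add: b_def)
    have "\<not> p dvd b"
    proof
      assume "p dvd b"
      then have "int p dvd a mod int p" unfolding b[symmetric] by (simp only: of_nat_dvd_iff)
      then show False using a by (simp add: dvd_mod_iff)
    qed
    moreover have "int b < int p" unfolding b using p1 by simp
    ultimately have "b \<in> totatives p" using p
      by (auto simp: totatives_def intro: prime_imp_coprime[THEN coprime_commute[THEN iffD1]] gr0I)
    then have "b \<in> (\<lambda>i. g ^ i mod p) ` {..<p - 1}" using bij unfolding bij_betw_def by blast
    then obtain i where "g ^ i mod p = b" by blast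
    then have "int (g ^ i mod p) = a mod int p" using b by simp
    then have "[a = int g ^ i] (mod int p)" by (simp add: cong_def zmod_int)
    then show ?thesis by blast
  qed
  then obtain ind where ind: "\<And>a. \<not> int p dvd a \<Longrightarrow> [a = int g ^ ind a] (mod int p)" by metis
  have cop: "coprime p g" "ord p g = p - 1" using g tot by (auto simp: residue_primroot_def)
  have "[int g ^ i = int g ^ j] (mod int p) \<longleftrightarrow> [i = j] (mod (p - 1))" for i j
    using order_divides_expdiff[OF cop(1), of i j] cop(2) cong_int_iff[of "g ^ i" "g ^ j" p] by simp
  moreover have "\<not> int p dvd int g"
  proof
    assume "int p dvd int g"
    then have "p dvd g" by (simp only: of_nat_dvd_iff)
    then have "is_unit p" using coprime_absorb_left cop(1) by blast
    then show False using p1 by simp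
  qed
  ultimately show thesis using that ind by blast
qed

definition Xq :: "nat \<Rightarrow> int \<Rightarrow> int poly" where "Xq q a = monom 1 q - [:a:]"

lemma poly_Xq: "poly (Xq q a) y = y ^ q - a"
  by (simp add: Xq_def poly_monom)

lemma degree_Xq: "q > 0 \<Longrightarrow> degree (Xq q a) = q" and monic_Xq: "q > 0 \<Longrightarrow> monic (Xq q a)"
proof -
  assume q: "q > 0"
  have "degree (Xq q a) = degree (monom (1::int) q)"
    unfolding Xq_def diff_conv_add_uminus using q by (intro degree_add_eq_left) (simp add: degree_monom_eq)
  then show d: "degree (Xq q a) = q" by (simp add: degree_monom_eq)
  show "monic (Xq q a)" unfolding d using q by (simp add: Xq_def coeff_pCons split: nat.splits)
qed

text \<open>Bezout in the form \<open>d * u = q * v + 1\<close> makes \<open>a\<close> times a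
  \<open>q\<close>-th power equal to a \<open>q\<close>-th power; divisibility of
  \<open>q\<close>-th powers descends to their bases.\<close>

lemma power_root_if_coprime:
  fixes a c :: int
  assumes "a \<noteq> 0" "a ^ d = c ^ q" "coprime d q" "q > 1"
  shows "\<exists>y. a = y ^ q"
proof -
  obtain u v where uv: "d * u = q * v + 1" using coprime_bezout_strong[of d q] assms by auto
  have "a * (a ^ v) ^ q = a ^ (d * u)" by (simp add: uv power_mult[symmetric] mult.commute)
  also have "\<dots> = (c ^ u) ^ q" by (metis assms(2) mult.commute power_mult)
  finally have eq: "a * (a ^ v) ^ q = (c ^ u) ^ q" .
  then have "(a ^ v) ^ q dvd (c ^ u) ^ q" by (metis dvd_triv_right)
  then have "a ^ v dvd c ^ u" using assms(4) by simp
  then obtain y where y: "c ^ u = a ^ v * y" by blast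
  have "a * (a ^ v) ^ q = y ^ q * (a ^ v) ^ q" using eq unfolding y by (simp add: power_mult_distrib mult.commute)
  then have "a = y ^ q" using assms(1) by simp
  then show ?thesis by blast
qed

text \<open>The constant coefficient of a factor of degree \<open>d\<close> is, up to sign, a
  product of \<open>d\<close> roots, so its \<open>q\<close>-th power is \<open>a ^ d\<close> up to
  sign. For \<open>0 < d < q\<close> the exponent \<open>d\<close> is prime to \<open>q\<close>, and
  \<open>a\<close> itself would be a \<open>q\<close>-th power.\<close>

lemma irreducible_Xq:
  assumes q: "prime q" and a: "a \<noteq> 0" and np: "\<And>y. a \<noteq> y ^ q"
  shows "irreducible (Xq q a)"
proof (rule monic_irreducibleI)
  have q0: "q > 0" and q1: "q > 1" using q prime_gt_0_nat prime_gt_1_nat by auto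
  show "monic (Xq q a)" by (rule monic_Xq[OF q0])
  show "degree (Xq q a) > 0" using q0 by (simp add: degree_Xq)
  fix g h assume gh: "Xq q a = g * h"
  have gh0: "g \<noteq> 0" "h \<noteq> 0" using gh monic_Xq[OF q0, of a] by auto
  have degs: "degree g + degree h = q" using degree_Xq[OF q0, of a] unfolding gh by (simp add: degree_mult_eq gh0)
  show "degree g = 0 \<or> degree h = 0"
  proof (rule ccontr)
    assume "\<not> ?thesis"
    then have d: "0 < degree g" "degree g < q" using degs by auto
    have lc: "lead_coeff g * lead_coeff h = 1" using monic_Xq[OF q0, of a] unfolding gh by (simp add: lead_coeff_mult)
    then have lg: "lead_coeff g * lead_coeff g = 1" by (auto simp: zmult_eq_1_iff)
    define gc where "gc = (of_int_poly g :: complex poly)"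
    obtain A where A: "size A = degree gc" "gc = smult (lead_coeff gc) (\<Prod>x\<in>#A. [:- x, 1:])"
      using alg_closed_imp_factorization[of gc] gh0 by (auto simp: gc_def)
    have rootA: "z ^ q = of_int a" if "z \<in># A" for z
    proof -
      have "poly gc z = 0" by (subst A(2)) (use that in \<open>auto simp: poly_prod_mset prod_mset_zero_iff\<close>)
      then have "poly (of_int_poly (Xq q a)) z = 0" unfolding gh gc_def by (simp add: of_int_poly_hom.hom_mult)
      moreover have "poly (of_int_poly (Xq q a)) z = z ^ q - of_int a"
        unfolding Xq_def by (simp add: of_int_poly_hom.hom_minus poly_monom ceval_const)
      ultimately show ?thesis by simp
    qed
    define c where "c = poly g 0"
    have c: "(of_int c :: complex) = of_int (lead_coeff g) * (\<Prod>x\<in>#A. - x)"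
    proof -
      have "(of_int c :: complex) = poly gc (of_int 0)" by (simp only: c_def gc_def of_int_hom.poly_map_poly)
      also have "\<dots> = lead_coeff gc * (\<Prod>x\<in>#A. - x)" by (subst A(2)) (simp add: poly_prod_mset image_mset.compositionality o_def)
      also have "lead_coeff gc = of_int (lead_coeff g)" by (simp add: gc_def)
      finally show ?thesis .
    qed
    have prodq: "(\<Prod>x\<in>#A. - x) ^ q = ((- 1) ^ q * of_int a) ^ degree g"
    proof -
      have "(\<Prod>x\<in>#M. h x) ^ q = (\<Prod>x\<in>#M. h x ^ q)" for M and h :: "complex \<Rightarrow> complex"
        by (induction M) (simp_all add: power_mult_distrib)
      then have "(\<Prod>x\<in>#A. - x) ^ q = (\<Prod>x\<in>#A. (- x) ^ q)" .
      also have "\<dots> = (\<Prod>x\<in>#A. (- 1) ^ q * of_int a)"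
      proof (rule arg_cong[of _ _ prod_mset], rule image_mset_cong)
        fix x assume "x \<in># A"
        then show "(- x) ^ q = (- 1) ^ q * of_int a" using rootA[of x] power_minus[of x q] by simp
      qed
      also have "\<dots> = ((- 1) ^ q * of_int a) ^ size A" by (induction A) simp_all
      also have "size A = degree g" using A(1) by (simp add: gc_def)
      finally show ?thesis .
    qed
    \<comment> \<open>A sign collecting the leading coefficient and the signs of the roots; since
      \<open>s * s = 1\<close>, it can be moved into the base, and even and odd \<open>q\<close>
      need no distinction.\<close>
    define s where "s = lead_coeff g * (- 1) ^ degree g"
    have "(of_int (c ^ q) :: complex) = of_int (lead_coeff g ^ q * ((- 1) ^ q * a) ^ degree g)"
      using prodq by (simp add: c power_mult_distrib)
    then have cq: "c ^ q = lead_coeff g ^ q * ((- 1) ^ q * a) ^ degree g" by (simp only: of_int_eq_iff)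
    have "((- 1 :: int) ^ degree g) * ((- 1) ^ degree g) = 1" by (simp flip: power_mult_distrib)
    then have ss: "s * s = 1" unfolding s_def using lg by (simp add: mult_ac)
    have "c ^ q = s ^ q * a ^ degree g" unfolding cq s_def
      by (simp add: power_mult_distrib power_mult[symmetric] mult.commute)
    then have "(s * c) ^ q = (s * s) ^ q * a ^ degree g" by (simp add: power_mult_distrib)
    then have "a ^ degree g = (s * c) ^ q" using ss by simp
    moreover have "coprime (degree g) q"
      using d q by (metis coprime_commute nat_dvd_not_less prime_imp_coprime_nat)
    ultimately show False using power_root_if_coprime[OF a _ _ q1] np by blast
  qed
qed

text \<open>In terms of \<open>r = g ^ j\<close> the equation becomes \<open>q * j = ind a\<close>
  modulo \<open>p - 1\<close>, which is counted by \<open>card_linear_congruence\<close>.\<close>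

lemma nroots_Xq:
  assumes p: "prime p" and q: "prime q" and a: "\<not> int p dvd a"
    and g: "\<And>a. \<not> int p dvd a \<Longrightarrow> [a = g ^ ind a] (mod int p)"
      "\<And>i j. [g ^ i = g ^ j] (mod int p) \<longleftrightarrow> [i = j] (mod (p - 1))" "\<not> int p dvd g"
  shows "nroots (Xq q a) p = (if q dvd p - 1 then if q dvd ind a then q else 0 else 1)"
proof -
  have p1: "p > 1" using p by (rule prime_gt_1_nat)
  have ip: "prime (int p)" using p by simp
  let ?J = "{j. j < p - 1 \<and> [q * j = ind a] (mod (p - 1))}"
  let ?R = "{r\<in>{0..<int p}. int p dvd poly (Xq q a) r}"
  have "bij_betw (\<lambda>j. g ^ j mod int p) ?J ?R"
    unfolding bij_betw_def
  proof
    show "inj_on (\<lambda>j. g ^ j mod int p) ?J"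
    proof (rule inj_onI)
      fix i j assume "i \<in> ?J" "j \<in> ?J" "g ^ i mod int p = g ^ j mod int p"
      then show "i = j" using g(2)[of i j] by (simp add: cong_def)
    qed
    show "(\<lambda>j. g ^ j mod int p) ` ?J = ?R"
    proof (intro equalityI subsetI)
      fix r assume "r \<in> (\<lambda>j. g ^ j mod int p) ` ?J"
      then obtain j where j: "[q * j = ind a] (mod (p - 1))" "r = g ^ j mod int p" by blast
      have "[r ^ q = (g ^ j) ^ q] (mod int p)" by (intro cong_pow) (simp add: j(2))
      also have "(g ^ j) ^ q = g ^ (q * j)" by (simp add: power_mult[symmetric] mult.commute)
      also have "[g ^ (q * j) = g ^ ind a] (mod int p)" using g(2) j(1) by blast
      also have "[g ^ ind a = a] (mod int p)" using g(1)[OF a] by (rule cong_sym)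
      finally have "int p dvd r ^ q - a" by (simp add: cong_iff_dvd_diff)
      moreover have "r \<in> {0..<int p}" using p1 by (simp add: j(2))
      ultimately show "r \<in> ?R" by (simp add: poly_Xq)
    next
      fix r assume r: "r \<in> ?R"
      then have ra: "[r ^ q = a] (mod int p)" by (simp add: poly_Xq cong_iff_dvd_diff)
      have "\<not> int p dvd r"
      proof
        assume "int p dvd r"
        then have "int p dvd r ^ q" using prime_gt_0_nat[OF q] by (meson dvd_power dvd_trans)
        then show False using a cong_dvd_iff[OF ra] by blast
      qed
      then have ri: "[r = g ^ ind r] (mod int p)" by (rule g(1))
      define j where "j = ind r mod (p - 1)"
      have "[g ^ j = g ^ ind r] (mod int p)" using g(2)[of j "ind r"] by (simp add: j_def cong_def)
      then have rj: "[r = g ^ j] (mod int p)" using ri by (metis cong_trans cong_sym)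
      then have "r = g ^ j mod int p" using r p1 by (simp add: cong_def)
      moreover have "[g ^ (q * j) = g ^ ind a] (mod int p)"
      proof -
        have "[(g ^ j) ^ q = r ^ q] (mod int p)" by (intro cong_pow cong_sym[OF rj])
        then have "[g ^ (q * j) = r ^ q] (mod int p)" by (simp add: power_mult[symmetric] mult.commute)
        then show ?thesis using ra g(1)[OF a] by (metis cong_trans)
      qed
      then have "[q * j = ind a] (mod (p - 1))" using g(2) by blast
      moreover have "j < p - 1" using p1 by (simp add: j_def)
      ultimately show "r \<in> (\<lambda>j. g ^ j mod int p) ` ?J" by blast
    qed
  qed
  then have "nroots (Xq q a) p = card ?J" unfolding nroots_def by (rule bij_betw_same_card[symmetric])
  then show ?thesis using card_linear_congruence[OF q, of "p - 1" "ind a"] p1 by simp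
qed

lemma qth_power_iff_index:
  assumes p: "prime p" and q: "prime q" and a: "\<not> int p dvd a" and qp: "q dvd p - 1"
    and g: "\<And>a. \<not> int p dvd a \<Longrightarrow> [a = g ^ ind a] (mod int p)"
      "\<And>i j. [g ^ i = g ^ j] (mod int p) \<longleftrightarrow> [i = j] (mod (p - 1))" "\<not> int p dvd g"
  shows "is_qth_power_mod q a p \<longleftrightarrow> q dvd ind a"
proof
  assume "is_qth_power_mod q a p"
  then obtain x where x: "[a = x ^ q] (mod int p)" by (auto simp: is_qth_power_mod_def)
  have "\<not> int p dvd x"
  proof
    assume "int p dvd x"
    then have "int p dvd x ^ q" using prime_gt_0_nat[OF q] by (meson dvd_power dvd_trans)
    then show False using a cong_dvd_iff[OF x] by blast
  qed
  then have "[x ^ q = (g ^ ind x) ^ q] (mod int p)" by (intro cong_pow g(1))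
  then have "[g ^ (q * ind x) = g ^ ind a] (mod int p)"
    using x g(1)[OF a] by (simp add: power_mult[symmetric] mult.commute) (metis cong_trans cong_sym)
  then have "[q * ind x = ind a] (mod (p - 1))" using g(2) by blast
  then have "[q * ind x = ind a] (mod q)" using qp by (rule cong_dvd_modulus_nat)
  then show "q dvd ind a" by (metis cong_dvd_iff dvd_triv_left cong_def mod_mod_trivial)
next
  assume "q dvd ind a"
  then obtain t where "ind a = q * t" by blast
  then have "[a = (g ^ t) ^ q] (mod int p)" using g(1)[OF a] by (simp add: power_mult[symmetric] mult.commute)
  then show "is_qth_power_mod q a p" by (auto simp: is_qth_power_mod_def)
qed

section \<open>Independence modulo powers\<close>

lemma root_of_unity_sum:
  fixes q t :: nat
  assumes "q \<ge> 1"
  defines "\<zeta> \<equiv> exp (2 * of_real pi * \<i> / of_nat q)"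
  shows "(\<Sum>u<q. \<zeta> ^ (u * t)) = (if q dvd t then of_nat q else 0)"
proof -
  have pow: "\<zeta> ^ j = exp (2 * of_real pi * \<i> * of_nat j / of_nat q)" for j
    unfolding \<zeta>_def by (subst exp_of_nat_mult[symmetric]) (simp add: mult_ac)
  have one: "\<zeta> ^ j = 1 \<longleftrightarrow> q dvd j" for j unfolding pow by (rule complex_root_unity_eq_1[OF assms(1)])
  have eq: "\<zeta> ^ (u * t) = (\<zeta> ^ t) ^ u" for u by (simp add: power_mult[symmetric] mult.commute)
  show ?thesis
  proof (cases "q dvd t")
    case True
    then have "\<zeta> ^ t = 1" using one by blast
    then show ?thesis using True by (simp add: eq)
  next
    case False
    then have ne: "\<zeta> ^ t \<noteq> 1" using one by blast
    have "(\<zeta> ^ t) ^ q = 1" using one[of "q * t"] by (simp add: power_mult[symmetric] mult.commute)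
    then show ?thesis using False ne by (simp add: eq geometric_sum)
  qed
qed

text \<open>
  For \<open>0 < s < q\<close> the product over \<open>a\<close> of \<open>q - (\<Sum>u<q. \<zeta> ^ (s * u * x a))\<close> is \<open>q ^ card A\<close> if no \<open>x a\<close> is
  divisible by \<open>q\<close> and vanishes otherwise; expand it and sum over \<open>s\<close>.
\<close>

lemma character_identity:
  fixes q :: nat and A :: "'a set" and x :: "'a \<Rightarrow> nat"
  assumes q: "prime q" and A: "finite A"
  shows "(\<Sum>w\<in>Pi\<^sub>E A (\<lambda>_. {..<q}). (\<Prod>a\<in>A. if w a = 0 then real q - 1 else - 1) * ((if q dvd (\<Sum>a\<in>A. w a * x a) then real q else 0) - 1))
    = (real q - 1) * real q ^ card A * of_bool (\<forall>a\<in>A. \<not> q dvd x a)"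
proof -
  define \<zeta> where "\<zeta> = exp (2 * of_real pi * \<i> / of_nat q)"
  have q1: "q \<ge> 1" using prime_gt_0_nat[OF q] by simp
  have rs: "(\<Sum>u<q. \<zeta> ^ (u * t)) = (if q dvd t then of_nat q else 0)" for t
    unfolding \<zeta>_def by (rule root_of_unity_sum[OF q1])
  define c where "c = (\<lambda>u::nat. if u = 0 then of_nat q - 1 else - 1 :: complex)"
  have split0: "(\<Sum>u<q. h u) = h 0 + (\<Sum>u=1..<q. h u)" for h :: "nat \<Rightarrow> complex"
    using q1 by (simp add: lessThan_atLeast0 sum.atLeast_Suc_lessThan)
  have tail: "(\<Sum>s=1..<q. \<zeta> ^ (s * t)) = (if q dvd t then of_nat q else 0) - 1" for t
  proof -
    have "(if q dvd t then of_nat q else 0) = 1 + (\<Sum>s=1..<q. \<zeta> ^ (s * t))"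
      unfolding rs[symmetric] using split0[of "\<lambda>s. \<zeta> ^ (s * t)"] by simp
    then show ?thesis by (simp only: add_diff_cancel_left')
  qed
  have inner: "(\<Sum>u<q. c u * \<zeta> ^ (u * t)) = of_nat q * of_bool (\<not> q dvd t)" for t
  proof -
    have "(\<Sum>u<q. c u * \<zeta> ^ (u * t)) = of_nat q - 1 - (\<Sum>u=1..<q. \<zeta> ^ (u * t))"
      using split0[of "\<lambda>u. c u * \<zeta> ^ (u * t)"] by (simp add: c_def sum_negf)
    then show ?thesis unfolding tail by simp
  qed
  let ?W = "Pi\<^sub>E A (\<lambda>_. {..<q})"
  have "(\<Sum>w\<in>?W. (\<Prod>a\<in>A. c (w a)) * ((if q dvd (\<Sum>a\<in>A. w a * x a) then of_nat q else 0) - 1))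
    = (\<Sum>w\<in>?W. (\<Prod>a\<in>A. c (w a)) * (\<Sum>s=1..<q. \<zeta> ^ (s * (\<Sum>a\<in>A. w a * x a))))"
    by (simp only: tail)
  also have "\<dots> = (\<Sum>w\<in>?W. \<Sum>s=1..<q. \<Prod>a\<in>A. c (w a) * \<zeta> ^ (w a * (s * x a)))"
  proof (rule sum.cong[OF refl])
    fix w
    have "\<zeta> ^ (s * (\<Sum>a\<in>A. w a * x a)) = (\<Prod>a\<in>A. \<zeta> ^ (w a * (s * x a)))" for s
      by (simp add: sum_distrib_left power_sum mult_ac)
    then show "(\<Prod>a\<in>A. c (w a)) * (\<Sum>s=1..<q. \<zeta> ^ (s * (\<Sum>a\<in>A. w a * x a))) = (\<Sum>s=1..<q. \<Prod>a\<in>A. c (w a) * \<zeta> ^ (w a * (s * x a)))"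
      by (simp add: sum_distrib_left prod.distrib)
  qed
  also have "\<dots> = (\<Sum>s=1..<q. \<Sum>w\<in>?W. \<Prod>a\<in>A. c (w a) * \<zeta> ^ (w a * (s * x a)))" by (rule sum.swap)
  also have "\<dots> = (\<Sum>s=1..<q. \<Prod>a\<in>A. \<Sum>u<q. c u * \<zeta> ^ (u * (s * x a)))"
    using A by (intro sum.cong refl prod_sum_PiE[symmetric]) auto
  also have "\<dots> = (\<Sum>s=1..<q. \<Prod>a\<in>A. of_nat q * of_bool (\<not> q dvd x a))"
  proof (intro sum.cong refl prod.cong)
    fix s a assume s: "s \<in> {1..<q}"
    have "\<not> q dvd s" using s by (auto dest: dvd_imp_le)
    then have "q dvd s * x a \<longleftrightarrow> q dvd x a" using q by (simp add: prime_dvd_mult_iff)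
    then show "(\<Sum>u<q. c u * \<zeta> ^ (u * (s * x a))) = of_nat q * of_bool (\<not> q dvd x a)" unfolding inner by simp
  qed
  also have "\<dots> = (of_nat q - 1) * (\<Prod>a\<in>A. of_nat q * of_bool (\<not> q dvd x a))" using q1 by (simp add: of_nat_diff)
  also have "(\<Prod>a\<in>A. of_nat q * of_bool (\<not> q dvd x a)) = (of_nat q ^ card A * of_bool (\<forall>a\<in>A. \<not> q dvd x a) :: complex)"
  proof (cases "\<forall>a\<in>A. \<not> q dvd x a")
    case True then show ?thesis by simp
  next
    case False
    then have "\<exists>a\<in>A. of_nat q * of_bool (\<not> q dvd x a) = (0 :: complex)" by auto
    then have "(\<Prod>a\<in>A. of_nat q * of_bool (\<not> q dvd x a)) = (0 :: complex)" using A by (simp add: prod_zero)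
    then show ?thesis using False by simp
  qed
  finally have cx: "(\<Sum>w\<in>?W. (\<Prod>a\<in>A. c (w a)) * ((if q dvd (\<Sum>a\<in>A. w a * x a) then of_nat q else 0) - 1))
    = (of_nat q - 1) * (of_nat q ^ card A * of_bool (\<forall>a\<in>A. \<not> q dvd x a))" .
  have "complex_of_real (\<Sum>w\<in>?W. (\<Prod>a\<in>A. if w a = 0 then real q - 1 else - 1) * ((if q dvd (\<Sum>a\<in>A. w a * x a) then real q else 0) - 1))
    = (\<Sum>w\<in>?W. (\<Prod>a\<in>A. c (w a)) * ((if q dvd (\<Sum>a\<in>A. w a * x a) then of_nat q else 0) - 1))"
    unfolding of_real_sum of_real_mult of_real_prod
    by (intro sum.cong refl arg_cong2[of _ _ _ _ "(*)"] prod.cong) (auto simp: c_def)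
  also have "\<dots> = complex_of_real ((real q - 1) * real q ^ card A * of_bool (\<forall>a\<in>A. \<not> q dvd x a))"
    unfolding cx by (simp add: mult.assoc)
  finally show ?thesis by (simp only: of_real_eq_iff)
qed

lemma psum_sum: "psum (\<lambda>p. \<Sum>w\<in>V. c w * h w p) X = (\<Sum>w\<in>V. c w * psum (h w) X)"
proof -
  have "psum (\<lambda>p. \<Sum>w\<in>V. c w * h w p) X = (\<Sum>p | prime p \<and> p \<le> X. \<Sum>w\<in>V. c w * (h w p * (ln (real p) / real p)))"
    unfolding psum_def sum_distrib_right by (simp add: mult.assoc)
  also have "\<dots> = (\<Sum>w\<in>V. \<Sum>p | prime p \<and> p \<le> X. c w * (h w p * (ln (real p) / real p)))" by (rule sum.swap)
  finally show ?thesis by (simp add: psum_def sum_distrib_left)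
qed

text \<open>Finitely many exceptional primes cost a constant, which disappears in
  \<open>o(ln X)\<close>.\<close>

lemma psum_mono_except:
  assumes "\<And>p. prime p \<Longrightarrow> p > P \<Longrightarrow> h p \<le> g p" and "\<And>p. g p \<ge> 0"
  shows "psum h X \<le> psum g X + (\<Sum>p\<le>P. \<bar>h p\<bar> * (ln (real p) / real p))"
proof -
  let ?w = "\<lambda>p::nat. ln (real p) / real p"
  have wnn: "?w p \<ge> 0" for p by (cases "p = 0") auto
  have "psum h X \<le> (\<Sum>p | prime p \<and> p \<le> X. g p * ?w p + of_bool (p \<le> P) * (\<bar>h p\<bar> * ?w p))"
    unfolding psum_def
  proof (rule sum_mono)
    fix p assume p: "p \<in> {p. prime p \<and> p \<le> X}"
    show "h p * ?w p \<le> g p * ?w p + of_bool (p \<le> P) * (\<bar>h p\<bar> * ?w p)"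
    proof (cases "p \<le> P")
      case True
      have "h p * ?w p \<le> \<bar>h p\<bar> * ?w p" using wnn by (intro mult_right_mono) auto
      moreover have "0 \<le> g p * ?w p" using assms(2) wnn by (intro mult_nonneg_nonneg)
      ultimately show ?thesis using True by simp
    next
      case False
      then have "h p * ?w p \<le> g p * ?w p" using assms(1)[of p] p wnn[of p] by (intro mult_right_mono) auto
      moreover have "of_bool (p \<le> P) * (\<bar>h p\<bar> * ?w p) = 0" using False by simp
      ultimately show ?thesis by linarith
    qed
  qed
  also have "\<dots> = psum g X + (\<Sum>p | prime p \<and> p \<le> X. of_bool (p \<le> P) * (\<bar>h p\<bar> * ?w p))"
    by (simp only: sum.distrib psum_def)
  also have "(\<Sum>p | prime p \<and> p \<le> X. of_bool (p \<le> P) * (\<bar>h p\<bar> * ?w p)) = (\<Sum>p\<in>{p. prime p \<and> p \<le> X} \<inter> {..P}. \<bar>h p\<bar> * ?w p)"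
    by (rule sum.mono_neutral_cong_right) auto
  also have "\<dots> \<le> (\<Sum>p\<le>P. \<bar>h p\<bar> * ?w p)" by (intro sum_mono2 mult_nonneg_nonneg abs_ge_zero wnn) auto
  finally show ?thesis by simp
qed

lemma const_smallo_ln: "(\<lambda>X::nat. c :: real) \<in> o(\<lambda>X. ln (real X))"
  by real_asymp

lemma smallo_sandwich:
  fixes F G :: "nat \<Rightarrow> real"
  assumes "G \<in> o(\<lambda>X. ln (real X))" and "\<And>X. 0 \<le> F X" and "\<And>X. F X \<le> c * G X + d"
  shows "F \<in> o(\<lambda>X. ln (real X))"
proof -
  have "(\<lambda>X. c * G X + d) \<in> o(\<lambda>X. ln (real X))"
    using assms(1) const_smallo_ln by (intro sum_in_smallo) auto
  moreover have "F \<in> O(\<lambda>X. c * G X + d)"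
    using assms(2,3) by (intro bigoI[of _ 1] always_eventually) (auto intro: order_trans[OF _ abs_ge_self])
  ultimately show ?thesis by (rule landau_o.big_small_trans[rotated])
qed

lemma ln_not_smallo: "(\<lambda>X::nat. ln (real X)) \<notin> o(\<lambda>X. ln (real X))"
proof
  assume "(\<lambda>X::nat. ln (real X)) \<in> o(\<lambda>X. ln (real X))"
  then have "\<forall>\<^sub>F X::nat in sequentially. ln (real X) = 0" by (simp add: landau_o.small_refl_iff)
  moreover have "\<forall>\<^sub>F X::nat in sequentially. ln (real X) > 0" by real_asymp
  ultimately have "\<forall>\<^sub>F X::nat in sequentially. False" by eventually_elim simp
  then show False by simp
qed

text \<open>For primes outside this class, raising to the power \<open>q\<close> permutes the
  residues, so every integer is a \<open>q\<close>-th power.\<close>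

definition qclass :: "nat \<Rightarrow> nat \<Rightarrow> bool" where "qclass q p \<longleftrightarrow> q dvd p - 1"

text \<open>
  A root modulo \<open>p > q\<close> of an irreducible factor of \<open>1 + X + \<dots> + X ^ (q - 1)\<close> has order \<open>q\<close>. (Any
  irreducible factor will do, so irreducibility of the cyclotomic polynomial is not needed.)
\<close>

lemma primes_qclass_not_sparse:
  assumes q: "prime q"
  shows "psum (\<lambda>p. of_bool (qclass q p)) \<notin> o(\<lambda>X. ln (real X))"
proof
  assume small: "psum (\<lambda>p. of_bool (qclass q p)) \<in> o(\<lambda>X. ln (real X))"
  have q1: "q > 1" using q by (rule prime_gt_1_nat)
  define \<Psi> where "\<Psi> = (\<Sum>i<q. monom (1::int) i)"
  have evP: "poly \<Psi> r = (\<Sum>i<q. r ^ i)" for r by (simp add: \<Psi>_def poly_sum poly_monom)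
  have cP: "coeff \<Psi> i = (if i < q then 1 else 0)" for i by (simp add: \<Psi>_def coeff_sum)
  have degP: "degree \<Psi> = q - 1"
  proof (rule antisym)
    show "degree \<Psi> \<le> q - 1" by (rule degree_le) (auto simp: cP)
    show "q - 1 \<le> degree \<Psi>" using q1 by (intro le_degree) (simp add: cP)
  qed
  have monP: "monic \<Psi>" unfolding degP using q1 by (simp add: cP)
  have "\<Psi> \<noteq> 0" using monP by auto
  moreover have "\<not> is_unit \<Psi>" using degP q1 by (auto simp: poly_dvd_1)
  ultimately obtain f where f: "f dvd \<Psi>" "prime f" using prime_divisor_exists by blast
  obtain h where h: "\<Psi> = f * h" using f(1) by blast
  have "lead_coeff f * lead_coeff h = 1" using monP unfolding h by (simp add: lead_coeff_mult)
  then have lf: "lead_coeff f = 1 \<or> lead_coeff f = - 1" by (auto simp: zmult_eq_1_iff)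
  obtain f' where f': "f' dvd \<Psi>" "irreducible f'" "monic f'"
  proof (cases "lead_coeff f = 1")
    case True then show thesis using that[of f] f by (simp add: prime_elem_imp_irreducible)
  next
    case False
    then have "monic (- f)" using lf by simp
    moreover have "irreducible (- f)"
      using irreducible_mult_unit_left[of "- 1" f] f(2) by (simp add: prime_elem_imp_irreducible)
    ultimately show thesis using that[of "- f"] f(1) by simp
  qed
  have deg': "degree f' > 0"
  proof (rule ccontr)
    assume "\<not> degree f' > 0"
    then have "f' = 1" using f'(3) monic_degree_0 by simp
    then show False using f'(2) by (simp add: irreducible_def)
  qed
  interpret F: monic_irreducible f' "degree f'" using f' deg' by unfold_locales auto
  have "nroots f' p = 0" if p: "prime p" "p > q" "\<not> qclass q p" for p
  proof -
    have "\<not> int p dvd poly f' r" for r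
    proof
      assume "int p dvd poly f' r"
      moreover have "poly f' r dvd poly \<Psi> r" using f'(1) by (auto elim!: dvdE)
      ultimately have d: "int p dvd (\<Sum>i<q. r ^ i)" unfolding evP by (rule dvd_trans)
      have "r ^ q - 1 = (r - 1) * (\<Sum>i<q. r ^ i)" by (rule power_diff_1_eq)
      then have rq: "[r ^ q = 1] (mod int p)" using d by (simp add: cong_iff_dvd_diff)
      have ndr: "\<not> int p dvd r"
      proof
        assume "int p dvd r"
        then have "int p dvd r ^ q" using dvd_trans[OF _ dvd_power[of q r]] q1 by simp
        then have "int p dvd 1" using cong_dvd_iff[OF rq] by blast
        then show False using prime_gt_1_nat[OF p(1)] by simp
      qed
      obtain g ind where g: "\<And>a. \<not> int p dvd a \<Longrightarrow> [a = g ^ ind a] (mod int p)"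
        "\<And>i j. [g ^ i = g ^ j] (mod int p) \<longleftrightarrow> [i = j] (mod (p - 1))"
        by (rule exists_index[OF p(1)]) blast
      have "[(g ^ ind r) ^ q = r ^ q] (mod int p)" by (intro cong_pow cong_sym[OF g(1)[OF ndr]])
      then have "[g ^ (q * ind r) = g ^ 0] (mod int p)" using rq by (simp add: power_mult[symmetric] mult.commute) (metis cong_trans)
      then have "[q * ind r = 0] (mod (p - 1))" using g(2) by blast
      then have "p - 1 dvd q * ind r" by (simp add: cong_0_iff)
      moreover have "coprime (p - 1) q" using p(3) q unfolding qclass_def by (metis coprime_commute prime_imp_coprime)
      ultimately have "p - 1 dvd ind r" by (simp add: coprime_dvd_mult_right_iff)
      then have "[ind r = 0] (mod (p - 1))" by (simp add: cong_0_iff)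
      then have "[g ^ ind r = g ^ 0] (mod int p)" using g(2) by blast
      then have "[r = 1] (mod int p)" using g(1)[OF ndr] by (simp add: cong_trans[OF g(1)[OF ndr]])
      then have "[r ^ i = 1] (mod int p)" for i using cong_pow[of r 1 "int p" i] by simp
      \<comment> \<open>A root has order dividing both \<open>q\<close> and \<open>p - 1\<close>,
        hence is 1 modulo \<open>p\<close>; but there the polynomial takes the value
        \<open>q\<close>, and \<open>0 < q < p\<close>.\<close>
      then have "[(\<Sum>i<q. r ^ i) = (\<Sum>i<q. 1)] (mod int p)" by (intro cong_sum)
      then have "int p dvd int q" using d by (simp add: cong_dvd_iff)
      then have "p dvd q" by (simp only: of_nat_dvd_iff)
      then show False using p(2) q1 by (auto dest: dvd_imp_le)
    qed
    then show ?thesis by (simp add: nroots_def)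
  qed
  moreover have "real (nroots f' p) \<le> 2 ^ degree f'" if p: "prime p" for p
  proof -
    have "nroots f' p \<le> 2 ^ degree f'" using F.Nf_le[OF p] by (simp add: F.Nf_def F.roots_mod_def nroots_def)
    then have "real (nroots f' p) \<le> real (2 ^ degree f')" by (simp only: of_nat_le_iff)
    then show ?thesis by simp
  qed
  ultimately have pt: "real (nroots f' p) \<le> 2 ^ degree f' * of_bool (qclass q p)" if "prime p" "p > q" for p
    using that by (cases "qclass q p") auto
  define C where "C = (\<Sum>p\<le>q. \<bar>real (nroots f' p)\<bar> * (ln (real p) / real p))"
  have "psum (\<lambda>p. real (nroots f' p)) X \<le> 2 ^ degree f' * psum (\<lambda>p. of_bool (qclass q p)) X + C" for X
  proof -
    have "psum (\<lambda>p. real (nroots f' p)) X \<le> psum (\<lambda>p. 2 ^ degree f' * of_bool (qclass q p)) X + C"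
      unfolding C_def using pt by (intro psum_mono_except) auto
    also have "psum (\<lambda>p. 2 ^ degree f' * of_bool (qclass q p)) X = 2 ^ degree f' * psum (\<lambda>p. of_bool (qclass q p)) X"
      by (simp add: psum_def sum_distrib_left mult.assoc)
    finally show ?thesis .
  qed
  moreover have "0 \<le> psum (\<lambda>p. real (nroots f' p)) X" for X
    unfolding psum_def by (intro sum_nonneg mult_nonneg_nonneg) (auto simp: prime_gt_0_nat Suc_le_eq)
  ultimately have "psum (\<lambda>p. real (nroots f' p)) \<in> o(\<lambda>X. ln (real X))" by (intro smallo_sandwich[OF small])
  from sum_in_smallo(2)[OF this F.prime_root_sum_asymp] show False using ln_not_smallo by simp
qed

text \<open>A weighted sum of the root counts over all exponent vectors is computed twice. For all
  large primes it is a constant multiple of the indicator that \<open>p\<close> lies in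
  \<open>T\<close> and \<open>q\<close> divides \<open>p - 1\<close>, hence small if
  \<open>T\<close> is sparse. On average every vector except 0 contributes \<open>o(ln X)\<close>,
  because both \<open>X ^ q - b\<close> and \<open>X\<close> satisfy the Mertens theorem. So the
  zero vector's term would be small too, against \<open>primes_qclass_not_sparse\<close>.\<close>

theorem independent_not_ae:
  fixes A :: "int set" and q :: nat
  assumes q: "prime q" and A: "finite A" "0 \<notin> A"
    and indep: "\<And>w y. (\<forall>a\<in>A. w a < q) \<Longrightarrow> (\<exists>a\<in>A. w a \<noteq> 0) \<Longrightarrow> (\<Prod>a\<in>A. a ^ w a) \<noteq> y ^ q"
  shows "\<not> contains_qth_power_ae q A"
proof
  assume ae: "contains_qth_power_ae q A"
  have q1: "q > 1" using q by (rule prime_gt_1_nat)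
  define T where "T = {p. prime p \<and> (\<forall>a\<in>A. \<not> is_qth_power_mod q a p)}"
  have "{p. prime p} - T = {p. prime p \<and> (\<exists>a\<in>A. is_qth_power_mod q a p)}" by (auto simp: T_def)
  then have "rel_density_primes ({p. prime p} - T) 1" using ae by (simp add: contains_qth_power_ae_def)
  then have Tsmall: "psum (\<lambda>p. of_bool (p \<in> T)) \<in> o(\<lambda>X. ln (real X))"
    by (intro sparse_prime_sum) (auto simp: T_def)
  let ?W = "Pi\<^sub>E A (\<lambda>_. {..<q})"
  define b where "b = (\<lambda>w. \<Prod>a\<in>A. a ^ w a)"
  \<comment> \<open>Up to powers of \<open>q\<close>, the Fourier coefficients of the condition that
    no \<open>ind a\<close> is divisible by \<open>q\<close>, as in
    \<open>character_identity\<close>.\<close>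
  define c where "c = (\<lambda>w. \<Prod>a\<in>A. if w a = (0::nat) then real q - 1 else - 1)"
  \<comment> \<open>For large \<open>p\<close>, the root count minus 1 is the sum of the nontrivial
    characters of order \<open>q\<close> at \<open>b w\<close>, and 0 if there are none.\<close>
  define h where "h = (\<lambda>w p. real (nroots (Xq q (b w)) p) - 1)"
  define w0 where "w0 = restrict (\<lambda>_. 0 :: nat) A"
  have w0: "w0 \<in> ?W" using q1 by (auto simp: w0_def)
  have finW: "finite ?W" using A(1) by (intro finite_PiE) auto
  have hsmall: "psum (h w) \<in> o(\<lambda>X. ln (real X))" if w: "w \<in> ?W - {w0}" for w
  proof -
    have "\<exists>a\<in>A. w a \<noteq> 0"
    proof (rule ccontr)
      assume "\<not> ?thesis"
      then have "w a = w0 a" if "a \<in> A" for a using that by (simp add: w0_def)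
      moreover have "w \<in> ?W" using w by blast
      ultimately have "w = w0" using w0 by (intro PiE_ext[of w A "\<lambda>_. {..<q}" w0])
      then show False using w by simp
    qed
    moreover have "\<forall>a\<in>A. w a < q" using w PiE_mem[of w A "\<lambda>_. {..<q}"] by blast
    ultimately have np: "b w \<noteq> y ^ q" for y unfolding b_def by (intro indep)
    have "b w \<noteq> 0" using A by (auto simp: b_def)
    then interpret F: monic_irreducible "Xq q (b w)" q
      using irreducible_Xq[OF q _ np] monic_Xq degree_Xq q1 by unfold_locales auto
    have "psum (h w) = (\<lambda>X. (psum (\<lambda>p. real (nroots (Xq q (b w)) p)) X - ln (real X)) - (psum (\<lambda>_. 1) X - ln (real X)))"
      unfolding h_def psum_def by (rule ext) (simp add: left_diff_distrib sum_subtractf diff_divide_distrib)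
    also have "\<dots> \<in> o(\<lambda>X. ln (real X))" by (intro sum_in_smallo F.prime_root_sum_asymp mertens)
    finally show ?thesis .
  qed
  define Pm where "Pm = q + (\<Sum>a\<in>A. nat \<bar>a\<bar>)"
  have idx: "(\<Sum>w\<in>?W. c w * h w p) = of_bool (qclass q p) * ((real q - 1) * real q ^ card A * of_bool (p \<in> T)) \<and> h w0 p = (real q - 1) * of_bool (qclass q p)"
    if p: "prime p" "p > Pm" for p
  proof -
    have nd: "\<not> int p dvd a" if a: "a \<in> A" for a
    proof
      assume "int p dvd a"
      moreover have "a \<noteq> 0" using a A(2) by auto
      ultimately have "int p \<le> \<bar>a\<bar>" by (simp add: zdvd_imp_le)
      then have "p \<le> nat \<bar>a\<bar>" by linarith
      also have "\<dots> \<le> (\<Sum>a\<in>A. nat \<bar>a\<bar>)" using a A(1) by (intro member_le_sum) auto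
      also have "\<dots> \<le> Pm" by (simp add: Pm_def)
      finally show False using p(2) by simp
    qed
    have ip: "prime (int p)" using p(1) by simp
    have ndb: "\<not> int p dvd b w" for w
    proof
      assume "int p dvd b w"
      then have "\<exists>a\<in>A. int p dvd a ^ w a"
        unfolding b_def by (rule prime_dvd_prod_iff[OF A(1) ip, THEN iffD1])
      then obtain a where a: "a \<in> A" "int p dvd a ^ w a" by blast
      have "int p dvd a" using a(2) by (rule prime_dvd_power[OF ip])
      then show False using nd[OF a(1)] by blast
    qed
    obtain g ind where g: "\<And>a. \<not> int p dvd a \<Longrightarrow> [a = g ^ ind a] (mod int p)"
      "\<And>i j. [g ^ i = g ^ j] (mod int p) \<longleftrightarrow> [i = j] (mod (p - 1))" "\<not> int p dvd g"
      by (rule exists_index[OF p(1)]) blast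
    have nr: "real (nroots (Xq q (b w)) p) = (if qclass q p then if q dvd ind (b w) then real q else 0 else 1)" for w
    proof -
      have "nroots (Xq q (b w)) p = (if q dvd p - 1 then if q dvd ind (b w) then q else 0 else 1)"
        by (rule nroots_Xq[OF p(1) q ndb g])
      then show ?thesis unfolding qclass_def by (simp split: if_splits)
    qed
    show ?thesis
    proof (cases "qclass q p")
      case False
      then show ?thesis by (simp add: h_def nr)
    next
      case True
      have indb: "q dvd ind (b w) \<longleftrightarrow> q dvd (\<Sum>a\<in>A. w a * ind a)" for w
      proof -
        have "[b w = (\<Prod>a\<in>A. (g ^ ind a) ^ w a)] (mod int p)"
          unfolding b_def by (intro cong_prod cong_pow g(1) nd)
        also have "(\<Prod>a\<in>A. (g ^ ind a) ^ w a) = g ^ (\<Sum>a\<in>A. w a * ind a)"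
          by (simp add: power_sum power_mult[symmetric] mult.commute)
        finally have "[g ^ ind (b w) = g ^ (\<Sum>a\<in>A. w a * ind a)] (mod int p)"
          by (rule cong_trans[OF cong_sym[OF g(1)[OF ndb[of w]]]])
        then have "[ind (b w) = (\<Sum>a\<in>A. w a * ind a)] (mod (p - 1))" using g(2) by blast
        then have "[ind (b w) = (\<Sum>a\<in>A. w a * ind a)] (mod q)" using True unfolding qclass_def by (rule cong_dvd_modulus_nat)
        then show ?thesis by (rule cong_dvd_iff)
      qed
      have hw: "h w p = (if q dvd (\<Sum>a\<in>A. w a * ind a) then real q else 0) - 1" for w
        unfolding h_def nr indb using True by simp
      have "(\<Sum>w\<in>?W. c w * h w p) = (real q - 1) * real q ^ card A * of_bool (\<forall>a\<in>A. \<not> q dvd ind a)"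
        unfolding hw c_def by (rule character_identity[OF q A(1)])
      moreover have "(\<forall>a\<in>A. \<not> q dvd ind a) \<longleftrightarrow> p \<in> T"
      proof -
        have "is_qth_power_mod q a p \<longleftrightarrow> q dvd ind a" if "a \<in> A" for a
          using qth_power_iff_index[OF p(1) q nd[OF that] True[unfolded qclass_def] g] by blast
        then show ?thesis using p(1) unfolding T_def by blast
      qed
      moreover have "h w0 p = real q - 1" unfolding hw by (simp add: w0_def)
      ultimately show ?thesis using True by simp
    qed
  qed
  define H where "H = (\<lambda>p. \<Sum>w\<in>?W. c w * h w p)"
  define Q where "Q = (real q - 1) * real q ^ card A"
  have Q0: "Q \<ge> 0" using q1 by (simp add: Q_def)
  define CH where "CH = (\<Sum>p\<le>Pm. \<bar>H p\<bar> * (ln (real p) / real p))"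
  have Hsmall: "psum H \<in> o(\<lambda>X. ln (real X))"
  proof -
    have up: "psum H X \<le> Q * psum (\<lambda>p. of_bool (p \<in> T)) X + CH" for X
    proof -
      have "psum H X \<le> psum (\<lambda>p. Q * of_bool (p \<in> T)) X + CH" unfolding CH_def
      proof (rule psum_mono_except)
        show "H p \<le> Q * of_bool (p \<in> T)" if "prime p" "p > Pm" for p
          using idx[OF that] Q0 by (auto simp: H_def Q_def of_bool_def)
      qed (use Q0 in auto)
      also have "psum (\<lambda>p. Q * of_bool (p \<in> T)) X = Q * psum (\<lambda>p. of_bool (p \<in> T)) X"
        by (simp add: psum_def sum_distrib_left mult.assoc)
      finally show ?thesis .
    qed
    have lo: "- psum H X \<le> CH" for X
    proof -
      have "psum (\<lambda>p. - H p) X \<le> psum (\<lambda>_. 0) X + (\<Sum>p\<le>Pm. \<bar>- H p\<bar> * (ln (real p) / real p))"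
      proof (rule psum_mono_except)
        show "- H p \<le> 0" if "prime p" "p > Pm" for p
          using idx[OF that] Q0 by (auto simp: H_def Q_def of_bool_def)
      qed simp
      then show ?thesis by (simp add: CH_def psum_def sum_negf)
    qed
    have "(\<lambda>X. psum H X + CH) \<in> o(\<lambda>X. ln (real X))"
    proof (rule smallo_sandwich[OF Tsmall])
      show "0 \<le> psum H X + CH" for X using lo[of X] by linarith
      show "psum H X + CH \<le> Q * psum (\<lambda>p. of_bool (p \<in> T)) X + (CH + CH)" for X using up[of X] by linarith
    qed
    from sum_in_smallo(2)[OF this const_smallo_ln[of CH]] show ?thesis by simp
  qed
  have "psum H = (\<lambda>X. \<Sum>w\<in>?W. c w * psum (h w) X)" unfolding H_def by (rule ext) (rule psum_sum)
  also have "\<dots> = (\<lambda>X. c w0 * psum (h w0) X + (\<Sum>w\<in>?W - {w0}. c w * psum (h w) X))"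
    by (rule ext) (rule sum.remove[OF finW w0])
  finally have "(\<lambda>X. c w0 * psum (h w0) X) = (\<lambda>X. psum H X - (\<Sum>w\<in>?W - {w0}. c w * psum (h w) X))" by simp
  also have "\<dots> \<in> o(\<lambda>X. ln (real X))"
  proof (intro sum_in_smallo(2) Hsmall big_sum_in_smallo)
    fix w assume "w \<in> ?W - {w0}"
    then have "psum (h w) \<in> o(\<lambda>X. ln (real X))" by (rule hsmall)
    then show "(\<lambda>X. c w * psum (h w) X) \<in> o(\<lambda>X. ln (real X))" by (cases "c w = 0") simp_all
  qed
  finally have c0: "(\<lambda>X. c w0 * psum (h w0) X) \<in> o(\<lambda>X. ln (real X))" .
  have "c w0 = (real q - 1) ^ card A" by (simp add: c_def w0_def)
  then have "c w0 \<noteq> 0" using q1 by simp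
  then have h0: "psum (h w0) \<in> o(\<lambda>X. ln (real X))" using c0 by simp
  define C0 where "C0 = (\<Sum>p\<le>Pm. \<bar>of_bool (qclass q p) - h w0 p\<bar> * (ln (real p) / real p))"
  have "psum (\<lambda>p. of_bool (qclass q p)) \<in> o(\<lambda>X. ln (real X))"
  proof (rule smallo_sandwich[OF h0])
    show "0 \<le> psum (\<lambda>p. of_bool (qclass q p)) X" for X
      unfolding psum_def by (intro sum_nonneg mult_nonneg_nonneg) (auto simp: prime_gt_0_nat Suc_le_eq)
    show "psum (\<lambda>p. of_bool (qclass q p)) X \<le> 1 * psum (h w0) X + C0" for X
    proof -
      have "psum (\<lambda>p. of_bool (qclass q p) - h w0 p) X \<le> psum (\<lambda>_. 0) X + C0" unfolding C0_def
      proof (rule psum_mono_except)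
        show "of_bool (qclass q p) - h w0 p \<le> 0" if "prime p" "p > Pm" for p
          using idx[OF that] q1 by (auto simp: of_bool_def)
      qed simp
      then show ?thesis unfolding psum_def left_diff_distrib sum_subtractf by simp
    qed
  qed
  then show False using primes_qclass_not_sparse[OF q] by blast
qed

section \<open>Counting dependent sets\<close>

lemma S_qk_dependent:
  assumes q: "prime q" and A: "A \<in> S_qk q k"
  shows "0 \<in> A \<or> (\<exists>w y. (\<forall>a\<in>A. w a < q) \<and> (\<exists>a\<in>A. w a \<noteq> 0) \<and> (\<Prod>a\<in>A. a ^ w a) = y ^ q)"
proof (rule ccontr)
  assume neg: "\<not> ?thesis"
  have "finite A" "contains_qth_power_ae q A" using A by (auto simp: S_qk_def)
  moreover have "(\<Prod>a\<in>A. a ^ w a) \<noteq> y ^ q" if "\<forall>a\<in>A. w a < q" "\<exists>a\<in>A. w a \<noteq> 0" for w y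
    using neg that by blast
  moreover have "0 \<notin> A" using neg by blast
  ultimately show False using independent_not_ae[OF q, of A] by blast
qed

text \<open>The candidates for the element determined by the others: \<open>t\<close> is its
  exponent in the relation and \<open>D\<close> the product of the remaining factors.\<close>

definition power_class :: "nat \<Rightarrow> int set \<Rightarrow> nat \<Rightarrow> int \<Rightarrow> int set" where
  "power_class q X t D = {a\<in>X. a \<noteq> 0 \<and> (\<exists>y. a ^ t * D = y ^ q)}"

lemma card_k_subsets_le:
  assumes "finite X"
  shows "finite (k_subsets k X)" "card (k_subsets k X) \<le> card X ^ k"
proof -
  have eq: "k_subsets k X = {A. A \<subseteq> X \<and> card A = k}"
    unfolding k_subsets_def using assms finite_subset by blast
  show "finite (k_subsets k X)" unfolding k_subsets_def by (rule finite_subset[of _ "Pow X"]) (use assms in auto)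
  have "card (k_subsets k X) = card X choose k" unfolding eq using assms by (rule n_subsets)
  also have "\<dots> \<le> card X ^ k" by (cases "k \<le> card X") (simp_all add: binomial_le_pow binomial_eq_0)
  finally show "card (k_subsets k X) \<le> card X ^ k" .
qed

text \<open>The case \<open>k = 0\<close> is split off because the count below removes an element
  from the set.\<close>

lemma S_qk_0:
  assumes q: "prime q" shows "S_qk q 0 = {}"
proof (rule equals0I)
  fix A assume A: "A \<in> S_qk q 0"
  then have "A = {}" by (auto simp: S_qk_def)
  then show False using S_qk_dependent[OF q A] by simp
qed

text \<open>Remove an element that is 0 or has nonzero exponent in the relation. There are at most
  \<open>card X ^ (k - 1)\<close> choices for the rest; given the rest, the removed element is 0 or
  lies in one of at most \<open>q ^ k\<close> power classes, one for each choice of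
  exponents.\<close>

lemma card_S_qk_le:
  assumes q: "prime q" and X: "finite X" and k: "k \<ge> 1" and L: "L \<ge> 0"
    and cls: "\<And>t D. 1 \<le> t \<Longrightarrow> t < q \<Longrightarrow> D \<noteq> 0 \<Longrightarrow> real (card (power_class q X t D)) \<le> L"
  shows "real (card (S_qk q k \<inter> k_subsets k X)) \<le> real (card X) ^ (k - 1) * (1 + real q ^ k * L)"
proof -
  define I where "I = (\<lambda>A'. {(w, t). w \<in> Pi\<^sub>E A' (\<lambda>_. {..<q}) \<and> t \<in> {1..<q} \<and> (\<Prod>a\<in>A'. a ^ w a) \<noteq> (0::int)})"
  define F where "F = (\<lambda>A'. (X \<inter> {0}) \<union> (\<Union>(w, t)\<in>I A'. power_class q X t (\<Prod>a\<in>A'. a ^ w a)))"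
  let ?K = "k_subsets (k - 1) X"
  have q0: "q > 0" using q by (rule prime_gt_0_nat)
  have "S_qk q k \<inter> k_subsets k X \<subseteq> (\<lambda>(A', a). insert a A') ` (SIGMA A':?K. F A')"
  proof
    fix A assume "A \<in> S_qk q k \<inter> k_subsets k X"
    then have A: "A \<in> S_qk q k" "A \<subseteq> X" "finite A" "card A = k" by (auto simp: k_subsets_def)
    have "\<exists>a\<in>A. a \<in> F (A - {a})"
    proof (cases "0 \<in> A")
      case True
      then have "0 \<in> F (A - {0})" using A(2) by (auto simp: F_def)
      then show ?thesis using True by blast
    next
      case False
      then obtain w y where w: "\<forall>a\<in>A. w a < q" "\<exists>a\<in>A. w a \<noteq> 0" "(\<Prod>a\<in>A. a ^ w a) = y ^ q"
        using S_qk_dependent[OF q A(1)] by blast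
      then obtain a where a: "a \<in> A" "w a \<noteq> 0" by blast
      define w' where "w' = restrict w (A - {a})"
      have pr: "(\<Prod>b\<in>A - {a}. b ^ w' b) = (\<Prod>b\<in>A - {a}. b ^ w b)" by (intro prod.cong refl) (simp add: w'_def)
      have "(\<Prod>b\<in>A - {a}. b ^ w' b) \<noteq> 0" unfolding pr using False A(3) by auto
      then have "(w', w a) \<in> I (A - {a})" using w(1) a unfolding I_def by (auto simp: w'_def)
      moreover have "a \<in> power_class q X (w a) (\<Prod>b\<in>A - {a}. b ^ w' b)"
      proof -
        have "a ^ w a * (\<Prod>b\<in>A - {a}. b ^ w' b) = y ^ q"
          unfolding pr w(3)[symmetric] by (rule prod.remove[OF A(3) a(1), symmetric])
        then show ?thesis using a(1) A(2) False unfolding power_class_def by auto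
      qed
      ultimately have "a \<in> F (A - {a})" unfolding F_def by blast
      then show ?thesis using a(1) by blast
    qed
    then obtain a where a: "a \<in> A" "a \<in> F (A - {a})" by blast
    have "A - {a} \<in> ?K" using A a(1) by (auto simp: k_subsets_def card_Diff_singleton)
    then have "(A - {a}, a) \<in> (SIGMA A':?K. F A')" using a(2) by blast
    then show "A \<in> (\<lambda>(A', a). insert a A') ` (SIGMA A':?K. F A')"
      by (rule rev_image_eqI) (simp add: insert_absorb a(1))
  qed
  moreover have finF: "finite (F A')" for A'
    by (rule finite_subset[OF _ X]) (auto simp: F_def power_class_def)
  moreover have finK: "finite ?K" by (rule card_k_subsets_le(1)[OF X])
  ultimately have "card (S_qk q k \<inter> k_subsets k X) \<le> card ((\<lambda>(A', a). insert a A') ` (SIGMA A':?K. F A'))"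
    by (intro card_mono finite_imageI finite_SigmaI) auto
  also have "\<dots> \<le> card (SIGMA A':?K. F A')" using finF finK by (intro card_image_le finite_SigmaI) auto
  also have "\<dots> = (\<Sum>A'\<in>?K. card (F A'))" using finF finK by simp
  finally have "real (card (S_qk q k \<inter> k_subsets k X)) \<le> real (\<Sum>A'\<in>?K. card (F A'))" by (simp only: of_nat_le_iff)
  also have "\<dots> = (\<Sum>A'\<in>?K. real (card (F A')))" by simp
  also have "\<dots> \<le> (\<Sum>A'\<in>?K. 1 + real q ^ k * L)"
  proof (rule sum_mono)
    fix A' assume "A' \<in> ?K"
    then have A': "finite A'" "card A' = k - 1" by (auto simp: k_subsets_def)
    let ?P = "Pi\<^sub>E A' (\<lambda>_. {..<q})"
    have finP: "finite ?P" using A'(1) by (intro finite_PiE) auto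
    have subI: "I A' \<subseteq> ?P \<times> {1..<q}" by (auto simp: I_def)
    have finI: "finite (I A')" by (rule finite_subset[OF subI]) (use finP in auto)
    have "card (I A') \<le> card (?P \<times> {1..<q})" using finP by (intro card_mono[OF _ subI]) auto
    also have "\<dots> = q ^ (k - 1) * (q - 1)" using A' by (simp add: card_cartesian_product card_PiE)
    also have "\<dots> \<le> q ^ (k - 1) * q" by simp
    also have "\<dots> = q ^ k" by (rule power_minus_mult) (use k in simp)
    finally have "real (card (I A')) \<le> real (q ^ k)" by (simp only: of_nat_le_iff)
    then have cI: "real (card (I A')) \<le> real q ^ k" by simp
    have "card (F A') \<le> card (X \<inter> {0}) + card (\<Union>(w, t)\<in>I A'. power_class q X t (\<Prod>a\<in>A'. a ^ w a))"
      unfolding F_def by (rule card_Un_le)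
    also have "card (X \<inter> {0}) \<le> 1" using card_mono[of "{0::int}" "X \<inter> {0}"] by simp
    also have "card (\<Union>(w, t)\<in>I A'. power_class q X t (\<Prod>a\<in>A'. a ^ w a)) \<le> (\<Sum>i\<in>I A'. card (case i of (w, t) \<Rightarrow> power_class q X t (\<Prod>a\<in>A'. a ^ w a)))"
      by (rule card_UN_le[OF finI])
    finally have "real (card (F A')) \<le> real (1 + (\<Sum>i\<in>I A'. card (case i of (w, t) \<Rightarrow> power_class q X t (\<Prod>a\<in>A'. a ^ w a))))"
      by (simp only: of_nat_le_iff)
    also have "\<dots> = 1 + (\<Sum>i\<in>I A'. real (card (case i of (w, t) \<Rightarrow> power_class q X t (\<Prod>a\<in>A'. a ^ w a))))" by simp
    also have "\<dots> \<le> 1 + (\<Sum>i\<in>I A'. L)"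
      by (intro add_left_mono sum_mono) (auto simp: I_def intro!: cls)
    also have "\<dots> = 1 + real (card (I A')) * L" by simp
    also have "\<dots> \<le> 1 + real q ^ k * L" using cI L by (intro add_left_mono mult_right_mono)
    finally show "real (card (F A')) \<le> 1 + real q ^ k * L" .
  qed
  also have "\<dots> = real (card ?K) * (1 + real q ^ k * L)" by simp
  also have "\<dots> \<le> real (card X ^ (k - 1)) * (1 + real q ^ k * L)"
  proof (rule mult_right_mono)
    show "real (card ?K) \<le> real (card X ^ (k - 1))" using card_k_subsets_le(2)[OF X] by (simp only: of_nat_le_iff)
  qed (use L in simp)
  finally show ?thesis by simp
qed

lemma coprime_below_prime:
  fixes q t :: nat
  assumes "prime q" "1 \<le> t" "t < q"
  shows "coprime t q"
proof -
  have "\<not> q dvd t" using assms by (auto dest: dvd_imp_le)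
  then show ?thesis using assms(1) by (simp add: prime_imp_coprime coprime_commute)
qed

text \<open>
  Take \<open>a0\<close> of least absolute value: a denominator in the \<open>q\<close>-th root of \<open>a / a0\<close> would lead to a
  smaller element of the class.
\<close>

lemma power_class_generator:
  fixes D :: int
  assumes q: "prime q" and t: "1 \<le> t" "t < q" and D: "D \<noteq> 0"
    and ne: "power_class q UNIV t D \<noteq> {}"
  obtains a0 where "a0 \<noteq> 0" "\<And>a. a \<in> power_class q UNIV t D \<Longrightarrow> \<exists>m. a = a0 * m ^ q"
proof -
  let ?C = "power_class q UNIV t D"
  have q1: "q > 1" using q by (rule prime_gt_1_nat)
  have cop: "coprime t q" using q t by (rule coprime_below_prime)
  obtain b where "b \<in> ?C" using ne by blast
  then obtain a0 where a0: "a0 \<in> ?C" and min: "\<And>a. a \<in> ?C \<Longrightarrow> nat \<bar>a0\<bar> \<le> nat \<bar>a\<bar>"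
    using arg_min_nat_lemma[of "\<lambda>a. a \<in> ?C" b "\<lambda>a. nat \<bar>a\<bar>"] by blast
  obtain y0 where y0: "a0 ^ t * D = y0 ^ q" and a0n: "a0 \<noteq> 0" using a0 by (auto simp: power_class_def)
  have y0n: "y0 \<noteq> 0" using y0 a0n D q1 by (cases "y0 = 0") (auto simp: power_0_left)
  \<comment> \<open>Raising the relation between \<open>a ^ t\<close> and \<open>a0 ^ t\<close> to
    the power \<open>u\<close> turns it into one between \<open>a\<close> and \<open>a0\<close> up
    to \<open>q\<close>-th powers.\<close>
  obtain u v where uv: "t * u = q * v + 1" using coprime_bezout_strong[OF cop] q1 by auto
  have "\<exists>m. a = a0 * m ^ q" if aC: "a \<in> ?C" for a
  proof -
    obtain y where y: "a ^ t * D = y ^ q" and an: "a \<noteq> 0" using aC by (auto simp: power_class_def)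
    have "a ^ t * y0 ^ q = a0 ^ t * y ^ q" unfolding y0[symmetric] y[symmetric] by simp
    then have "(a ^ t * y0 ^ q) ^ u = (a0 ^ t * y ^ q) ^ u" by simp
    moreover have "(x ^ t * z ^ q) ^ u = x * (x ^ v * z ^ u) ^ q" for x z :: int
    proof -
      have "(x ^ t * z ^ q) ^ u = x ^ (t * u) * z ^ (q * u)" by (simp add: power_mult_distrib power_mult)
      also have "\<dots> = x * (x ^ (v * q) * z ^ (u * q))" by (simp add: uv mult.commute)
      finally show ?thesis by (simp add: power_mult_distrib power_mult)
    qed
    ultimately have eq: "a * (a ^ v * y0 ^ u) ^ q = a0 * (a0 ^ v * y ^ u) ^ q" by simp
    define P R where "P = a ^ v * y0 ^ u" and "R = a0 ^ v * y ^ u"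
    have Pn: "P \<noteq> 0" using an y0n by (simp add: P_def)
    define g where "g = gcd P R"
    have gn: "g \<noteq> 0" using Pn by (simp add: g_def)
    obtain P' R' where PR: "P = g * P'" "R = g * R'" "coprime P' R'"
      using gcd_coprime_exists[of P R] Pn by (metis g_def gn mult.commute)
    have "g ^ q * (a * P' ^ q) = g ^ q * (a0 * R' ^ q)"
      using eq unfolding P_def[symmetric] R_def[symmetric] unfolding PR by (simp add: power_mult_distrib mult_ac)
    then have eq': "a * P' ^ q = a0 * R' ^ q" using gn by simp
    have "coprime (P' ^ q) (R' ^ q)" using PR(3) by simp
    moreover have "P' ^ q dvd a0 * R' ^ q" using eq' by (metis dvd_triv_right)
    ultimately have "P' ^ q dvd a0" by (simp add: coprime_dvd_mult_left_iff)
    then obtain a1 where a1: "a0 = P' ^ q * a1" by blast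
    have P'n: "P' \<noteq> 0" using PR(1) Pn by auto
    have "(P' ^ t) ^ q * (a1 ^ t * D) = y0 ^ q"
      unfolding y0[symmetric] a1 by (simp add: power_mult_distrib power_mult[symmetric] mult_ac)
    then have *: "(P' ^ t) ^ q * (a1 ^ t * D) = y0 ^ q" .
    then have "(P' ^ t) ^ q dvd y0 ^ q" by (metis dvd_triv_left)
    then have "P' ^ t dvd y0" using q1 by simp
    then obtain y1 where y1: "y0 = P' ^ t * y1" by blast
    have "(P' ^ t) ^ q * (a1 ^ t * D) = (P' ^ t) ^ q * y1 ^ q" using * unfolding y1 by (simp add: power_mult_distrib)
    then have "a1 ^ t * D = y1 ^ q" using P'n by simp
    moreover have "a1 \<noteq> 0" using a1 a0n by auto
    ultimately have "a1 \<in> ?C" by (auto simp: power_class_def)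
    then have "nat \<bar>a0\<bar> \<le> nat \<bar>a1\<bar>" by (rule min)
    then have "\<bar>P'\<bar> ^ q * \<bar>a1\<bar> \<le> 1 * \<bar>a1\<bar>" unfolding a1 by (simp add: abs_mult power_abs)
    then have "\<bar>P'\<bar> ^ q \<le> 1" using \<open>a1 \<noteq> 0\<close> by (simp add: mult_le_cancel_right)
    moreover have "\<bar>P'\<bar> \<le> \<bar>P'\<bar> ^ q" using P'n q1 by (intro self_le_power) auto
    ultimately have "\<bar>P'\<bar> \<le> 1" by linarith
    then have "P' = 1 \<or> P' = - 1" using P'n by linarith
    then have PP: "P' ^ q * P' ^ q = 1" by (auto simp: power_mult_distrib[symmetric])
    have "a = a * (P' ^ q * P' ^ q)" using PP by simp
    also have "\<dots> = a0 * R' ^ q * P' ^ q" using eq' by (simp add: mult.assoc[symmetric])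
    also have "\<dots> = a0 * (R' * P') ^ q" by (simp add: power_mult_distrib mult_ac)
    finally show ?thesis by blast
  qed
  with a0n that show thesis by blast
qed

text \<open>All elements have the form \<open>a0 * m ^ q\<close>, and the box forces
  \<open>m\<close> to have absolute value at most the \<open>q\<close>-th root of \<open>N\<close>;
  the factor 3 absorbs both signs and \<open>m = 0\<close>.\<close>

lemma card_power_class_add_box:
  assumes q: "prime q" and t: "1 \<le> t" "t < q" and D: "D \<noteq> 0" and N: "N \<ge> 1"
  shows "real (card (power_class q (add_box N) t D)) \<le> 3 * real N powr (1 / real q)"
proof (cases "power_class q UNIV t D = {}")
  case True
  then have "power_class q (add_box N) t D = {}" by (auto simp: power_class_def)
  then show ?thesis by simp
next
  case False
  obtain a0 where a0: "a0 \<noteq> 0" "\<And>a. a \<in> power_class q UNIV t D \<Longrightarrow> \<exists>m. a = a0 * m ^ q"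
    by (rule power_class_generator[OF q t D False]) blast
  have q0: "q > 0" using q by (rule prime_gt_0_nat)
  define \<rho> where "\<rho> = real N powr (1 / real q)"
  have \<rho>1: "\<rho> \<ge> 1" unfolding \<rho>_def using N by (intro ge_one_powr_ge_zero) auto
  have \<rho>q: "\<rho> ^ q = real N" unfolding \<rho>_def using N q0 by (simp add: powr_realpow[symmetric] powr_powr)
  let ?M = "{- \<lfloor>\<rho>\<rfloor>..\<lfloor>\<rho>\<rfloor>}"
  have "power_class q (add_box N) t D \<subseteq> (\<lambda>m. a0 * m ^ q) ` ?M"
  proof
    fix a assume a: "a \<in> power_class q (add_box N) t D"
    then have "a \<in> power_class q UNIV t D" by (simp add: power_class_def)
    then obtain m where m: "a = a0 * m ^ q" using a0(2) by blast
    have "\<bar>a\<bar> \<le> int N" using a by (auto simp: power_class_def add_box_def)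
    moreover have "1 * \<bar>m\<bar> ^ q \<le> \<bar>a0\<bar> * \<bar>m\<bar> ^ q" using a0(1) by (intro mult_right_mono) auto
    ultimately have "\<bar>m\<bar> ^ q \<le> int N" unfolding m by (simp add: abs_mult power_abs)
    then have "real_of_int (\<bar>m\<bar> ^ q) \<le> real_of_int (int N)" by (simp only: of_int_le_iff)
    then have "real_of_int \<bar>m\<bar> ^ q \<le> \<rho> ^ q" using \<rho>q by simp
    then have "real_of_int \<bar>m\<bar> \<le> \<rho>" using q0 \<rho>1 by (simp add: power_mono_iff)
    then have "\<bar>m\<bar> \<le> \<lfloor>\<rho>\<rfloor>" by (simp only: le_floor_iff)
    then have "m \<in> ?M" by (simp add: abs_le_iff)
    then show "a \<in> (\<lambda>m. a0 * m ^ q) ` ?M" using m by blast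
  qed
  then have "card (power_class q (add_box N) t D) \<le> card ((\<lambda>m. a0 * m ^ q) ` ?M)" by (intro card_mono) auto
  also have "\<dots> \<le> card ?M" by (rule card_image_le) simp
  also have "\<dots> = nat (2 * \<lfloor>\<rho>\<rfloor> + 1)" by simp
  finally have "real (card (power_class q (add_box N) t D)) \<le> real (nat (2 * \<lfloor>\<rho>\<rfloor> + 1))" by (simp only: of_nat_le_iff)
  also have "\<dots> \<le> 3 * \<rho>" using \<rho>1 by linarith
  finally show ?thesis by (simp add: \<rho>_def)
qed

section \<open>Power classes in the multiplicative box\<close>

lemma prime_ith_prime: "prime (ith_prime i)"
  using enumerate_in_set[OF primes_infinite, of "i - 1"] by (simp add: ith_prime_def)

lemma ith_prime_inj: "i \<ge> 1 \<Longrightarrow> j \<ge> 1 \<Longrightarrow> ith_prime i = ith_prime j \<Longrightarrow> i = j"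
proof -
  assume ij: "i \<ge> 1" "j \<ge> 1" "ith_prime i = ith_prime j"
  have "inj (enumerate {p::nat. prime p})" using strict_mono_enumerate[OF primes_infinite] by (rule strict_mono_imp_inj_on)
  then have "i - 1 = j - 1" using ij(3) unfolding ith_prime_def by (rule injD)
  then show ?thesis using ij(1,2) by simp
qed

lemma mult_box_image:
  "mult_box N = (\<lambda>(s, e). s * (\<Prod>i\<in>{1..N}. int (ith_prime i) ^ e i)) ` ({1, - 1} \<times> Pi\<^sub>E {1..N} (\<lambda>_. {..N}))"
proof (intro equalityI subsetI)
  fix x assume "x \<in> mult_box N"
  then obtain s e where se: "x = s * (\<Prod>i\<in>{1..N}. int (ith_prime i) ^ e i)" "s \<in> {1, - 1}" "\<forall>i\<in>{1..N}. e i \<le> N"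
    unfolding mult_box_def by blast
  have "x = s * (\<Prod>i\<in>{1..N}. int (ith_prime i) ^ restrict e {1..N} i)" unfolding se(1) by simp
  moreover have "restrict e {1..N} \<in> Pi\<^sub>E {1..N} (\<lambda>_. {..N})" using se(3) by auto
  ultimately show "x \<in> (\<lambda>(s, e). s * (\<Prod>i\<in>{1..N}. int (ith_prime i) ^ e i)) ` ({1, - 1} \<times> Pi\<^sub>E {1..N} (\<lambda>_. {..N}))"
    using se(2) by (intro image_eqI[of _ _ "(s, restrict e {1..N})"]) auto
next
  fix x assume "x \<in> (\<lambda>(s, e). s * (\<Prod>i\<in>{1..N}. int (ith_prime i) ^ e i)) ` ({1, - 1} \<times> Pi\<^sub>E {1..N} (\<lambda>_. {..N}))"
  then obtain s e where se: "s \<in> {1, - 1}" "e \<in> Pi\<^sub>E {1..N} (\<lambda>_. {..N})" "x = s * (\<Prod>i\<in>{1..N}. int (ith_prime i) ^ e i)" by auto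
  have "\<forall>i\<in>{1..N}. e i \<le> N" using se(2) by (auto dest: PiE_mem)
  then show "x \<in> mult_box N" unfolding mult_box_def using se(1,3) by blast
qed

lemma finite_mult_box: "finite (mult_box N)" and card_mult_box_le: "card (mult_box N) \<le> 2 * (N + 1) ^ N"
proof -
  let ?S = "{1, - 1 :: int} \<times> Pi\<^sub>E {1..N} (\<lambda>_. {..N})"
  have fin: "finite ?S" by (intro finite_cartesian_product finite_PiE) auto
  then show "finite (mult_box N)" unfolding mult_box_image by (rule finite_imageI)
  have "card (mult_box N) \<le> card ?S" unfolding mult_box_image using fin by (rule card_image_le)
  also have "\<dots> = 2 * (N + 1) ^ N" by (simp add: card_cartesian_product card_PiE)
  finally show "card (mult_box N) \<le> 2 * (N + 1) ^ N" .
qed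

text \<open>As \<open>t\<close> is invertible modulo \<open>q\<close>, the condition fixes the
  residue of \<open>e\<close>.\<close>

lemma card_residue_exponents:
  assumes q: "prime q" and t: "1 \<le> t" "t < q"
  shows "real (card {e. e \<le> N \<and> q dvd t * e + d}) \<le> real N / real q + 1"
proof -
  let ?E = "{e. e \<le> N \<and> q dvd t * e + d}"
  have q0: "q > 0" using q by (rule prime_gt_0_nat)
  have "inj_on (\<lambda>e. e div q) ?E"
  proof (rule inj_onI)
    fix e f assume e: "e \<in> ?E" and f: "f \<in> ?E" and eq: "e div q = f div q"
    have "[t * e + d = t * f + d] (mod q)" using e f by (metis (mono_tags, lifting) cong_0_iff cong_sym cong_trans mem_Collect_eq)
    then have "[t * e = t * f] (mod q)" by (simp add: cong_add_rcancel_nat)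
    moreover have "coprime t q" using q t by (rule coprime_below_prime)
    ultimately have "[e = f] (mod q)" by (simp add: cong_mult_lcancel_nat)
    then show "e = f" using eq by (metis cong_def div_mult_mod_eq)
  qed
  moreover have "(\<lambda>e. e div q) ` ?E \<subseteq> {..N div q}" by (auto intro: div_le_mono)
  ultimately have "card ?E \<le> card {..N div q}" by (rule card_inj_on_le) simp
  then have "real (card ?E) \<le> real (N div q + 1)" by (simp only: of_nat_le_iff) simp
  also have "\<dots> \<le> real N / real q + 1" using of_nat_div_le_of_nat[of N q, where 'a = real] by simp
  finally show ?thesis .
qed

text \<open>Every prime occurs in a \<open>q\<close>-th power with multiplicity divisible by
  \<open>q\<close>, so each of the \<open>N\<close> exponents is confined to one residue class
  modulo \<open>q\<close>; the factor 2 is the sign.\<close>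

lemma card_power_class_mult_box:
  assumes q: "prime q" and t: "1 \<le> t" "t < q" and D: "D \<noteq> 0"
  shows "real (card (power_class q (mult_box N) t D)) \<le> 2 * (real N / real q + 1) ^ N"
proof -
  define P where "P = (\<lambda>i. int (ith_prime i))"
  have pP: "prime (P i)" for i using prime_ith_prime by (simp add: P_def)
  have nz: "P i \<noteq> 0" for i using pP[of i] by auto
  define E where "E = (\<lambda>i. {e. e \<le> N \<and> q dvd t * e + multiplicity (P i) D})"
  let ?S = "{1, - 1 :: int} \<times> Pi\<^sub>E {1..N} E"
  have finE: "finite (E i)" for i unfolding E_def by (rule finite_subset[of _ "{..N}"]) auto
  have fin: "finite ?S" using finE by (intro finite_cartesian_product finite_PiE) auto
  have "power_class q (mult_box N) t D \<subseteq> (\<lambda>(s, e). s * (\<Prod>i\<in>{1..N}. P i ^ e i)) ` ?S"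
  proof
    fix a assume a: "a \<in> power_class q (mult_box N) t D"
    then obtain y where y: "a ^ t * D = y ^ q" and a0: "a \<noteq> 0" and aB: "a \<in> mult_box N" by (auto simp: power_class_def)
    obtain s e where se: "s \<in> {1, - 1}" "e \<in> Pi\<^sub>E {1..N} (\<lambda>_. {..N})" "a = s * (\<Prod>i\<in>{1..N}. P i ^ e i)"
    proof -
      obtain z where z: "z \<in> {1, - 1} \<times> Pi\<^sub>E {1..N} (\<lambda>_. {..N})"
        "a = (\<lambda>(s, e). s * (\<Prod>i\<in>{1..N}. P i ^ e i)) z"
        using aB unfolding mult_box_image P_def by blast
      then show thesis using that[of "fst z" "snd z"] by (cases z) (simp only: mem_Sigma_iff prod.case fst_conv snd_conv)
    qed
    have y0: "y \<noteq> 0"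
    proof
      assume "y = 0"
      then have "a ^ t * D = 0" using y prime_gt_0_nat[OF q] by simp
      then show False using a0 D by simp
    qed
    have "e i \<in> E i" if i: "i \<in> {1..N}" for i
    proof -
      have mi: "multiplicity (P i) (P j ^ e j) = (if j = i then e j else 0)" if j: "j \<in> {1..N}" for j
      proof (cases "j = i")
        case True
        moreover have "P i \<noteq> 0" "\<not> is_unit (P i)" using pP[of i] not_prime_unit[of "P i"] by auto
        ultimately show ?thesis by (simp add: multiplicity_same_power)
      next
        case False
        then have "P i \<noteq> P j" using ith_prime_inj[of i j] i j by (auto simp: P_def)
        then show ?thesis using False multiplicity_distinct_prime_power[OF pP pP] by simp
      qed
      have "multiplicity (P i) (\<Prod>j\<in>{1..N}. P j ^ e j) = (\<Sum>j\<in>{1..N}. multiplicity (P i) (P j ^ e j))"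
        by (rule prime_elem_multiplicity_prod_distrib[OF prime_imp_prime_elem[OF pP]]) (use nz in auto)
      also have "\<dots> = (\<Sum>j\<in>{1..N}. if j = i then e j else 0)" by (intro sum.cong refl mi)
      also have "\<dots> = e i" using i by simp
      finally have mp: "multiplicity (P i) (\<Prod>j\<in>{1..N}. P j ^ e j) = e i" .
      have "is_unit s" using se(1) by auto
      then have ma: "multiplicity (P i) a = e i" unfolding se(3) using mp by (simp only: multiplicity_times_unit_right)
      have pe: "prime_elem (P i)" by (rule prime_imp_prime_elem[OF pP])
      have m1: "multiplicity (P i) (a ^ t * D) = t * e i + multiplicity (P i) D"
        using prime_elem_multiplicity_mult_distrib[OF pe, of "a ^ t" D]
          prime_elem_multiplicity_power_distrib[OF pe a0, of t] ma a0 D by simp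
      have m2: "multiplicity (P i) (y ^ q) = q * multiplicity (P i) y"
        by (rule prime_elem_multiplicity_power_distrib[OF pe y0])
      have "q dvd t * e i + multiplicity (P i) D" unfolding m1[symmetric, unfolded y m2] by (rule dvd_triv_left)
      moreover have "e i \<le> N" using PiE_mem[OF se(2) i] by simp
      ultimately show ?thesis unfolding E_def by blast
    qed
    then have "e \<in> Pi\<^sub>E {1..N} E"
      using PiE_arb[OF se(2)] by (intro PiE_I)
    then show "a \<in> (\<lambda>(s, e). s * (\<Prod>i\<in>{1..N}. P i ^ e i)) ` ?S" using se(1,3) by (intro image_eqI[of _ _ "(s, e)"]) (simp_all only: prod.case mem_Sigma_iff simp_thms)
  qed
  then have "card (power_class q (mult_box N) t D) \<le> card ((\<lambda>(s, e). s * (\<Prod>i\<in>{1..N}. P i ^ e i)) ` ?S)"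
    using fin by (intro card_mono) auto
  also have "\<dots> \<le> card ?S" using fin by (rule card_image_le)
  also have "\<dots> = 2 * (\<Prod>i\<in>{1..N}. card (E i))" by (simp add: card_cartesian_product card_PiE)
  finally have "real (card (power_class q (mult_box N) t D)) \<le> real (2 * (\<Prod>i\<in>{1..N}. card (E i)))" by (simp only: of_nat_le_iff)
  also have "\<dots> = 2 * (\<Prod>i\<in>{1..N}. real (card (E i)))" by simp
  also have "\<dots> \<le> 2 * (\<Prod>i\<in>{1..N}. real N / real q + 1)"
    unfolding E_def by (intro mult_left_mono prod_mono conjI card_residue_exponents q t) auto
  finally show ?thesis by simp
qed


section \<open>The quantitative bounds and the densities\<close>

lemma S_qk_add_box_bound:
  assumes q: "prime q"
  obtains a :: real where "a > 0" "\<And>N. N \<ge> 1 \<Longrightarrow> real (card (S_qk q k \<inter> k_subsets k (add_box N))) \<le> a * real N powr (real k - (1 - 1 / real q))"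
proof (cases "k = 0")
  case True
  then show thesis using that[of 1] S_qk_0[OF q] by simp
next
  case False
  \<comment> \<open>The box has at most \<open>3 * N\<close> elements and a power class at most 3
    times the \<open>q\<close>-th root of \<open>N\<close>.\<close>
  define a where "a = 3 ^ (k - 1) * (1 + 3 * real q ^ k)"
  have a0: "a > 0" by (simp add: a_def add_pos_nonneg)
  have "real (card (S_qk q k \<inter> k_subsets k (add_box N))) \<le> a * real N powr (real k - (1 - 1 / real q))" if N: "N \<ge> 1" for N
  proof -
    define \<rho> where "\<rho> = real N powr (1 / real q)"
    have \<rho>1: "\<rho> \<ge> 1" unfolding \<rho>_def using N by (intro ge_one_powr_ge_zero) auto
    have N0: "real N > 0" using N by simp
    have cX: "real (card (add_box N)) = 2 * real N + 1" by (simp add: add_box_def)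
    have "real (card (S_qk q k \<inter> k_subsets k (add_box N))) \<le> real (card (add_box N)) ^ (k - 1) * (1 + real q ^ k * (3 * \<rho>))"
    proof (rule card_S_qk_le[OF q])
      show "real (card (power_class q (add_box N) t D)) \<le> 3 * \<rho>" if "1 \<le> t" "t < q" "D \<noteq> 0" for t D
        unfolding \<rho>_def by (rule card_power_class_add_box[OF q that N])
    qed (use False \<rho>1 in \<open>auto simp: add_box_def\<close>)
    also have "\<dots> \<le> (3 * real N) ^ (k - 1) * ((1 + 3 * real q ^ k) * \<rho>)"
    proof (intro mult_mono power_mono)
      show "real (card (add_box N)) \<le> 3 * real N" unfolding cX using N by simp
      show "1 + real q ^ k * (3 * \<rho>) \<le> (1 + 3 * real q ^ k) * \<rho>" using \<rho>1 by (simp add: algebra_simps)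
    qed (use \<rho>1 in auto)
    also have "\<dots> = a * (real N ^ (k - 1) * \<rho>)" by (simp add: a_def power_mult_distrib mult_ac)
    also have "real N ^ (k - 1) * \<rho> = real N powr (real (k - 1) + 1 / real q)"
      using N0 by (simp add: powr_add powr_realpow \<rho>_def)
    also have "real (k - 1) + 1 / real q = real k - (1 - 1 / real q)" using False by (simp add: of_nat_diff)
    finally show ?thesis .
  qed
  with a0 that show thesis by blast
qed

text \<open>For \<open>k \<ge> 1\<close> and \<open>N \<ge> k\<close> the binomial coefficient is at
  least \<open>(N / k) ^ k\<close>, so the ratio is of order \<open>N\<close> to the power
  \<open>- (1 - 1 / q)\<close>.\<close>

lemma add_density_zero:
  assumes q: "prime q"
  shows "add_subset_density k (S_qk q k) 0"
proof (cases "k = 0")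
  case True
  then show ?thesis unfolding add_subset_density_def by (simp add: S_qk_0[OF q])
next
  case False
  obtain a :: real where a: "a > 0" "\<And>N. N \<ge> 1 \<Longrightarrow> real (card (S_qk q k \<inter> k_subsets k (add_box N))) \<le> a * real N powr (real k - (1 - 1 / real q))"
    by (rule S_qk_add_box_bound[OF q, of k]) blast
  have q1: "real q > 1" using prime_gt_1_nat[OF q] by simp
  have e: "1 - 1 / real q > 0" using q1 by simp
  show ?thesis unfolding add_subset_density_def
  proof (rule tendsto_sandwich[where f = "\<lambda>_. 0" and h = "\<lambda>N. a * real k ^ k * real N powr (- (1 - 1 / real q))"])
    show "\<forall>\<^sub>F N in sequentially. 0 \<le> real (card (S_qk q k \<inter> k_subsets k (add_box N))) / real ((2 * N + 1) choose k)"
      by (intro always_eventually allI) simp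
    show "\<forall>\<^sub>F N in sequentially. real (card (S_qk q k \<inter> k_subsets k (add_box N))) / real ((2 * N + 1) choose k) \<le> a * real k ^ k * real N powr (- (1 - 1 / real q))"
      using eventually_ge_at_top[of k]
    proof eventually_elim
      case (elim N)
      have N: "N \<ge> 1" "real N > 0" using elim False by auto
      have k0: "real k > 0" using False by simp
      have "(real N / real k) ^ k \<le> (real (2 * N + 1) / real k) ^ k" by (intro power_mono divide_right_mono) auto
      also have "\<dots> \<le> real ((2 * N + 1) choose k)"
        using binomial_ge_n_over_k_pow_k[of k "2 * N + 1", where 'a = real] elim by simp
      finally have c: "(real N / real k) ^ k \<le> real ((2 * N + 1) choose k)" .
      have "real (card (S_qk q k \<inter> k_subsets k (add_box N))) / real ((2 * N + 1) choose k) \<le> (a * real N powr (real k - (1 - 1 / real q))) / (real N / real k) ^ k"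
        using a(2)[OF N(1)] a(1) c N(2) k0 by (intro frac_le) auto
      also have "\<dots> = a * real k ^ k * (real N powr (real k - (1 - 1 / real q)) / real N powr real k)"
        using N(2) by (simp add: power_divide powr_realpow)
      also have "real N powr (real k - (1 - 1 / real q)) / real N powr real k = real N powr (- (1 - 1 / real q))"
        by (simp flip: powr_diff)
      finally show ?case .
    qed
    have "(\<lambda>N. real N powr (- (1 - 1 / real q))) \<longlonglongrightarrow> 0"
      using e by (intro tendsto_neg_powr filterlim_real_sequentially) auto
    from tendsto_mult_left[OF this, of "a * real k ^ k"]
    show "(\<lambda>N. a * real k ^ k * real N powr (- (1 - 1 / real q))) \<longlonglongrightarrow> 0" by simp
  qed simp
qed

text \<open>Replaces \<open>(N + 1) ^ N\<close> and \<open>(N + q) ^ N\<close> by constant multiples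
  of \<open>N ^ N\<close>; this is where the constant of the multiplicative bound comes
  from.\<close>

lemma one_plus_power_le_exp:
  fixes x :: real assumes "x \<ge> 0" "N \<ge> 1"
  shows "(real N + x) ^ N \<le> exp x * real N ^ N"
proof -
  have "real N + x = real N * (1 + x / real N)" using assms by (simp add: field_simps)
  then have eq: "(real N + x) ^ N = (1 + x / real N) ^ N * real N ^ N" by (simp only: power_mult_distrib mult.commute)
  have "(1 + x / real N) ^ N \<le> exp (x / real N) ^ N"
    using assms by (intro power_mono exp_ge_add_one_self) auto
  also have "exp (x / real N) ^ N = exp x" using assms by (simp flip: exp_of_nat_mult)
  finally show ?thesis unfolding eq by (intro mult_right_mono) auto
qed

lemma S_qk_mult_box_bound:
  assumes q: "prime q"
  obtains m :: real where "m > 0" "\<And>N. N \<ge> 1 \<Longrightarrow> real (card (S_qk q k \<inter> k_subsets k (mult_box N))) \<le> m * real N ^ (N * k) / real q ^ N"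
proof (cases "k = 0")
  case True
  then show thesis using that[of 1] S_qk_0[OF q] by simp
next
  case False
  have q0: "real q > 0" using prime_gt_0_nat[OF q] by simp
  \<comment> \<open>\<open>2 * exp 1\<close> comes from the size \<open>2 * (N + 1) ^ N\<close> of
    the box, and \<open>exp (real q)\<close> from \<open>(N / q + 1) ^ N\<close>, which is
    \<open>(N + q) ^ N / q ^ N\<close>.\<close>
  define m where "m = (2 * exp 1) ^ (k - 1) * ((1 + 2 * real q ^ k) * exp (real q))"
  have m0: "m > 0" by (simp add: m_def add_pos_nonneg)
  have "real (card (S_qk q k \<inter> k_subsets k (mult_box N))) \<le> m * real N ^ (N * k) / real q ^ N" if N: "N \<ge> 1" for N
  proof -
    define \<mu> where "\<mu> = (real N / real q + 1) ^ N"
    have l1: "\<mu> \<ge> 1" unfolding \<mu>_def by (intro one_le_power) simp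
    have lq: "\<mu> \<le> exp (real q) * real N ^ N / real q ^ N"
    proof -
      have "real N / real q + 1 = (real N + real q) / real q" using q0 by (simp add: field_simps)
      then have "\<mu> = (real N + real q) ^ N / real q ^ N" by (simp add: \<mu>_def power_divide)
      also have "\<dots> \<le> exp (real q) * real N ^ N / real q ^ N"
        using q0 N by (intro divide_right_mono one_plus_power_le_exp) auto
      finally show ?thesis .
    qed
    have cX: "real (card (mult_box N)) \<le> 2 * exp 1 * real N ^ N"
    proof -
      have "real (card (mult_box N)) \<le> real (2 * (N + 1) ^ N)" using card_mult_box_le by (simp only: of_nat_le_iff)
      also have "\<dots> = 2 * (real N + 1) ^ N" by (simp add: add.commute)
      also have "\<dots> \<le> 2 * (exp 1 * real N ^ N)" using N by (intro mult_left_mono one_plus_power_le_exp) auto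
      finally show ?thesis by simp
    qed
    have "real (card (S_qk q k \<inter> k_subsets k (mult_box N))) \<le> real (card (mult_box N)) ^ (k - 1) * (1 + real q ^ k * (2 * \<mu>))"
    proof (rule card_S_qk_le[OF q finite_mult_box])
      show "real (card (power_class q (mult_box N) t D)) \<le> 2 * \<mu>" if "1 \<le> t" "t < q" "D \<noteq> 0" for t D
        unfolding \<mu>_def by (rule card_power_class_mult_box[OF q that])
    qed (use False l1 in auto)
    also have "\<dots> \<le> (2 * exp 1 * real N ^ N) ^ (k - 1) * ((1 + 2 * real q ^ k) * (exp (real q) * real N ^ N / real q ^ N))"
    proof (intro mult_mono power_mono cX)
      have "1 + real q ^ k * (2 * \<mu>) \<le> (1 + 2 * real q ^ k) * \<mu>" using l1 by (simp add: algebra_simps)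
      also have "\<dots> \<le> (1 + 2 * real q ^ k) * (exp (real q) * real N ^ N / real q ^ N)" by (intro mult_left_mono lq) auto
      finally show "1 + real q ^ k * (2 * \<mu>) \<le> (1 + 2 * real q ^ k) * (exp (real q) * real N ^ N / real q ^ N)" .
    qed (use l1 in auto)
    also have "\<dots> = m * ((real N ^ N) ^ (k - 1) * real N ^ N) / real q ^ N"
      by (simp add: m_def power_mult_distrib mult_ac)
    also have "(real N ^ N) ^ (k - 1) * real N ^ N = (real N ^ N) ^ k"
      by (rule power_minus_mult) (use False in simp)
    also have "(real N ^ N) ^ k = real N ^ (N * k)" by (simp add: power_mult)
    finally show ?thesis .
  qed
  with m0 that show thesis by blast
qed

lemma mult_density_zero:
  assumes q: "prime q"
  shows "mult_subset_density k (S_qk q k) 0"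
proof (cases "k = 0")
  case True
  then show ?thesis unfolding mult_subset_density_def by (simp add: S_qk_0[OF q])
next
  case False
  obtain m :: real where m: "m > 0" "\<And>N. N \<ge> 1 \<Longrightarrow> real (card (S_qk q k \<inter> k_subsets k (mult_box N))) \<le> m * real N ^ (N * k) / real q ^ N"
    by (rule S_qk_mult_box_bound[OF q, of k]) blast
  have q1: "real q > 1" using prime_gt_1_nat[OF q] by simp
  have k0: "real k > 0" using False by simp
  show ?thesis unfolding mult_subset_density_def
  proof (rule tendsto_sandwich[where f = "\<lambda>_. 0" and h = "\<lambda>N. m * real k ^ k * (1 / real q) ^ N"])
    show "\<forall>\<^sub>F N in sequentially. 0 \<le> real (card (S_qk q k \<inter> k_subsets k (mult_box N))) / real ((2 * (N + 1) ^ N) choose k)"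
      by (intro always_eventually allI) simp
    show "\<forall>\<^sub>F N in sequentially. real (card (S_qk q k \<inter> k_subsets k (mult_box N))) / real ((2 * (N + 1) ^ N) choose k) \<le> m * real k ^ k * (1 / real q) ^ N"
      using eventually_ge_at_top[of k]
    proof eventually_elim
      case (elim N)
      have N: "N \<ge> 1" "real N > 0" using elim False by auto
      define M where "M = 2 * (N + 1) ^ N"
      have "N + 1 \<le> (N + 1) ^ N" using N by (intro self_le_power) auto
      then have kM: "k \<le> M" using elim by (simp add: M_def)
      have "real N ^ N \<le> (real N + 1) ^ N" by (intro power_mono) auto
      also have "\<dots> \<le> real M" by (simp add: M_def add.commute)
      finally have "(real N ^ N / real k) ^ k \<le> (real M / real k) ^ k" by (intro power_mono divide_right_mono) auto
      also have "\<dots> \<le> real (M choose k)" using binomial_ge_n_over_k_pow_k[OF kM, where 'a = real] by simp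
      finally have c: "(real N ^ N / real k) ^ k \<le> real (M choose k)" .
      have pos: "(real N ^ N / real k) ^ k > 0" using N(2) k0 by simp
      have "real (card (S_qk q k \<inter> k_subsets k (mult_box N))) / real (M choose k) \<le> (m * real N ^ (N * k) / real q ^ N) / (real N ^ N / real k) ^ k"
        using m(2)[OF N(1)] m(1) c pos by (intro frac_le) auto
      also have "\<dots> = m * real k ^ k * (1 / real q) ^ N"
        using N(2) k0 by (simp add: power_divide power_mult)
      finally show ?case unfolding M_def .
    qed
    have "(\<lambda>N. (1 / real q) ^ N) \<longlonglongrightarrow> 0" using q1 by (intro LIMSEQ_realpow_zero) auto
    from tendsto_mult_left[OF this, of "m * real k ^ k"]
    show "(\<lambda>N. m * real k ^ k * (1 / real q) ^ N) \<longlonglongrightarrow> 0" by simp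
  qed simp
qed

theorem theorem1:
  fixes q k :: nat
  assumes "prime q"
  shows "add_subset_density k (S_qk q k) 0
       \<and> (\<exists>a::real. a > 0 \<and> (\<forall>N::nat. N \<ge> 1 \<longrightarrow>
            real (card (S_qk q k \<inter> k_subsets k (add_box N)))
              \<le> a * real N powr (real k - (1 - 1 / real q))))
       \<and> mult_subset_density k (S_qk q k) 0
       \<and> (\<exists>m::real. m > 0 \<and> (\<forall>N::nat. N \<ge> 1 \<longrightarrow>
            real (card (S_qk q k \<inter> k_subsets k (mult_box N)))
              \<le> m * real N ^ (N * k) / real q ^ N))"
proof (intro conjI)
  show "add_subset_density k (S_qk q k) 0" by (rule add_density_zero[OF assms])
  show "mult_subset_density k (S_qk q k) 0" by (rule mult_density_zero[OF assms])
  show "\<exists>a::real. a > 0 \<and> (\<forall>N::nat. N \<ge> 1 \<longrightarrow>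
      real (card (S_qk q k \<inter> k_subsets k (add_box N))) \<le> a * real N powr (real k - (1 - 1 / real q)))"
    by (rule S_qk_add_box_bound[OF assms, of k]) blast
  show "\<exists>m::real. m > 0 \<and> (\<forall>N::nat. N \<ge> 1 \<longrightarrow>
      real (card (S_qk q k \<inter> k_subsets k (mult_box N))) \<le> m * real N ^ (N * k) / real q ^ N)"
    by (rule S_qk_mult_box_bound[OF assms, of k]) blast
qed

end
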